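(* Let $H=-\Delta+V$, $e_1<e_2$, $\phi_j(z)$, $E_j$, $a_0$, $\delta_0$ be as in the context (in particular $e_1+n(e_2-e_1)\notin[0,4]$ for all $n\in\mathbb Z$). There exist $a_1\in(0,a_0)$, $\delta_1\in(0,\delta_0)$ and functions $$\psi\in C^\omega\left(B_{\mathbb C^2}(\delta_1);\,l_e^{a_1}(\mathbb Z;\mathbb C)\right),\qquad \varepsilon_j\in C^\omega\left(B_{\mathbb R^2}(\delta_1^2);\mathbb R\right)\quad(j=1,2)$$ such that $$\Psi(z_1,z_2):=\phi_1(z_1)+\phi_2(z_2)+\psi(z_1,z_2)$$ is a solution of $\mathrm i\partial_t u=Hu+|u|^6u$ whenever $z_1=z_1(t)$, $z_2=z_2(t)$ (with $(z_1,z_2)\in B_{\mathbb C^2}(\delta_1)$) satisfy $$\mathrm i\,\dot z_j=\left(E_j(|z_j|^2)+\varepsilon_j(|z_1|^2,|z_2|^2)\right)z_j,\qquad j=1,2.$$ Further, for every $\theta\in\mathbb R$ and $(z_1,z_2)\in B_{\mathbb C^2}(\delta_1)$, $$e^{\mathrm i\theta}\psi(z_1,z_2)=\psi(e^{\mathrm i\theta}z_1,e^{\mathrm i\theta}z_2),$$ and $$\|\psi(z_1,z_2)\|_{l_e^{a_1}}\lesssim|z_1||z_2|(|z_1|^5+|z_2|^5),\qquad |\varepsilon_j(|z_1|^2,|z_2|^2)|\lesssim|z_{3-j}|^2(|z_1|^4+|z_2|^4)\quad(j=1,2).$$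
   Context: Setting. $(\Delta u)(n)=u(n+1)-2u(n)+u(n-1)$ is the discrete Laplacian on $\mathbb Z$; $V:\mathbb Z\to\mathbb R$ satisfies $\sum_{n\in\mathbb Z}(1+|n|^2)^{1/2}|V(n)|<\infty$; $H=-\Delta+V$ on $l^2(\mathbb Z;\mathbb C)$. The discrete spectrum of $H$ is $\sigma_d(H)=\{e_1<e_2\}$, and $e_1+n(e_2-e_1)\notin[0,4]$ for all $n\in\mathbb Z$. $\phi_1,\phi_2$ are $l^2$-normalized real-valued eigenfunctions for $e_1,e_2$. The equation is $\mathrm i\partial_tu=Hu+|u|^6u$, $u:\mathbb R\times\mathbb Z\to\mathbb C$. Notation. $\langle u,v\rangle=\mathrm{Re}\sum_{n}u(n)\overline{v(n)}$. For $a\in\mathbb R$, $\|u\|_{l_e^a}^2=\sum_n e^{2a|n|}|u(n)|^2$ and $l_e^a$ is the space of sequences with finite norm. $B_X(\delta)$ is the open ball of radius $\delta$ about $0$ in the Banach space $X$. $C^\omega(B_X(\delta);Y)$ is the set of $f:B_X(\delta)\to Y$ of the form $f(x)=\sum_{n\ge0}a_nx^n$, $a_n$ bounded ($\mathbb R$-)$n$-linear maps $X^n\to Y$, $a_nx^n=a_n(x,\dots,x)$, with $\sum_n\|a_n\|r^n<\infty$ for all $r<\delta$ ($\mathbb C^2$ is regarded as $\mathbb R^4$). $a\lesssim b$ means $a\le Cb$ for a constant $C$. Nonlinear bound states. There are $a_0,\delta_0>0$ and, for $j=1,2$, fixed functions $\tilde e_j\in C^\omega(B_{\mathbb R}(\delta_0^2);\mathbb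 R)$ and $q_j\in C^\omega(B_{\mathbb R}(\delta_0^2);l_e^{a_0}(\mathbb Z;\mathbb R))$ with $\langle\phi_j,q_j\rangle=0$, such that for $z\in B_{\mathbb C}(\delta_0)$, $\phi_j(z):=z(\phi_j+q_j(|z|^2))$ satisfies $(H-E_j(|z|^2))\phi_j(z)+|\phi_j(z)|^6\phi_j(z)=0$ with $E_j(|z|^2)=e_j+\tilde e_j(|z|^2)$, and $|\tilde e_j(|z|^2)|+\|q_j(|z|^2)\|_{l_e^{a_0}}\lesssim|z|^6$. *)

theory Defs
  imports "HOL-Analysis.Analysis" "HOL-Library.Function_Algebras"
begin

text \<open>Functions carry the pointwise real vector space structure, so that \<^term>\<open>linear\<close> and
  \<^term>\<open>span\<close> apply to sequences on the integers.\<close>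

instantiation "fun" :: (type, real_vector) real_vector
begin

definition scaleR_fun_def: "c *\<^sub>R f = (\<lambda>x. c *\<^sub>R f x)"

instance
  by standard (auto simp: scaleR_fun_def fun_eq_iff scaleR_add_left scaleR_add_right)

end

lemma scaleR_fun_apply [simp]: "(c *\<^sub>R f) x = c *\<^sub>R f x"
  by (simp add: scaleR_fun_def)


text \<open>A normed space of sequences is given by its carrier \<open>Y\<close> together with a norm function \<open>N\<close>.
  The norm \<^term>\<open>le_norm\<close> below is meaningful only on \<^term>\<open>le_space\<close>, because an infinite sum
  that does not converge has the value 0 by convention.\<close>

definition le_space :: "real \<Rightarrow> (int \<Rightarrow> 'b::real_normed_vector) set" where
  "le_space a = {u. (\<lambda>n. exp (2 * a * \<bar>real_of_int n\<bar>) * (norm (u n))\<^sup>2) summable_on UNIV}"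

definition le_norm :: "real \<Rightarrow> (int \<Rightarrow> 'b::real_normed_vector) \<Rightarrow> real" where
  "le_norm a u = sqrt (\<Sum>\<^sub>\<infinity>n. exp (2 * a * \<bar>real_of_int n\<bar>) * (norm (u n))\<^sup>2)"

abbreviation l2_space :: "(int \<Rightarrow> 'b::real_normed_vector) set" where
  "l2_space \<equiv> le_space 0"

abbreviation l2_norm :: "(int \<Rightarrow> 'b::real_normed_vector) \<Rightarrow> real" where
  "l2_norm \<equiv> le_norm 0"

text \<open>For complex sequences the summand is \<open>Re (u n * cnj (v n))\<close>.\<close>

definition l2_inner :: "(int \<Rightarrow> 'b::real_inner) \<Rightarrow> (int \<Rightarrow> 'b) \<Rightarrow> real" where
  "l2_inner u v = (\<Sum>\<^sub>\<infinity>n. u n \<bullet> v n)"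


definition nlinear :: "nat \<Rightarrow> ((nat \<Rightarrow> 'a::real_vector) \<Rightarrow> 'b::real_vector) \<Rightarrow> bool" where
  \<comment> \<open>An \<open>n\<close>-linear map takes its arguments as a sequence of which only the first \<open>n\<close> entries matter.\<close>
  "nlinear n A \<longleftrightarrow>
     (\<forall>x y. (\<forall>i<n. x i = y i) \<longrightarrow> A x = A y) \<and>
     (\<forall>x. \<forall>i<n. linear (\<lambda>v. A (x(i := v))))"

definition nlinear_bounds ::
    "nat \<Rightarrow> ('b \<Rightarrow> real) \<Rightarrow> ((nat \<Rightarrow> 'a::real_normed_vector) \<Rightarrow> 'b) \<Rightarrow> real set" where
  "nlinear_bounds n N A = {C. 0 \<le> C \<and> (\<forall>x. N (A x) \<le> C * (\<Prod>i<n. norm (x i)))}"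

definition bounded_nlinear ::
    "nat \<Rightarrow> 'b::real_vector set \<Rightarrow> ('b \<Rightarrow> real) \<Rightarrow> ((nat \<Rightarrow> 'a::real_normed_vector) \<Rightarrow> 'b) \<Rightarrow> bool" where
  "bounded_nlinear n Y N A \<longleftrightarrow> nlinear n A \<and> range A \<subseteq> Y \<and> nlinear_bounds n N A \<noteq> {}"

definition nlinear_norm ::
    "nat \<Rightarrow> ('b \<Rightarrow> real) \<Rightarrow> ((nat \<Rightarrow> 'a::real_normed_vector) \<Rightarrow> 'b) \<Rightarrow> real" where
  "nlinear_norm n N A = Inf (nlinear_bounds n N A)"

text \<open>The class \<open>C\<^sup>\<omega>(B\<^sub>X(\<delta>); Y)\<close>. The product type carries the Euclidean norm, so
  \<^typ>\<open>complex \<times> complex\<close> is 4-dimensional real Euclidean space.\<close>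

definition analytic_on_ball ::
    "'b::real_vector set \<Rightarrow> ('b \<Rightarrow> real) \<Rightarrow> real \<Rightarrow> ('a::real_normed_vector \<Rightarrow> 'b) \<Rightarrow> bool" where
  "analytic_on_ball Y N \<delta> f \<longleftrightarrow>
     (\<exists>A :: nat \<Rightarrow> (nat \<Rightarrow> 'a) \<Rightarrow> 'b.
        (\<forall>n. bounded_nlinear n Y N (A n)) \<and>
        (\<forall>r. 0 \<le> r \<and> r < \<delta> \<longrightarrow> summable (\<lambda>n. nlinear_norm n N (A n) * r ^ n)) \<and>
        (\<forall>x\<in>ball 0 \<delta>. f x \<in> Y \<and> (\<lambda>m. N (f x - (\<Sum>n<m. A n (\<lambda>_. x)))) \<longlonglongrightarrow> 0))"


definition lap :: "(int \<Rightarrow> 'b::real_vector) \<Rightarrow> int \<Rightarrow> 'b" where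
  "lap u n = u (n + 1) - 2 *\<^sub>R u n + u (n - 1)"

definition schroedinger :: "(int \<Rightarrow> real) \<Rightarrow> (int \<Rightarrow> 'b::real_vector) \<Rightarrow> int \<Rightarrow> 'b" where
  "schroedinger V u n = - lap u n + V n *\<^sub>R u n"

definition spectrum_on ::
    "(int \<Rightarrow> complex) set \<Rightarrow> ((int \<Rightarrow> complex) \<Rightarrow> real) \<Rightarrow> ((int \<Rightarrow> complex) \<Rightarrow> int \<Rightarrow> complex) \<Rightarrow> complex set"
  where
  "spectrum_on Y N T =
     {l. \<not> (bij_betw (\<lambda>u n. T u n - l * u n) Y Y \<and>
            (\<exists>C. \<forall>u\<in>Y. N u \<le> C * N (\<lambda>n. T u n - l * u n)))}"

definition eigenspace_on ::
    "(int \<Rightarrow> complex) set \<Rightarrow> ((int \<Rightarrow> complex) \<Rightarrow> int \<Rightarrow> complex) \<Rightarrow> complex \<Rightarrow> (int \<Rightarrow> complex) set" where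
  "eigenspace_on Y T l = {u \<in> Y. \<forall>n. T u n = l * u n}"

text \<open>Isolated points of the spectrum that are eigenvalues of finite multiplicity. The span is over
  the reals, which makes no difference to finite-dimensionality; for selfadjoint \<open>T\<close> algebraic and
  geometric multiplicities coincide.\<close>

definition discrete_spectrum_on ::
    "(int \<Rightarrow> complex) set \<Rightarrow> ((int \<Rightarrow> complex) \<Rightarrow> real) \<Rightarrow> ((int \<Rightarrow> complex) \<Rightarrow> int \<Rightarrow> complex) \<Rightarrow> complex set"
  where
  "discrete_spectrum_on Y N T =
     {l. l isolated_in spectrum_on Y N T \<and>
         eigenspace_on Y T l \<noteq> {0} \<and>
         (\<exists>B. finite B \<and> eigenspace_on Y T l \<subseteq> span B)}"


text \<open>Here \<open>u\<close> is a solution in the sense of a curve in \<open>l\<^sup>2\<close> that is differentiable in the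
  \<open>l\<^sup>2\<close> norm; in particular it is differentiable at each site.\<close>

definition has_l2_derivative ::
    "(real \<Rightarrow> int \<Rightarrow> complex) \<Rightarrow> (int \<Rightarrow> complex) \<Rightarrow> real \<Rightarrow> bool" where
  "has_l2_derivative u D t \<longleftrightarrow>
     D \<in> l2_space \<and> ((\<lambda>s. l2_norm ((1 / (s - t)) *\<^sub>R (u s - u t) - D)) \<longlongrightarrow> 0) (at t)"

definition dnls_solution :: "(int \<Rightarrow> real) \<Rightarrow> real set \<Rightarrow> (real \<Rightarrow> int \<Rightarrow> complex) \<Rightarrow> bool" where
  "dnls_solution V I u \<longleftrightarrow>
     (\<forall>t\<in>I. u t \<in> l2_space) \<and>
     (\<forall>t\<in>I. \<exists>D. has_l2_derivative u D t \<and>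
        (\<forall>n. \<i> * D n = schroedinger V (u t) n + of_real (cmod (u t n) ^ 6) * u t n))"


definition bound_state ::
    "(int \<Rightarrow> real) \<Rightarrow> (real \<Rightarrow> int \<Rightarrow> real) \<Rightarrow> complex \<Rightarrow> int \<Rightarrow> complex" where
  "bound_state \<phi> q z n = z * of_real (\<phi> n + q ((cmod z)\<^sup>2) n)"

text \<open>The family of nonlinear bound states bifurcating from the eigenvalue \<open>e\<close> with eigenfunction
  \<open>\<phi>\<close>; \<open>et\<close> is the correction of the eigenvalue.\<close>

definition bound_state_family ::
    "(int \<Rightarrow> real) \<Rightarrow> real \<Rightarrow> (int \<Rightarrow> real) \<Rightarrow> real \<Rightarrow> real \<Rightarrow> (real \<Rightarrow> real) \<Rightarrow> (real \<Rightarrow> int \<Rightarrow> real) \<Rightarrow> bool"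
  where
  "bound_state_family V e \<phi> a \<delta> et q \<longleftrightarrow>
     analytic_on_ball UNIV norm (\<delta>\<^sup>2) et \<and>
     analytic_on_ball (le_space a) (le_norm a) (\<delta>\<^sup>2) q \<and>
     (\<forall>s\<in>ball 0 (\<delta>\<^sup>2). l2_inner \<phi> (q s) = 0) \<and>
     (\<forall>z\<in>ball 0 \<delta>. \<forall>n.
        schroedinger V (bound_state \<phi> q z) n - of_real (e + et ((cmod z)\<^sup>2)) * bound_state \<phi> q z n
        + of_real (cmod (bound_state \<phi> q z n) ^ 6) * bound_state \<phi> q z n = 0) \<and>
     (\<exists>C. \<forall>z\<in>ball 0 \<delta>. \<bar>et ((cmod z)\<^sup>2)\<bar> + le_norm a (q ((cmod z)\<^sup>2)) \<le> C * cmod z ^ 6)"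

end

theory Submission
  imports Defs
begin

text \<open>On an orbit of the reduced system the moduli of \<open>z1\<close>, \<open>z2\<close> are constant, so \<open>\<psi>\<close> is sought as a power
  series in \<open>z1\<close>, \<open>cnj z1\<close>, \<open>z2\<close>, \<open>cnj z2\<close> whose gauge-covariant monomials carry the frequencies
  \<open>e1 + m (e2 - e1)\<close> to leading order. For \<open>m\<close> other than 0 and 1 these lie in the resolvent set of
  \<open>H\<close>: outside \<open>[0,4]\<close> the operator is a finite-rank perturbation of a diagonally dominant one, hence a
  real point of the spectrum there is a simple eigenvalue, isolated, and thus in the discrete spectrum.
  The resolvents act on the exponentially weighted spaces with norms of order \<open>1 / \<bar>m\<bar>\<close>, which pays for
  the factor \<open>m\<close> produced by the time derivative. For \<open>m\<close> equal to 0 and 1 the equation is solvable modulo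
  the eigenfunction, and its multiple determines the frequency correction.

  The resulting fixed-point map on coefficients maps a ball of absolutely summable series into itself
  and raises the degree, so its iterates stabilise in each degree; the limit stays in the ball by
  testing finite sums, and neither completeness nor a contraction estimate is needed.\<close>



section \<open>Weighted sequence spaces\<close>

text \<open>The amplitude-dependent frequencies are kept out of the inverted operators, which are
  those at zero amplitude. The frequency corrections, multiplied by \<open>1 - m\<close> or
  \<open>m\<close> and by \<psi>, go to the right-hand side, and a weight
  \<open>1 + \<bar>m\<bar>\<close> in the norm of \<psi> absorbs these factors. H is real, so all
  coefficients are real sequences and complex conjugation only permutes exponents. Each bound state
  solves its own equation; the single-mode part of the nonlinearity therefore cancels, and \<psi>
  contains only monomials in both modes, whence the factor |z1| |z2| in its estimate. The exponent a
  of the space must serve all m at once: finitely many m are treated by letting a tend to 0, the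
  others by diagonal dominance uniformly for a \<le> 1. The constants K (resolvents) and B (data)
  are fixed before the radius r: on a ball of size r^2 for \<psi> and r for \<epsilon> the
  right-hand side has size r^3, so smallness of r closes the argument. The component of \<psi> along
  an eigenfunction is not normalised; any solution with the norm bound serves.\<close>

abbreviation wt :: "real \<Rightarrow> int \<Rightarrow> real" where
  "wt a n \<equiv> exp (a * \<bar>real_of_int n\<bar>)"

lemma le_weight: "exp (2 * a * \<bar>real_of_int n\<bar>) * (norm x)\<^sup>2 = (wt a n * norm x)\<^sup>2"
proof -
  have "exp (2 * a * \<bar>real_of_int n\<bar>) = exp (a * \<bar>real_of_int n\<bar>) * exp (a * \<bar>real_of_int n\<bar>)"
    by (simp flip: exp_add)
  then show ?thesis
    by (simp add: power2_eq_square)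
qed

text \<open>Membership and norm bound come together from finite sections. The norm alone would prove
  nothing, since a divergent \<open>infsum\<close> has the value 0.\<close>

lemma le_normI:
  fixes u :: "int \<Rightarrow> 'b::real_normed_vector"
  assumes "\<And>F. finite F \<Longrightarrow> L2_set (\<lambda>n. wt a n * norm (u n)) F \<le> C"
  shows "u \<in> le_space a" "le_norm a u \<le> C"
proof -
  have C: "0 \<le> C" using assms[of "{}"] by simp
  have b: "(\<Sum>n\<in>F. exp (2 * a * \<bar>real_of_int n\<bar>) * (norm (u n))\<^sup>2) \<le> C\<^sup>2" if "finite F" for F
    using power_mono[OF assms[OF that], of 2]
    by (simp add: L2_set_def le_weight sum_nonneg)
  have s: "(\<lambda>n. exp (2 * a * \<bar>real_of_int n\<bar>) * (norm (u n))\<^sup>2) summable_on UNIV"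
    by (rule nonneg_bdd_above_summable_on) (auto intro!: bdd_aboveI2[where M = "C\<^sup>2"] b)
  then show "u \<in> le_space a" by (simp add: le_space_def)
  have "(\<Sum>\<^sub>\<infinity>n. exp (2 * a * \<bar>real_of_int n\<bar>) * (norm (u n))\<^sup>2) \<le> C\<^sup>2"
    by (rule infsum_le_finite_sums[OF s]) (use b in auto)
  then show "le_norm a u \<le> C"
    unfolding le_norm_def using real_sqrt_le_mono[of _ "C\<^sup>2"] C by fastforce
qed

lemma L2_set_le_le_norm:
  fixes u :: "int \<Rightarrow> 'b::real_normed_vector"
  assumes "u \<in> le_space a" "finite F"
  shows "L2_set (\<lambda>n. wt a n * norm (u n)) F \<le> le_norm a u"
  using finite_sum_le_infsum[of "\<lambda>n. exp (2 * a * \<bar>real_of_int n\<bar>) * (norm (u n))\<^sup>2" UNIV F] assms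
  by (auto simp: le_space_def le_norm_def L2_set_def le_weight)

lemma le_norm_nonneg [simp]: "0 \<le> le_norm a u"
  by (simp add: le_norm_def infsum_nonneg)

lemma norm_le_le_norm:
  fixes u :: "int \<Rightarrow> 'b::real_normed_vector"
  assumes "u \<in> le_space a"
  shows "wt a n * norm (u n) \<le> le_norm a u"
  using L2_set_le_le_norm[OF assms, of "{n}"] by simp

lemma norm_le_le_norm':
  fixes u :: "int \<Rightarrow> 'b::real_normed_vector"
  assumes "u \<in> le_space a" "0 \<le> a"
  shows "norm (u n) \<le> le_norm a u"
proof -
  have "1 * norm (u n) \<le> wt a n * norm (u n)"
    using assms(2) by (intro mult_right_mono) auto
  with norm_le_le_norm[OF assms(1), of n] show ?thesis by simp
qed

lemma le_space_dominated2:
  fixes u :: "int \<Rightarrow> 'b::real_normed_vector" and v :: "int \<Rightarrow> 'c::real_normed_vector"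
    and w :: "int \<Rightarrow> 'd::real_normed_vector"
  assumes v: "v \<in> le_space a" and w: "w \<in> le_space a"
    and le: "\<And>n. norm (u n) \<le> norm (v n) + norm (w n)"
  shows "u \<in> le_space a" "le_norm a u \<le> le_norm a v + le_norm a w"
proof -
  have "L2_set (\<lambda>n. wt a n * norm (u n)) F \<le> le_norm a v + le_norm a w" if "finite F" for F
  proof -
    have "L2_set (\<lambda>n. wt a n * norm (u n)) F
        \<le> L2_set (\<lambda>n. wt a n * norm (v n) + wt a n * norm (w n)) F"
      using le by (intro L2_set_mono) (auto simp flip: distrib_left)
    also have "\<dots> \<le> L2_set (\<lambda>n. wt a n * norm (v n)) F + L2_set (\<lambda>n. wt a n * norm (w n)) F"
      by (rule L2_set_triangle_ineq)
    finally show ?thesis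
      using L2_set_le_le_norm[OF v that] L2_set_le_le_norm[OF w that] by linarith
  qed
  then show "u \<in> le_space a" "le_norm a u \<le> le_norm a v + le_norm a w"
    by (auto intro: le_normI)
qed

lemma le_space_dominated:
  fixes u :: "int \<Rightarrow> 'b::real_normed_vector" and v :: "int \<Rightarrow> 'c::real_normed_vector"
  assumes v: "v \<in> le_space a" and c: "0 \<le> c"
    and le: "\<And>n. norm (u n) \<le> c * norm (v n)"
  shows "u \<in> le_space a" "le_norm a u \<le> c * le_norm a v"
proof -
  have "L2_set (\<lambda>n. wt a n * norm (u n)) F \<le> c * le_norm a v" if "finite F" for F
  proof -
    have "L2_set (\<lambda>n. wt a n * norm (u n)) F \<le> L2_set (\<lambda>n. c * (wt a n * norm (v n))) F"
      using le by (intro L2_set_mono) (auto simp: mult.left_commute)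
    also have "\<dots> = c * L2_set (\<lambda>n. wt a n * norm (v n)) F"
      using c by (simp add: L2_set_right_distrib)
    also have "\<dots> \<le> c * le_norm a v"
      using L2_set_le_le_norm[OF v that] c by (rule mult_left_mono)
    finally show ?thesis .
  qed
  then show "u \<in> le_space a" "le_norm a u \<le> c * le_norm a v"
    by (auto intro: le_normI)
qed

lemma le_space_zero [simp]: "(\<lambda>n. 0) \<in> le_space a" "le_norm a (\<lambda>n. 0) = 0"
  by (simp_all add: le_space_def le_norm_def)

lemma le_norm_eq_0D:
  fixes u :: "int \<Rightarrow> 'b::real_normed_vector"
  assumes "u \<in> le_space a" "le_norm a u \<le> 0"
  shows "u n = 0"
proof -
  have "wt a n * norm (u n) \<le> 0" using norm_le_le_norm[OF assms(1), of n] assms(2) by linarith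
  then show ?thesis by (simp add: mult_le_0_iff) 
qed

lemma le_space_add:
  fixes u v :: "int \<Rightarrow> 'b::real_normed_vector"
  assumes "u \<in> le_space a" "v \<in> le_space a"
  shows "(\<lambda>n. u n + v n) \<in> le_space a" "le_norm a (\<lambda>n. u n + v n) \<le> le_norm a u + le_norm a v"
  using le_space_dominated2[OF assms, of "\<lambda>n. u n + v n"] by (auto simp: norm_triangle_ineq)

lemma le_space_diff:
  fixes u v :: "int \<Rightarrow> 'b::real_normed_vector"
  assumes "u \<in> le_space a" "v \<in> le_space a"
  shows "(\<lambda>n. u n - v n) \<in> le_space a" "le_norm a (\<lambda>n. u n - v n) \<le> le_norm a u + le_norm a v"
  using le_space_dominated2[OF assms, of "\<lambda>n. u n - v n"] by (auto simp: norm_triangle_ineq4)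

lemma le_space_mult:
  fixes u :: "int \<Rightarrow> 'b::real_normed_div_algebra"
  assumes "u \<in> le_space a" "\<And>n. norm (p n) \<le> c"
  shows "(\<lambda>n. p n * u n) \<in> le_space a" "le_norm a (\<lambda>n. p n * u n) \<le> c * le_norm a u"
proof -
  have "0 \<le> c" using assms(2)[of 0] norm_ge_zero order_trans by blast
  then show "(\<lambda>n. p n * u n) \<in> le_space a" "le_norm a (\<lambda>n. p n * u n) \<le> c * le_norm a u"
    using le_space_dominated[OF assms(1), of c "\<lambda>n. p n * u n"] assms(2)
    by (auto simp: norm_mult mult_right_mono)
qed

lemma le_space_scaleR:
  fixes u :: "int \<Rightarrow> 'b::real_normed_vector"
  assumes "u \<in> le_space a"
  shows "(\<lambda>n. c *\<^sub>R u n) \<in> le_space a" "le_norm a (\<lambda>n. c *\<^sub>R u n) \<le> \<bar>c\<bar> * le_norm a u"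
  using le_space_dominated[OF assms, of "\<bar>c\<bar>" "\<lambda>n. c *\<^sub>R u n"] by auto

text \<open>Moving by one site changes the weight by at most the factor \<open>exp a\<close>. It
  turns the hopping norm 2 into the \<open>2 * exp a\<close> of the dominance conditions
  below.\<close>

lemma le_space_shift:
  fixes u :: "int \<Rightarrow> 'b::real_normed_vector"
  assumes u: "u \<in> le_space a" and a: "0 \<le> a" and s: "\<bar>s\<bar> \<le> 1"
  shows "(\<lambda>n. u (n + s)) \<in> le_space a" "le_norm a (\<lambda>n. u (n + s)) \<le> exp a * le_norm a u"
proof -
  have "L2_set (\<lambda>n. wt a n * norm (u (n + s))) F \<le> exp a * le_norm a u" if F: "finite F" for F
  proof -
    have w: "wt a n \<le> exp a * wt a (n + s)" for n
    proof -
      have "\<bar>real_of_int n\<bar> \<le> 1 + \<bar>real_of_int (n + s)\<bar>"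
        using s by linarith
      then have "a * \<bar>real_of_int n\<bar> \<le> a * (1 + \<bar>real_of_int (n + s)\<bar>)"
        using a by (rule mult_left_mono)
      then have "exp (a * \<bar>real_of_int n\<bar>) \<le> exp (a + a * \<bar>real_of_int (n + s)\<bar>)"
        by (simp add: algebra_simps)
      then show ?thesis by (simp add: exp_add)
    qed
    have "L2_set (\<lambda>n. wt a n * norm (u (n + s))) F
        \<le> L2_set (\<lambda>n. exp a * (wt a (n + s) * norm (u (n + s)))) F"
      by (intro L2_set_mono) (use w in \<open>auto simp: mult.assoc[symmetric] intro!: mult_right_mono\<close>)
    also have "\<dots> = exp a * L2_set (\<lambda>n. wt a (n + s) * norm (u (n + s))) F"
      by (simp add: L2_set_right_distrib)
    also have "L2_set (\<lambda>n. wt a (n + s) * norm (u (n + s))) F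
        = L2_set (\<lambda>n. wt a n * norm (u n)) ((\<lambda>n. n + s) ` F)"
      by (simp add: L2_set_def sum.reindex inj_on_def)
    also have "exp a * \<dots> \<le> exp a * le_norm a u"
      using L2_set_le_le_norm[OF u, of "(\<lambda>n. n + s) ` F"] F by simp
    finally show ?thesis .
  qed
  then show "(\<lambda>n. u (n + s)) \<in> le_space a" "le_norm a (\<lambda>n. u (n + s)) \<le> exp a * le_norm a u"
    by (auto intro: le_normI)
qed

lemma le_space_sum:
  fixes u :: "'i \<Rightarrow> int \<Rightarrow> 'b::real_normed_vector"
  assumes "\<And>i. i \<in> A \<Longrightarrow> u i \<in> le_space a"
  shows "(\<lambda>n. \<Sum>i\<in>A. u i n) \<in> le_space a \<and> le_norm a (\<lambda>n. \<Sum>i\<in>A. u i n) \<le> (\<Sum>i\<in>A. le_norm a (u i))"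
  using assms
proof (induction A rule: infinite_finite_induct)
  case (insert i A)
  then show ?case
    using le_space_add[of "u i" a "\<lambda>n. \<Sum>i\<in>A. u i n"] by fastforce
qed auto

text \<open>Lower semicontinuity of the norm under sitewise convergence, as in Fatou's lemma: a
  bound for the approximants takes the place of convergence in norm.\<close>

lemma le_space_limit:
  fixes u :: "'i \<Rightarrow> int \<Rightarrow> 'b::real_normed_vector"
  assumes "F \<noteq> bot" and lim: "\<And>n. ((\<lambda>k. u k n) \<longlongrightarrow> v n) F"
    and bd: "\<forall>\<^sub>F k in F. u k \<in> le_space a \<and> le_norm a (u k) \<le> C"
  shows "v \<in> le_space a" "le_norm a v \<le> C"
proof -
  have "L2_set (\<lambda>n. wt a n * norm (v n)) S \<le> C" if S: "finite S" for S
  proof (rule tendsto_upperbound[OF _ _ \<open>F \<noteq> bot\<close>])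
    show "((\<lambda>k. L2_set (\<lambda>n. wt a n * norm (u k n)) S) \<longlongrightarrow> L2_set (\<lambda>n. wt a n * norm (v n)) S) F"
      unfolding L2_set_def by (intro tendsto_intros lim)
    show "\<forall>\<^sub>F k in F. L2_set (\<lambda>n. wt a n * norm (u k n)) S \<le> C"
      using bd by eventually_elim (use L2_set_le_le_norm S in \<open>blast intro: order_trans\<close>)
  qed
  then show "v \<in> le_space a" "le_norm a v \<le> C"
    by (auto intro: le_normI)
qed

lemma le_space_has_sum:
  fixes u :: "'i \<Rightarrow> int \<Rightarrow> 'b::real_normed_vector"
  assumes u: "\<And>i. i \<in> I \<Longrightarrow> u i \<in> le_space a"
    and v: "\<And>n. ((\<lambda>i. u i n) has_sum v n) I"
    and bd: "\<And>S. finite S \<Longrightarrow> S \<subseteq> I \<Longrightarrow> (\<Sum>i\<in>S. le_norm a (u i)) \<le> C"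
  shows "v \<in> le_space a" "le_norm a v \<le> C"
proof -
  have "\<forall>\<^sub>F S in finite_subsets_at_top I. (\<lambda>n. \<Sum>i\<in>S. u i n) \<in> le_space a
      \<and> le_norm a (\<lambda>n. \<Sum>i\<in>S. u i n) \<le> C"
  proof (rule eventually_finite_subsets_at_top_weakI)
    fix S assume S: "finite S" "S \<subseteq> I"
    have "\<And>i. i \<in> S \<Longrightarrow> u i \<in> le_space a" using S u by auto
    from le_space_sum[OF this, of S "\<lambda>i. i"] bd[OF S]
    show "(\<lambda>n. \<Sum>i\<in>S. u i n) \<in> le_space a \<and> le_norm a (\<lambda>n. \<Sum>i\<in>S. u i n) \<le> C"
      by auto
  qed
  then show "v \<in> le_space a" "le_norm a v \<le> C"
    using le_space_limit[OF finite_subsets_at_top_neq_bot v[unfolded has_sum_def]] by auto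
qed

lemma le_space_mono:
  fixes u :: "int \<Rightarrow> 'b::real_normed_vector"
  assumes "u \<in> le_space b" "a \<le> b"
  shows "u \<in> le_space a" "le_norm a u \<le> le_norm b u"
proof -
  have "L2_set (\<lambda>n. wt a n * norm (u n)) F \<le> le_norm b u" if "finite F" for F
  proof -
    have "L2_set (\<lambda>n. wt a n * norm (u n)) F \<le> L2_set (\<lambda>n. wt b n * norm (u n)) F"
      using assms(2) by (intro L2_set_mono) (auto intro!: mult_right_mono)
    then show ?thesis using L2_set_le_le_norm[OF assms(1) that] by linarith
  qed
  then show "u \<in> le_space a" "le_norm a u \<le> le_norm b u" by (auto intro: le_normI)
qed

lemma le_space_of_real [simp]:
  "(\<lambda>n. complex_of_real (u n)) \<in> le_space a \<longleftrightarrow> u \<in> le_space a"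
  "le_norm a (\<lambda>n. complex_of_real (u n)) = le_norm a u"
  by (simp_all add: le_space_def le_norm_def)

lemma le_space_indicator:
  "(\<lambda>n. if n = s then c else (0::'b::real_normed_vector)) \<in> le_space a"
proof -
  have "(\<lambda>n. exp (2 * a * \<bar>real_of_int n\<bar>) * (norm (if n = s then c else 0))\<^sup>2) summable_on {s}"
    by simp
  then show ?thesis
    unfolding le_space_def mem_Collect_eq by (rule summable_on_cong_neutral[THEN iffD1, rotated 3]) auto
qed


section \<open>Jacobi operators\<close>

text \<open>The spectral parameter is part of the diagonal \<open>p\<close>, which may be complex. A
  change of the potential at finitely many sites is then an update of the function
  \<open>p\<close>.\<close>

definition jacobi :: "(int \<Rightarrow> complex) \<Rightarrow> (int \<Rightarrow> complex) \<Rightarrow> int \<Rightarrow> complex" where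
  "jacobi p u n = p n * u n - u (n + 1) - u (n - 1)"

lemma jacobi_add: "jacobi p (\<lambda>n. u n + v n) n = jacobi p u n + jacobi p v n"
  by (simp add: jacobi_def algebra_simps)

lemma jacobi_diff: "jacobi p (\<lambda>n. u n - v n) n = jacobi p u n - jacobi p v n"
  by (simp add: jacobi_def algebra_simps)

lemma jacobi_cmult: "jacobi p (\<lambda>n. c * u n) n = c * jacobi p u n"
  by (simp add: jacobi_def algebra_simps)

lemma jacobi_sum: "jacobi p (\<lambda>n. \<Sum>i\<in>A. u i n) n = (\<Sum>i\<in>A. jacobi p (u i) n)"
  by (simp add: jacobi_def sum_subtractf sum_distrib_left)

lemma jacobi_change: "jacobi p u n = jacobi p' u n + (p n - p' n) * u n"
  by (simp add: jacobi_def algebra_simps)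

lemma le_space_neighbours:
  fixes u :: "int \<Rightarrow> 'b::real_normed_vector"
  assumes u: "u \<in> le_space a" and a: "0 \<le> a"
  shows "(\<lambda>n. u (n + 1) + u (n - 1)) \<in> le_space a"
    "le_norm a (\<lambda>n. u (n + 1) + u (n - 1)) \<le> 2 * exp a * le_norm a u"
  using le_space_shift[OF assms, of 1] le_space_shift[OF assms, of "-1"]
    le_space_add[of "\<lambda>n. u (n + 1)" a "\<lambda>n. u (n - 1)"] by auto

text \<open>Dividing by the diagonal puts \<open>jacobi p u = f\<close> into fixed-point form; its
  linear part is a contraction when \<open>2 * exp a < c\<close>.\<close>

lemma jacobi_dominant_step:
  fixes u f :: "int \<Rightarrow> complex"
  assumes u: "u \<in> le_space a" and a: "0 \<le> a" and c: "0 < c" and p: "\<And>n. c \<le> cmod (p n)"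
  shows "(\<lambda>n. (u (n + 1) + u (n - 1)) / p n) \<in> le_space a"
    "le_norm a (\<lambda>n. (u (n + 1) + u (n - 1)) / p n) \<le> 2 * exp a / c * le_norm a u"
proof -
  have "cmod (1 / p n) \<le> 1 / c" for n
    using p[of n] c by (simp add: norm_divide frac_le)
  from le_space_mult[OF le_space_neighbours(1)[OF u a], of "\<lambda>n. 1 / p n", OF this]
  show "(\<lambda>n. (u (n + 1) + u (n - 1)) / p n) \<in> le_space a"
    and "le_norm a (\<lambda>n. (u (n + 1) + u (n - 1)) / p n) \<le> 2 * exp a / c * le_norm a u"
    using le_space_neighbours(2)[OF u a] c
    by (auto simp: field_simps)
qed

lemma jacobi_dominant_unique:
  assumes u: "u \<in> le_space a" and a: "0 \<le> a" and c: "2 * exp a < c" and p: "\<And>n. c \<le> cmod (p n)"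
    and eq: "\<And>n. jacobi p u n = 0"
  shows "u n = 0"
proof -
  have c0: "0 < c" using c exp_gt_zero[of a] by linarith
  have p0: "p n \<noteq> 0" for n using p[of n] c0 by auto
  have "u = (\<lambda>n. (u (n + 1) + u (n - 1)) / p n)"
    using eq p0 by (auto simp: jacobi_def fun_eq_iff field_simps)
  then have "le_norm a u \<le> 2 * exp a / c * le_norm a u"
    using jacobi_dominant_step(2)[where p = p, OF u a c0 p] by simp
  moreover have "2 * exp a / c < 1" using c c0 by simp
  ultimately have "le_norm a u \<le> 0"
    using mult_right_less_imp_less[of "2 * exp a / c" "le_norm a u" 1] le_norm_nonneg[of a u]
    by (metis mult_1 mult_less_cancel_right2 not_le)
  then show ?thesis using u by (rule le_norm_eq_0D[rotated])
qed

lemma jacobi_dominant_solvable: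
  assumes f: "f \<in> le_space a" and a: "0 \<le> a" and c: "2 * exp a < c" and p: "\<And>n. c \<le> cmod (p n)"
  shows "\<exists>u\<in>le_space a. (\<forall>n. jacobi p u n = f n) \<and> le_norm a u \<le> le_norm a f / (c - 2 * exp a)"
proof -
  have c0: "0 < c" using c exp_gt_zero[of a] by linarith
  have p0: "p n \<noteq> 0" for n using p[of n] c0 by auto
  define \<theta> where "\<theta> = 2 * exp a / c"
  have \<theta>: "0 \<le> \<theta>" "\<theta> < 1" using c c0 by (auto simp: \<theta>_def)
  \<comment> \<open>\<open>d k\<close> is the k-th term of the Neumann series. Its norm decays like
    \<open>\<theta> ^ k\<close>, and the geometric sum gives the constant
    \<open>1 / (c - 2 * exp a)\<close>.\<close>
  define d where "d = rec_nat (\<lambda>n. f n / p n) (\<lambda>k v n. (v (n + 1) + v (n - 1)) / p n)"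
  have d0: "d 0 = (\<lambda>n. f n / p n)" and dS: "\<And>k. d (Suc k) = (\<lambda>n. (d k (n + 1) + d k (n - 1)) / p n)"
    by (simp_all add: d_def)
  have d: "d k \<in> le_space a \<and> le_norm a (d k) \<le> \<theta> ^ k * (le_norm a f / c)" for k
  proof (induction k)
    case 0
    have "cmod (1 / p n) \<le> 1 / c" for n
      using p[of n] c0 by (simp add: norm_divide frac_le)
    from le_space_mult[OF f, of "\<lambda>n. 1 / p n", OF this] show ?case by (simp add: d0)
  next
    case (Suc k)
    then have "d k \<in> le_space a" by simp
    note st = jacobi_dominant_step[where p = p, OF this a c0 p]
    have "le_norm a (d (Suc k)) \<le> \<theta> * le_norm a (d k)" using st(2) by (simp add: dS \<theta>_def)
    also have "\<dots> \<le> \<theta> * (\<theta> ^ k * (le_norm a f / c))" using Suc \<theta> by (intro mult_left_mono) auto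
    finally show ?case using st(1) by (simp add: dS mult.assoc)
  qed
  have geo: "summable (\<lambda>k. \<theta> ^ k * (le_norm a f / c))"
    using \<theta> by (intro summable_mult2 summable_geometric) auto
  have sm: "summable (\<lambda>k. d k n)" for n
  proof (rule summable_comparison_test[OF _ geo], intro exI allI impI)
    fix k
    show "norm (d k n) \<le> \<theta> ^ k * (le_norm a f / c)"
      using norm_le_le_norm'[of "d k" a n] d[of k] a by auto
  qed
  define u where "u n = (\<Sum>k. d k n)" for n
  have u1: "u n = d 0 n + (\<Sum>k. d (Suc k) n)" for n
    using suminf_split_head[OF sm] by (simp add: u_def)
  have u2: "(\<Sum>k. d (Suc k) n) = (u (n + 1) + u (n - 1)) / p n" for n
    using sm by (simp add: dS u_def suminf_add suminf_divide summable_add)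
  have "jacobi p u n = f n" for n
    using p0[of n] u1[of n] u2[of n] by (simp add: jacobi_def d0 field_simps)
  moreover have lim: "(\<lambda>K. \<Sum>k<K. d k n) \<longlonglongrightarrow> u n" for n
    using summable_LIMSEQ[OF sm] by (simp add: u_def)
  have bd: "(\<lambda>n. \<Sum>k<K. d k n) \<in> le_space a \<and>
      le_norm a (\<lambda>n. \<Sum>k<K. d k n) \<le> le_norm a f / (c - 2 * exp a)" for K
  proof -
    have 1: "(\<lambda>n. \<Sum>k<K. d k n) \<in> le_space a" "le_norm a (\<lambda>n. \<Sum>k<K. d k n) \<le> (\<Sum>k<K. le_norm a (d k))"
      using le_space_sum[of "{..<K}" d a] d by auto
    have "(\<Sum>k<K. le_norm a (d k)) \<le> (\<Sum>k<K. \<theta> ^ k * (le_norm a f / c))"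
      using d by (intro sum_mono) auto
    also have "\<dots> \<le> (\<Sum>k. \<theta> ^ k * (le_norm a f / c))"
      using geo c0 \<theta> by (intro sum_le_suminf) auto
    also have "\<dots> = 1 / (1 - \<theta>) * (le_norm a f / c)"
      using \<theta> by (subst suminf_mult2[symmetric]) (auto simp: suminf_geometric summable_geometric)
    also have "\<dots> = le_norm a f / (c - 2 * exp a)"
      using c c0 by (simp add: \<theta>_def divide_simps)
    finally show ?thesis using 1 by simp
  qed
  note lm = le_space_limit[OF sequentially_bot lim, where a = a and C = "le_norm a f / (c - 2 * exp a)"]
  have "u \<in> le_space a" "le_norm a u \<le> le_norm a f / (c - 2 * exp a)"
    using lm bd by auto
  ultimately show ?thesis by blast
qed

text \<open>\<open>A\<close> is additive and homogeneous only on \<open>S\<close>. A linear map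
  extended from a basis of \<open>S\<close> agrees with it there, and counting dimensions
  finishes.\<close>

lemma subspace_inj_imp_surj:
  fixes A :: "'v::real_vector \<Rightarrow> 'v"
  assumes S: "subspace S" and E: "finite E" "S \<subseteq> span E"
    and AS: "\<And>x. x \<in> S \<Longrightarrow> A x \<in> S"
    and add: "\<And>x y. x \<in> S \<Longrightarrow> y \<in> S \<Longrightarrow> A (x + y) = A x + A y"
    and scale: "\<And>c x. x \<in> S \<Longrightarrow> A (c *\<^sub>R x) = c *\<^sub>R A x"
    and inj: "\<And>x. x \<in> S \<Longrightarrow> A x = 0 \<Longrightarrow> x = 0"
    and y: "y \<in> S"
  shows "\<exists>x\<in>S. A x = y"
proof -
  obtain B where B: "B \<subseteq> S" "independent B" "S \<subseteq> span B"
    by (rule basis_exists[of S])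
  have SB: "span B = S" using B S by (metis span_minimal subset_antisym)
  have fB: "finite B" using independent_span_bound[OF E(1) B(2)] B(1) E(2) by auto
  obtain g where g: "linear g" "\<And>x. x \<in> B \<Longrightarrow> g x = A x"
    using linear_independent_extend[OF B(2), of A] by auto
  have "x \<in> span B \<and> g x = A x" if "x \<in> span B" for x
    using that
  proof (induction rule: span_induct_alt)
    case base
    have "A (0 *\<^sub>R 0) = 0 *\<^sub>R A 0" using scale[of 0 0] S subspace_0 by blast
    then show ?case using g(1) by (simp add: linear_0 span_zero)
  next
    case (step c x z)
    moreover have "c *\<^sub>R x \<in> span B" using step(1) by (simp add: span_base span_scale)
    ultimately show ?case
      using g SB add[of "c *\<^sub>R x" z] scale[of x c] span_base[of x B] subspace_add[OF S]
      by (simp add: linear_add linear_scale)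
  qed
  then have gA: "\<And>x. x \<in> span B \<Longrightarrow> g x = A x" by blast
  have "inj_on g (span B)"
    using linear_inj_on_iff_eq_0[OF g(1) subspace_span] gA SB inj by auto
  then have ind: "independent (g ` B)" and inj': "inj_on g B"
    using linear_independent_injective_image[OF g(1) B(2)] by (auto intro: inj_on_subset[OF _ span_superset])
  have gBS: "g ` B \<subseteq> S" using B(1) AS g(2) by auto
  \<comment> \<open>Otherwise y together with the image of \<open>B\<close> would be an independent
    set inside the span of \<open>B\<close> with one element more than \<open>B\<close>.\<close>
  have "y \<in> span (g ` B)"
  proof (rule ccontr)
    assume n: "y \<notin> span (g ` B)"
    then have "independent (insert y (g ` B))" using ind by (simp add: independent_insertI)
    moreover have "insert y (g ` B) \<subseteq> span B" using gBS y SB by auto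
    ultimately have "card (insert y (g ` B)) \<le> card B"
      using independent_span_bound[OF fB] by blast
    moreover have "y \<notin> g ` B" using n span_base[of y "g ` B"] by metis
    ultimately show False using fB by (simp add: card_image[OF inj'])
  qed
  then have "y \<in> g ` span B" using linear_span_image[OF g(1)] by blast
  then show ?thesis using gA SB by auto
qed

lemma subspace_supported: "subspace {w :: int \<Rightarrow> complex. \<forall>n. n \<notin> F \<longrightarrow> w n = 0}"
  by (auto simp: subspace_def plus_fun_def zero_fun_def)

text \<open>\<open>span\<close> is taken over the reals, hence each site contributes two unit
  vectors, with values 1 and \<open>\<i>\<close>.\<close>

lemma supported_subset_span:
  assumes "finite F"
  shows "{w :: int \<Rightarrow> complex. \<forall>n. n \<notin> F \<longrightarrow> w n = 0}
    \<subseteq> span ((\<lambda>s n. if n = s then 1 else 0) ` F \<union> (\<lambda>s n. if n = s then \<i> else 0) ` F)"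
    (is "_ \<subseteq> span ?E")
proof
  fix w :: "int \<Rightarrow> complex" assume "w \<in> {w. \<forall>n. n \<notin> F \<longrightarrow> w n = 0}"
  then have w: "w n = 0" if "n \<notin> F" for n using that by auto
  let ?d = "\<lambda>c s n. if n = s then (c :: complex) else 0"
  have "w = (\<Sum>s\<in>F. Re (w s) *\<^sub>R ?d 1 s + Im (w s) *\<^sub>R ?d \<i> s)"
  proof
    fix n
    have ap: "(\<Sum>s\<in>F. g s) n = (\<Sum>s\<in>F. g s n)" for g :: "int \<Rightarrow> int \<Rightarrow> complex"
      by (induction F rule: infinite_finite_induct) auto
    have "(\<Sum>s\<in>F. Re (w s) *\<^sub>R ?d 1 s + Im (w s) *\<^sub>R ?d \<i> s) n = (\<Sum>s\<in>F. if n = s then w s else 0)"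
      unfolding ap by (intro sum.cong) (auto simp: complex_eq_iff)
    then show "w n = (\<Sum>s\<in>F. Re (w s) *\<^sub>R ?d 1 s + Im (w s) *\<^sub>R ?d \<i> s) n"
      using w assms by auto
  qed
  moreover have "(\<Sum>s\<in>F. Re (w s) *\<^sub>R ?d 1 s + Im (w s) *\<^sub>R ?d \<i> s) \<in> span ?E"
    by (intro span_sum span_add span_scale span_base) auto
  ultimately show "w \<in> span ?E" by simp
qed

text \<open>The Fredholm alternative: the potential is dominant off a finite set, so the operator is a
  finite rank perturbation of an invertible one.\<close>

lemma jacobi_solvable:
  assumes a: "0 \<le> a" and F: "finite F" and c: "2 * exp a < c"
    and p: "\<forall>n. n \<notin> F \<longrightarrow> c \<le> cmod (p n)"
    and inj: "\<forall>u\<in>le_space a. (\<forall>n. jacobi p u n = 0) \<longrightarrow> (\<forall>n. u n = 0)"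
  shows "\<exists>K\<ge>0. \<forall>f\<in>le_space a. \<exists>u\<in>le_space a. (\<forall>n. jacobi p u n = f n) \<and> le_norm a u \<le> K * le_norm a f"
proof -
  have c0: "0 < c" using c exp_gt_zero[of a] by linarith
  \<comment> \<open>On \<open>F\<close> the diagonal is replaced by the constant \<open>c\<close>;
    dominance then holds everywhere, and the operator with diagonal \<open>p'\<close> has a bounded
    inverse.\<close>
  define p' where "p' n = (if n \<in> F then complex_of_real c else p n)" for n
  have p': "c \<le> cmod (p' n)" for n using p c0 by (auto simp: p'_def)
  define k where "k = c - 2 * exp a"
  have k: "k > 0" using c by (simp add: k_def)
  have "\<forall>f\<in>le_space a. \<exists>u. u \<in> le_space a \<and> (\<forall>n. jacobi p' u n = f n) \<and> le_norm a u \<le> le_norm a f / k"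
    using jacobi_dominant_solvable[where p = p', OF _ a c p'] k_def by blast
  from bchoice[OF this] obtain R where R: "R f \<in> le_space a \<and> (\<forall>n. jacobi p' (R f) n = f n)
      \<and> le_norm a (R f) \<le> le_norm a f / k" if "f \<in> le_space a" for f
    by blast
  \<comment> \<open>\<open>R\<close> comes from a choice; uniqueness of weighted solutions is what
    makes it additive and homogeneous.\<close>
  have Runiq: "R f = u" if "f \<in> le_space a" "u \<in> le_space a" "\<And>n. jacobi p' u n = f n" for f u
  proof
    fix n
    have "R f n - u n = 0"
      using R[OF that(1)] that
      by (intro jacobi_dominant_unique[where p = p', OF le_space_diff(1)[of "R f" a u] a c p']) (auto simp: jacobi_diff)
    then show "R f n = u n" by simp
  qed
  define S where "S = {w :: int \<Rightarrow> complex. \<forall>n. n \<notin> F \<longrightarrow> w n = 0}"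
  have Sle: "w \<in> le_space a" if "w \<in> S" for w
  proof -
    have "w = (\<lambda>n. \<Sum>s\<in>F. if n = s then w s else 0)" using that F by (auto simp: S_def fun_eq_iff)
    also have "\<dots> \<in> le_space a"
      using le_space_sum[of F "\<lambda>s n. if n = s then w s else 0" a] le_space_indicator by blast
    finally show ?thesis .
  qed
  define D where "D n = p' n - p n" for n
  have D: "D n = 0" if "n \<notin> F" for n using that by (simp add: D_def p'_def)
  \<comment> \<open>The two operators differ by multiplication with \<open>D\<close>, so
    \<open>jacobi p (R w) = A w\<close>. As \<open>D\<close> vanishes off \<open>F\<close>, the map
    \<open>A\<close> preserves the finite-dimensional space \<open>S\<close>, and the problem is
    reduced to inverting it there.\<close>
  define A where "A w = w - (\<lambda>n. D n * R w n)" for w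
  have surj: "\<exists>w\<in>S. A w = y" if "y \<in> S" for y
  proof (rule subspace_inj_imp_surj[of S])
    show "subspace S" unfolding S_def by (rule subspace_supported)
    show "finite ((\<lambda>s n. if n = s then 1 else 0) ` F \<union> (\<lambda>s n. if n = s then \<i> else 0) ` F)"
      using F by simp
    show "S \<subseteq> span ((\<lambda>s n. if n = s then 1 else 0) ` F \<union> (\<lambda>s n. if n = s then \<i> else 0) ` F)"
      unfolding S_def by (rule supported_subset_span[OF F])
    show "A x \<in> S" if "x \<in> S" for x using that D by (auto simp: A_def S_def)
    show "A (x + y) = A x + A y" if "x \<in> S" "y \<in> S" for x y
    proof -
      have "R (x + y) = (\<lambda>n. R x n + R y n)"
        using that Sle R le_space_add[of x a y] le_space_add[of "R x" a "R y"]
        by (intro Runiq) (auto simp: jacobi_add plus_fun_def)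
      then show ?thesis by (auto simp: A_def fun_eq_iff algebra_simps)
    qed
    show "A (r *\<^sub>R x) = r *\<^sub>R A x" if "x \<in> S" for x r
    proof -
      have "R (r *\<^sub>R x) = (\<lambda>n. of_real r * R x n)"
        using that Sle R le_space_scaleR(1)[of x a r] le_space_scaleR(1)[of "R x" a r]
        by (intro Runiq) (auto simp: jacobi_cmult scaleR_fun_def scaleR_conv_of_real)
      then show ?thesis by (auto simp: A_def fun_eq_iff algebra_simps scaleR_conv_of_real)
    qed
    show "x = 0" if x: "x \<in> S" "A x = 0" for x
    proof -
      have e: "x n = D n * R x n" for n using fun_cong[OF x(2), of n] by (simp add: A_def)
      note Rx = R[OF Sle[OF x(1)]]
      have "jacobi p (R x) n = 0" for n
        using jacobi_change[of p "R x" n p'] Rx e[of n] by (simp add: D_def algebra_simps)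
      with inj Rx have "R x n = 0" for n by blast
      with e show "x = 0" by (auto simp: fun_eq_iff)
    qed
    show "y \<in> S" by fact
  qed
  have "\<exists>u\<in>le_space a. \<forall>n. jacobi p u n = (if n = s then 1 else 0)" if "s \<in> F" for s
  proof -
    have "(\<lambda>n. if n = s then 1 else 0) \<in> S" using that by (auto simp: S_def)
    from surj[OF this] obtain w where w: "w \<in> S" "A w = (\<lambda>n. if n = s then 1 else 0)" by blast
    note Rw = R[OF Sle[OF w(1)]]
    have "jacobi p (R w) n = (if n = s then 1 else 0)" for n
      using jacobi_change[of p "R w" n p'] Rw fun_cong[OF w(2), of n] by (simp add: A_def D_def algebra_simps)
    then show ?thesis using Rw by blast
  qed
  then obtain g where g: "\<And>s. s \<in> F \<Longrightarrow> g s \<in> le_space a"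
    "\<And>s n. s \<in> F \<Longrightarrow> jacobi p (g s) n = (if n = s then 1 else 0)" by metis
  \<comment> \<open>The solution will be \<open>R f\<close> plus the combination of the
    \<open>g s\<close> with coefficients \<open>D s * R f s\<close>, and \<open>cmod (R f s)\<close>
    is at most \<open>le_norm a f / k\<close>.\<close>
  define K where "K = 1 / k + (\<Sum>s\<in>F. cmod (D s) / k * le_norm a (g s))"
  show ?thesis
  proof (intro exI[of _ K] conjI ballI)
    show "0 \<le> K" using k by (auto simp: K_def intro!: add_nonneg_nonneg sum_nonneg)
    fix f :: "int \<Rightarrow> complex" assume f: "f \<in> le_space a"
    note Rf = R[OF f]
    \<comment> \<open>As a solution for \<open>p\<close>, the sequence \<open>R f\<close> has the
      defect \<open>D n * R f n\<close>, which lives on \<open>F\<close>; \<open>v\<close> removes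
      it.\<close>
    define v where "v = (\<lambda>n. \<Sum>s\<in>F. (D s * R f s) * g s n)"
    have gc: "(\<lambda>n. (D s * R f s) * g s n) \<in> le_space a
        \<and> le_norm a (\<lambda>n. (D s * R f s) * g s n) \<le> cmod (D s) / k * le_norm a (g s) * le_norm a f"
      if "s \<in> F" for s
    proof -
      have "cmod (R f s) \<le> le_norm a f / k"
        using norm_le_le_norm'[of "R f" a s] Rf a by auto
      then have "cmod (D s * R f s) \<le> cmod (D s) * (le_norm a f / k)"
        unfolding norm_mult by (rule mult_left_mono) simp
      from le_space_mult[OF g(1)[OF that], of "\<lambda>_. D s * R f s", OF this] show ?thesis
        by (simp add: mult_ac)
    qed
    have v: "v \<in> le_space a" "le_norm a v \<le> (\<Sum>s\<in>F. cmod (D s) / k * le_norm a (g s) * le_norm a f)"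
      using le_space_sum[of F "\<lambda>s n. (D s * R f s) * g s n" a] gc
        sum_mono[of F "\<lambda>s. le_norm a (\<lambda>n. (D s * R f s) * g s n)"
          "\<lambda>s. cmod (D s) / k * le_norm a (g s) * le_norm a f"]
      unfolding v_def by fastforce+
    show "\<exists>u\<in>le_space a. (\<forall>n. jacobi p u n = f n) \<and> le_norm a u \<le> K * le_norm a f"
    proof (intro bexI[of _ "\<lambda>n. R f n + v n"] conjI allI)
      fix n
      have "jacobi p v n = (\<Sum>s\<in>F. (D s * R f s) * jacobi p (g s) n)"
        unfolding v_def jacobi_sum jacobi_cmult by simp
      also have "\<dots> = (\<Sum>s\<in>F. if n = s then D s * R f s else 0)"
        using g(2) by (intro sum.cong) auto
      also have "\<dots> = D n * R f n" using F D[of n] by simp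
      finally have "jacobi p v n = D n * R f n" .
      moreover have "jacobi p (R f) n = f n - D n * R f n"
        using Rf jacobi_change[of p "R f" n p'] by (simp add: D_def algebra_simps)
      ultimately show "jacobi p (\<lambda>n. R f n + v n) n = f n"
        by (simp add: jacobi_add)
    next
      have "le_norm a (\<lambda>n. R f n + v n) \<le> le_norm a (R f) + le_norm a v"
        using Rf v by (intro le_space_add) auto
      also have "\<dots> \<le> K * le_norm a f"
        using v(2) Rf unfolding sum_distrib_right[symmetric] by (simp add: K_def distrib_right)
      finally show "le_norm a (\<lambda>n. R f n + v n) \<le> K * le_norm a f" .
    next
      show "(\<lambda>n. R f n + v n) \<in> le_space a" using Rf v by (intro le_space_add) auto
    qed
  qed
qed

section \<open>Symmetry of Jacobi operators and comparison of null vectors\<close>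

lemma summable_l2_mult:
  fixes u v :: "int \<Rightarrow> complex"
  assumes "u \<in> l2_space" "v \<in> l2_space"
  shows "(\<lambda>n. norm (u n * v n)) summable_on UNIV"
proof (rule Infinite_Sum.abs_summable_on_comparison_test[where g = "\<lambda>n. (cmod (u n))\<^sup>2 + (cmod (v n))\<^sup>2"])
  show "(\<lambda>n. norm ((cmod (u n))\<^sup>2 + (cmod (v n))\<^sup>2)) summable_on UNIV"
    using assms by (simp, intro summable_on_add) (auto simp: le_space_def)
  show "norm (u n * v n) \<le> norm ((cmod (u n))\<^sup>2 + (cmod (v n))\<^sup>2)" for n
  proof -
    have "2 * (cmod (u n) * cmod (v n)) \<le> (cmod (u n))\<^sup>2 + (cmod (v n))\<^sup>2"
      using sum_squares_bound[of "cmod (u n)" "cmod (v n)"] by (simp add: mult.assoc)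
    moreover have "0 \<le> cmod (u n) * cmod (v n)" by simp
    ultimately have "cmod (u n) * cmod (v n) \<le> (cmod (u n))\<^sup>2 + (cmod (v n))\<^sup>2"
      by linarith
    then show ?thesis by (simp add: norm_mult)
  qed
qed

text \<open>Summation by parts: the shift by one site exchanges the two off-diagonal sums. The
  pairing is bilinear, without conjugation, so the symmetry holds for complex diagonals too.\<close>

lemma jacobi_pairing:
  assumes u: "u \<in> l2_space" and v: "v \<in> l2_space" and Ju: "jacobi p u \<in> l2_space" and Jv: "jacobi p v \<in> l2_space"
  shows "(\<Sum>\<^sub>\<infinity>n. jacobi p u n * v n) = (\<Sum>\<^sub>\<infinity>n. u n * jacobi p v n)"
proof -
  define A where "A n = u (n + 1) * v n" for n
  define B where "B n = u (n - 1) * v n" for n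
  have sh: "(\<lambda>n. w (n + s)) \<in> l2_space" if "w \<in> l2_space" "\<bar>s\<bar> \<le> 1" for w :: "int \<Rightarrow> complex" and s
    using le_space_shift[of w 0 s] that by simp
  have sA: "A summable_on UNIV" and sB: "B summable_on UNIV"
    unfolding A_def B_def
    using summable_l2_mult[OF sh[OF u, of 1] v] summable_l2_mult[OF sh[OF u, of "-1"] v]
    by (auto intro: abs_summable_summable)
  have bij: "bij_betw (\<lambda>n. n + s) UNIV (UNIV::int set)" for s :: int
    by (rule bij_betwI[of _ _ _ "\<lambda>n. n - s"]) auto
  have A': "((\<lambda>n. u n * v (n - 1)) has_sum infsum A UNIV) UNIV"
    using has_sum_reindex_bij_betw[OF bij[of "-1"], of A "infsum A UNIV"] sA by (simp add: A_def)
  have B': "((\<lambda>n. u n * v (n + 1)) has_sum infsum B UNIV) UNIV"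
    using has_sum_reindex_bij_betw[OF bij[of "1"], of B "infsum B UNIV"] sB by (simp add: B_def)
  have sJ: "(\<lambda>n. jacobi p u n * v n) summable_on UNIV"
    using summable_l2_mult[OF Ju v] by (rule abs_summable_summable)
  have "((\<lambda>n. jacobi p u n * v n + A n + B n + - (u n * v (n - 1)) + - (u n * v (n + 1))) has_sum
     (infsum (\<lambda>n. jacobi p u n * v n) UNIV + infsum A UNIV + infsum B UNIV + - infsum A UNIV + - infsum B UNIV)) UNIV"
    by (intro has_sum_add has_sum_uminus[THEN iffD2] A' B') (use sA sB sJ A' B' in auto)
  moreover have "jacobi p u n * v n + A n + B n + - (u n * v (n - 1)) + - (u n * v (n + 1)) = u n * jacobi p v n" for n
    by (simp add: jacobi_def A_def B_def algebra_simps)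
  ultimately show ?thesis by (simp add: infsumI)
qed

text \<open>The three-term recurrence can be run in both directions from two consecutive
  values.\<close>

lemma jacobi_initial_unique:
  assumes eq: "\<And>n. jacobi p u n = 0" and "u s = 0" "u (s + 1) = 0"
  shows "u n = 0"
proof -
  have "u (s + int k) = 0 \<and> u (s + int k + 1) = 0" for k
  proof (induction k)
    case (Suc k)
    then show ?case using eq[of "s + int k + 1"] by (simp add: jacobi_def algebra_simps)
  qed (use assms in auto)
  moreover have "u (s - int k) = 0 \<and> u (s - int k + 1) = 0" for k
  proof (induction k)
    case (Suc k)
    then show ?case using eq[of "s - int k"] by (simp add: jacobi_def algebra_simps)
  qed (use assms in auto)
  ultimately show ?thesis
    using zle_iff_zadd[of s n] zle_iff_zadd[of n s] by (metis add_diff_cancel_right' linear)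
qed

text \<open>The Wronskian is constant and summable.\<close>

lemma jacobi_wronskian:
  assumes u: "u \<in> l2_space" and v: "v \<in> l2_space" 
    and "\<And>n. jacobi p u n = 0" "\<And>n. jacobi p v n = 0"
  shows "u (n + 1) * v n = u n * v (n + 1)"
proof -
  define W where "W n = u (n + 1) * v n + - (u n * v (n + 1))" for n
  have step: "W n = W (n - 1)" for n
  proof -
    have "W n - W (n - 1) = v (n) * (- jacobi p u n) + u n * jacobi p v n"
      by (simp add: W_def jacobi_def algebra_simps)
    then show ?thesis using assms(3,4) by simp
  qed
  have const: "W n = W 0" for n
  proof (induction n rule: int_induct[where k = 0])
    case (step1 i) then show ?case using step[of "i + 1"] by simp
  next
    case (step2 i) then show ?case using step[of i] by simp
  qed simp
  have sh: "(\<lambda>n. w (n + 1)) \<in> l2_space" if "w \<in> l2_space" for w :: "int \<Rightarrow> complex"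
    using le_space_shift[of w 0 1] that by simp
  have "W summable_on UNIV"
    unfolding W_def using summable_l2_mult[OF sh[OF u] v] summable_l2_mult[OF u sh[OF v]]
    by (intro summable_on_add summable_on_uminus[THEN iffD2]) (auto intro: abs_summable_summable)
  then have "(\<lambda>n::int. W 0) summable_on UNIV"
    by (rule summable_on_cong[THEN iffD1, rotated]) (use const in auto)
  then have "(\<lambda>n::int. norm (W 0)) summable_on UNIV"
    by (simp only: summable_on_iff_abs_summable_on_complex)
  then have "W 0 = 0"
    using infsum_diverge_constant[of "UNIV :: int set" "norm (W 0)"] infinite_UNIV_int by auto
  then show ?thesis using const[of n] by (simp add: W_def)
qed


section \<open>Eigenvalues outside the essential spectrum\<close>

definition opot :: "(int \<Rightarrow> real) \<Rightarrow> complex \<Rightarrow> int \<Rightarrow> complex" where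
  "opot V l n = complex_of_real (2 + V n) - l"

lemma jacobi_opot: "jacobi (opot V l) u n = schroedinger V u n - l * u n"
  by (simp add: jacobi_def opot_def schroedinger_def lap_def scaleR_conv_of_real algebra_simps)

lemma infsum_single:
  fixes g :: "'i \<Rightarrow> complex"
  assumes "\<And>n. n \<noteq> s \<Longrightarrow> g n = 0"
  shows "(\<Sum>\<^sub>\<infinity>n. g n) = g s"
proof -
  have "(\<Sum>\<^sub>\<infinity>n. g n) = (\<Sum>\<^sub>\<infinity>n\<in>{s}. g n)"
    by (rule infsum_cong_neutral) (use assms in auto)
  then show ?thesis by simp
qed

lemma jacobi_site:
  "jacobi (p(s := p s + 1)) u n = jacobi p u n + (if n = s then u s else 0)"
  by (simp add: jacobi_def algebra_simps)

text \<open>Symmetry moves the perturbed operator onto a null vector of the unperturbed one, where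
  only the perturbed site survives.\<close>

lemma jacobi_site_pairing:
  assumes u: "u \<in> l2_space" and Ju: "jacobi (p(s := p s + 1)) u \<in> l2_space"
    and v: "v \<in> l2_space" "\<And>n. jacobi p v n = 0"
  shows "(\<Sum>\<^sub>\<infinity>n. jacobi (p(s := p s + 1)) u n * v n) = u s * v s"
proof -
  have e: "jacobi (p(s := p s + 1)) v = (\<lambda>n. if n = s then v s else 0)"
    using v(2) by (simp add: jacobi_site fun_eq_iff)
  have "(\<Sum>\<^sub>\<infinity>n. jacobi (p(s := p s + 1)) u n * v n) = (\<Sum>\<^sub>\<infinity>n. u n * jacobi (p(s := p s + 1)) v n)"
    by (rule jacobi_pairing[OF u v(1) Ju]) (simp add: e le_space_indicator)
  also have "\<dots> = u s * v s"
    by (subst infsum_single[where s = s]) (auto simp: e)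
  finally show ?thesis .
qed

text \<open>Adding a unit potential at a site where the eigenfunction does not vanish removes the
  eigenvalue, because eigenvalues are simple.\<close>

lemma jacobi_site_injective:
  assumes \<phi>: "\<phi> \<in> l2_space" "\<And>n. jacobi p \<phi> n = 0" "\<phi> s \<noteq> 0"
    and u: "u \<in> l2_space" "\<And>n. jacobi (p(s := p s + 1)) u n = 0"
  shows "u n = 0"
proof -
  have e: "jacobi (p(s := p s + 1)) u = (\<lambda>n. 0)" using u(2) by auto
  \<comment> \<open>The perturbed operator annihilates \<open>u\<close>, so this pairing is zero and
    \<open>u\<close> vanishes at \<open>s\<close>; it is then a null vector of the unperturbed
    operator as well.\<close>
  have "u s * \<phi> s = (\<Sum>\<^sub>\<infinity>n. jacobi (p(s := p s + 1)) u n * \<phi> n)"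
    by (rule jacobi_site_pairing[symmetric]) (use u(1) \<phi> in \<open>auto simp: e\<close>)
  then have us: "u s = 0" using \<phi>(3) by (simp add: e)
  then have Ju: "jacobi p u n = 0" for n
    using u(2)[of n] by (simp add: jacobi_site split: if_splits)
  \<comment> \<open>The Wronskian with \<phi> supplies the second of two consecutive zeros.\<close>
  have "u (s + 1) * \<phi> s = u s * \<phi> (s + 1)"
    by (rule jacobi_wronskian[OF u(1) \<phi>(1) Ju \<phi>(2)])
  then have "u (s + 1) = 0" using us \<phi>(3) by simp
  then show ?thesis using jacobi_initial_unique[OF Ju us] by blast
qed

lemma jacobi_site_solvable:
  assumes a: "0 \<le> a" and F: "finite F" and c: "2 * exp a < c"
    and p: "\<forall>n. n \<notin> F \<longrightarrow> c \<le> cmod (p n)"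
    and \<phi>: "\<phi> \<in> l2_space" "\<And>n. jacobi p \<phi> n = 0" "\<phi> s \<noteq> 0"
  shows "\<exists>K\<ge>0. \<forall>f\<in>le_space a. \<exists>u\<in>le_space a.
    (\<forall>n. jacobi (p(s := p s + 1)) u n = f n) \<and> le_norm a u \<le> K * le_norm a f"
proof (rule jacobi_solvable[OF a _ c])
  show "finite (insert s F)" using F by simp
  show "\<forall>n. n \<notin> insert s F \<longrightarrow> c \<le> cmod ((p(s := p s + 1)) n)" using p by auto
  show "\<forall>u\<in>le_space a. (\<forall>n. jacobi (p(s := p s + 1)) u n = 0) \<longrightarrow> (\<forall>n. u n = 0)"
    using jacobi_site_injective[OF \<phi> le_space_mono(1)[OF _ a]] by blast
qed

text \<open>\<phi> solves the perturbed equation with a point source of strength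
  \<open>\<phi> s\<close> at \<open>s\<close>. The weighted solution for this source is also in l2,
  where solutions are unique, so it equals \<phi>.\<close>

lemma jacobi_eigenfunction_decay:
  assumes "0 \<le> a" "finite F" "2 * exp a < c" "\<forall>n. n \<notin> F \<longrightarrow> c \<le> cmod (p n)"
    and \<phi>: "\<phi> \<in> l2_space" "\<And>n. jacobi p \<phi> n = 0" "\<phi> s \<noteq> 0"
  shows "\<phi> \<in> le_space a"
proof -
  obtain K where K: "\<forall>f\<in>le_space a. \<exists>u\<in>le_space a.
    (\<forall>n. jacobi (p(s := p s + 1)) u n = f n) \<and> le_norm a u \<le> K * le_norm a f"
    using jacobi_site_solvable[OF assms] by blast
  obtain u where u: "u \<in> le_space a" "\<And>n. jacobi (p(s := p s + 1)) u n = (if n = s then \<phi> s else 0)"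
    using bspec[OF K le_space_indicator[of s "\<phi> s" a]] by blast
  have "u n - \<phi> n = 0" for n
  proof (rule jacobi_site_injective[OF \<phi>])
    show "(\<lambda>n. u n - \<phi> n) \<in> l2_space"
      using le_space_mono(1)[OF u(1) assms(1)] \<phi>(1) by (rule le_space_diff)
    show "jacobi (p(s := p s + 1)) (\<lambda>n. u n - \<phi> n) n = 0" for n
      using u(2)[of n] \<phi>(2)[of n] by (simp add: jacobi_diff jacobi_site)
  qed
  then have "u = \<phi>" by auto
  with u(1) show ?thesis by simp
qed

text \<open>A solution of the perturbed equation solves the original one as soon as it vanishes at \<open>s\<close>; a
  multiple of the perturbed solution for the right-hand side \<open>\<phi>\<close> achieves this.\<close>

lemma jacobi_eigen_solvable:
  assumes a: "0 \<le> a" and F: "finite F" "2 * exp a < c" "\<forall>n. n \<notin> F \<longrightarrow> c \<le> cmod (p n)"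
    and \<phi>: "\<phi> \<in> l2_space" "\<And>n. jacobi p \<phi> n = 0" "\<phi> s \<noteq> 0"
    and nz: "(\<Sum>\<^sub>\<infinity>n. \<phi> n * \<phi> n) \<noteq> 0"
  shows "\<exists>K\<ge>0. \<forall>f\<in>le_space a. \<exists>u\<in>le_space a. \<exists>k.
    (\<forall>n. jacobi p u n = f n + k * \<phi> n) \<and> le_norm a u \<le> K * le_norm a f \<and> cmod k \<le> K * le_norm a f"
proof -
  have \<phi>a: "\<phi> \<in> le_space a" by (rule jacobi_eigenfunction_decay[OF assms(1-7)])
  obtain K where K: "0 \<le> K" "\<And>f. f \<in> le_space a \<Longrightarrow> \<exists>u\<in>le_space a.
    (\<forall>n. jacobi (p(s := p s + 1)) u n = f n) \<and> le_norm a u \<le> K * le_norm a f"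
    using jacobi_site_solvable[OF assms(1-7)] by blast
  obtain w where w: "w \<in> le_space a" "\<And>n. jacobi (p(s := p s + 1)) w n = \<phi> n"
    using K(2)[OF \<phi>a] by blast
  have w2: "w \<in> l2_space" using le_space_mono(1)[OF w(1) a] .
  have e: "jacobi (p(s := p s + 1)) w = \<phi>" using w(2) by auto
  \<comment> \<open>Here \<open>nz\<close> enters: \<open>w s\<close> must be nonzero for a multiple
    of \<open>w\<close> to cancel the value of a solution at \<open>s\<close>.\<close>
  have "w s * \<phi> s = (\<Sum>\<^sub>\<infinity>n. \<phi> n * \<phi> n)"
    using jacobi_site_pairing[OF w2 _ \<phi>(1,2), of s] \<phi>(1) by (simp add: e)
  then have ws: "w s \<noteq> 0" using nz by auto
  define L where "L = K + K / cmod (w s) * (1 + le_norm a w)"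
  have ws': "0 < cmod (w s)" using ws by simp
  have KL: "K + K / cmod (w s) * le_norm a w \<le> L" "K / cmod (w s) \<le> L"
    using K(1) ws' by (auto simp: L_def distrib_left)
  show ?thesis
  proof (intro exI[of _ L] conjI ballI)
    show "0 \<le> L" using K(1) ws' by (auto simp: L_def)
    fix f :: "int \<Rightarrow> complex" assume f: "f \<in> le_space a"
    obtain v where v: "v \<in> le_space a" "\<And>n. jacobi (p(s := p s + 1)) v n = f n"
      "le_norm a v \<le> K * le_norm a f" using K(2)[OF f] by blast
    define k where "k = - (v s / w s)"
    define u where "u = (\<lambda>n. v n + k * w n)"
    have us: "u s = 0" using ws by (simp add: u_def k_def)
    have Ju: "jacobi p u n = f n + k * \<phi> n" for n
    proof -
      have "jacobi (p(s := p s + 1)) u n = f n + k * \<phi> n"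
        using v(2) w(2) by (simp add: u_def jacobi_add jacobi_cmult)
      then show ?thesis using us by (simp add: jacobi_site split: if_splits)
    qed
    have "cmod (v s) \<le> K * le_norm a f"
      using norm_le_le_norm'[OF v(1) a, of s] v(3) by linarith
    then have kb: "cmod k \<le> K / cmod (w s) * le_norm a f"
      using ws' by (simp add: k_def norm_divide divide_right_mono)
    have kw: "(\<lambda>n. k * w n) \<in> le_space a" "le_norm a (\<lambda>n. k * w n) \<le> cmod k * le_norm a w"
      using le_space_mult[OF w(1), of "\<lambda>_. k" "cmod k"] by auto
    have ua: "u \<in> le_space a" "le_norm a u \<le> le_norm a v + le_norm a (\<lambda>n. k * w n)"
      using le_space_add[OF v(1) kw(1)] by (auto simp: u_def)
    have "cmod k * le_norm a w \<le> K / cmod (w s) * le_norm a f * le_norm a w"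
      using kb by (rule mult_right_mono) simp
    then have "le_norm a u \<le> K * le_norm a f + K / cmod (w s) * le_norm a f * le_norm a w"
      using ua(2) kw(2) v(3) by linarith
    also have "\<dots> = (K + K / cmod (w s) * le_norm a w) * le_norm a f" by (simp add: algebra_simps)
    also have "\<dots> \<le> L * le_norm a f" using KL(1) by (rule mult_right_mono) simp
    finally have ub: "le_norm a u \<le> L * le_norm a f" .
    have "cmod k \<le> L * le_norm a f"
      using kb mult_right_mono[OF KL(2), of "le_norm a f"] by simp
    with Ju ua(1) ub show "\<exists>u\<in>le_space a. \<exists>k. (\<forall>n. jacobi p u n = f n + k * \<phi> n)
      \<and> le_norm a u \<le> L * le_norm a f \<and> cmod k \<le> L * le_norm a f" by blast
  qed
qed

section \<open>Decay of the potential and spectrum off [0,4]\<close>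

lemma finite_superlevel:
  fixes g :: "'i \<Rightarrow> real"
  assumes "g summable_on UNIV" "\<And>n. 0 \<le> g n" "0 < \<epsilon>"
  shows "finite {n. \<epsilon> \<le> g n}"
proof (rule ccontr)
  assume inf: "infinite {n. \<epsilon> \<le> g n}"
  have "g summable_on {n. \<epsilon> \<le> g n}" using assms(1) by (rule summable_on_subset_banach) simp
  then have "(\<lambda>n. norm (g n)) summable_on {n. \<epsilon> \<le> g n}" using assms(2) by simp
  then have "(\<lambda>n. norm \<epsilon>) summable_on {n. \<epsilon> \<le> g n}"
    by (rule Infinite_Sum.abs_summable_on_comparison_test) (use assms in auto)
  then have "(\<lambda>n. \<epsilon>) summable_on {n. \<epsilon> \<le> g n}" using assms(3) by simp
  then show False using infsum_diverge_constant[OF inf, of \<epsilon>] assms(3) by auto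
qed

lemma potential_decay:
  fixes V :: "int \<Rightarrow> real"
  assumes V: "(\<lambda>n. sqrt (1 + \<bar>real_of_int n\<bar>\<^sup>2) * \<bar>V n\<bar>) summable_on UNIV"
  shows "\<exists>B. \<forall>n. \<bar>V n\<bar> \<le> B" "0 < \<epsilon> \<Longrightarrow> finite {n. \<epsilon> \<le> \<bar>V n\<bar>}"
proof -
  define g where "g = (\<lambda>n. sqrt (1 + \<bar>real_of_int n\<bar>\<^sup>2) * \<bar>V n\<bar>)"
  have gs: "g summable_on UNIV" unfolding g_def by (rule V)
  have g0: "0 \<le> g n" for n by (simp add: g_def)
  have Vg: "\<bar>V n\<bar> \<le> g n" for n
  proof -
    have "1 * \<bar>V n\<bar> \<le> sqrt (1 + \<bar>real_of_int n\<bar>\<^sup>2) * \<bar>V n\<bar>" by (rule mult_right_mono) auto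
    then show ?thesis by (simp add: g_def)
  qed
  have "g n \<le> infsum g UNIV" for n
    using finite_sum_le_infsum[OF gs, of "{n}"] g0 by simp
  then show "\<exists>B. \<forall>n. \<bar>V n\<bar> \<le> B" using Vg order_trans by blast
  show "finite {n. \<epsilon> \<le> \<bar>V n\<bar>}" if "0 < \<epsilon>"
    by (rule finite_subset[OF _ finite_superlevel[OF gs g0 that]]) (use Vg order_trans in auto)
qed

text \<open>Outside [0,4] the distance of \<open>l\<close> from the diagonal value 2 of the free
  operator exceeds the hopping norm 2. The constant \<open>c\<close> is the midpoint between 2 and
  this distance, and \<open>F\<close> collects the sites where V could use up the other
  half.\<close>

lemma opot_gap:
  assumes V: "\<And>\<epsilon>. 0 < \<epsilon> \<Longrightarrow> finite {n. \<epsilon> \<le> \<bar>V n\<bar>}" and l: "(l::real) \<notin> {0..4}"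
  shows "\<exists>c F. 2 < c \<and> finite F \<and> (\<forall>n. n \<notin> F \<longrightarrow> c \<le> cmod (opot V (complex_of_real l) n))"
proof -
  define d where "d = \<bar>2 - l\<bar>"
  have d: "2 < d" using l by (auto simp: d_def)
  show ?thesis
  proof (intro exI[of _ "(2 + d) / 2"] exI[of _ "{n. (d - 2) / 2 \<le> \<bar>V n\<bar>}"] conjI allI impI)
    show "2 < (2 + d) / 2" using d by simp
    show "finite {n. (d - 2) / 2 \<le> \<bar>V n\<bar>}" by (rule V) (use d in simp)
    fix n assume "n \<notin> {n. (d - 2) / 2 \<le> \<bar>V n\<bar>}"
    then have "\<bar>V n\<bar> < (d - 2) / 2" by simp
    moreover have "d \<le> \<bar>2 + V n - l\<bar> + \<bar>V n\<bar>" unfolding d_def by linarith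
    ultimately have "(2 + d) / 2 \<le> \<bar>2 + V n - l\<bar>" by (simp add: field_simps)
    also have "\<dots> = cmod (opot V (complex_of_real l) n)"
    proof -
      have "opot V (complex_of_real l) n = complex_of_real (2 + V n - l)" by (simp add: opot_def)
      then show ?thesis by (simp only: norm_of_real)
    qed
    finally show "(2 + d) / 2 \<le> cmod (opot V (complex_of_real l) n)" .
  qed
qed

lemma le_space_jacobi:
  assumes "u \<in> le_space a" "0 \<le> a" "\<And>n. cmod (p n) \<le> B"
  shows "jacobi p u \<in> le_space a"
proof -
  have "jacobi p u = (\<lambda>n. p n * u n - (u (n + 1) + u (n - 1)))"
    by (auto simp: jacobi_def)
  then show ?thesis
    using le_space_diff(1)[OF le_space_mult(1)[OF assms(1,3)] le_space_neighbours(1)[OF assms(1,2)]]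
    by simp
qed

text \<open>Pythagoras with the square of \<open>w\<close> dropped; only the real part of the
  Hermitian product enters.\<close>

lemma l2_norm_orthogonal:
  assumes v: "v \<in> l2_space" and w: "w \<in> l2_space" and orth: "(\<Sum>\<^sub>\<infinity>n. v n * cnj (w n)) = 0"
  shows "l2_norm v \<le> l2_norm (\<lambda>n. v n - w n)"
proof -
  have w': "(\<lambda>n. cnj (w n)) \<in> l2_space" using w by (simp add: le_space_def)
  have s: "(\<lambda>n. v n * cnj (w n)) summable_on UNIV"
    using summable_l2_mult[OF v w'] by (rule abs_summable_summable)
  then have "((\<lambda>n. v n * cnj (w n)) has_sum 0) UNIV" using orth by (simp add: has_sum_iff)
  then have re: "((\<lambda>n. Re (v n * cnj (w n))) has_sum 0) UNIV" using has_sum_Re by fastforce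
  have sv: "((\<lambda>n. (cmod (v n))\<^sup>2) has_sum (\<Sum>\<^sub>\<infinity>n. (cmod (v n))\<^sup>2)) UNIV"
    using v by (auto simp: le_space_def)
  have sd: "((\<lambda>n. (cmod (v n - w n))\<^sup>2) has_sum (\<Sum>\<^sub>\<infinity>n. (cmod (v n - w n))\<^sup>2)) UNIV"
    using le_space_diff(1)[OF v w] by (auto simp: le_space_def)
  have "(\<Sum>\<^sub>\<infinity>n. (cmod (v n))\<^sup>2) + - 2 * 0 \<le> (\<Sum>\<^sub>\<infinity>n. (cmod (v n - w n))\<^sup>2)"
  proof (rule has_sum_mono[OF has_sum_add[OF sv has_sum_cmult_right[OF re, of "-2"]] sd])
    fix n
    have "(cmod (v n - w n))\<^sup>2 = (cmod (v n))\<^sup>2 - 2 * Re (v n * cnj (w n)) + (cmod (w n))\<^sup>2"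
      unfolding cmod_power2 by (simp add: power2_eq_square algebra_simps)
    then show "(cmod (v n))\<^sup>2 + - 2 * Re (v n * cnj (w n)) \<le> (cmod (v n - w n))\<^sup>2" by simp
  qed
  then show ?thesis by (simp add: le_norm_def)
qed

text \<open>The spectral hypothesis of the theorem speaks of discrete eigenvalues, so a null vector
  off [0,4] must be shown to give an isolated point. A null vector v at a nearby \<mu> is orthogonal
  to \<phi>. Inverting the operator with a unit potential at \<open>s\<close> writes v as a multiple
  of \<phi> plus \<open>(\<mu> - l) * w\<close> with \<open>w\<close> bounded by v, and
  orthogonality gives \<open>l2_norm v \<le> cmod (\<mu> - l) * K * l2_norm v\<close>. Hence v = 0,
  and the Fredholm alternative puts \<mu> into the resolvent set.\<close>

lemma discrete_spectrum_schroedinger: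
  fixes V :: "int \<Rightarrow> real" and l :: real
  assumes VB: "\<And>n. \<bar>V n\<bar> \<le> B" and V: "\<And>\<epsilon>. 0 < \<epsilon> \<Longrightarrow> finite {n. \<epsilon> \<le> \<bar>V n\<bar>}"
    and l: "l \<notin> {0..4}"
    and \<phi>: "\<phi> \<in> l2_space" "\<And>n. jacobi (opot V l) \<phi> n = 0" "\<phi> s \<noteq> 0"
  shows "complex_of_real l \<in> discrete_spectrum_on l2_space l2_norm (schroedinger V)"
proof -
  let ?p = "opot V (complex_of_real l)"
  obtain c F where cF: "2 < c" "finite F" "\<forall>n. n \<notin> F \<longrightarrow> c \<le> cmod (?p n)"
    using opot_gap[OF V l] by blast
  obtain K where K: "0 \<le> K" "\<And>f. f \<in> l2_space \<Longrightarrow> \<exists>u\<in>l2_space.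
    (\<forall>n. jacobi (?p(s := ?p s + 1)) u n = f n) \<and> l2_norm u \<le> K * l2_norm f"
    using jacobi_site_solvable[OF order_refl cF(2) _ cF(3) \<phi>] cF(1) by auto
  \<comment> \<open>The first term keeps the diagonal dominant off \<open>F\<close> for all nearby
    \<mu>; the second makes \<open>cmod (\<mu> - l) * K\<close> less than 1.\<close>
  define \<delta> where "\<delta> = min ((c - 2) / 2) (1 / (K + 1))"
  have \<delta>: "0 < \<delta>" using K(1) cF(1) by (simp add: \<delta>_def)
  have inj: "v n = 0" if \<mu>: "cmod (\<mu> - l) < \<delta>" "\<mu> \<noteq> l" and v: "v \<in> l2_space" "\<And>n. jacobi (opot V \<mu>) v n = 0" for v n and \<mu> :: complex
  proof -
    have Jv: "jacobi ?p v = (\<lambda>n. (\<mu> - l) * v n)"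
      using v(2) jacobi_change[of ?p v _ "opot V \<mu>"] by (auto simp: opot_def)
    \<comment> \<open>Conjugation turns the bilinear pairing into the Hermitian product. The
      conjugate is again a null vector because V and \<open>l\<close> are real.\<close>
    define \<phi>' where "\<phi>' = (\<lambda>n. cnj (\<phi> n))"
    have \<phi>': "\<phi>' \<in> l2_space" using \<phi>(1) by (simp add: \<phi>'_def le_space_def)
    have J\<phi>': "jacobi ?p \<phi>' = (\<lambda>n. 0)"
    proof
      fix n
      have "jacobi ?p \<phi>' n = cnj (jacobi ?p \<phi> n)" by (simp add: jacobi_def \<phi>'_def opot_def)
      then show "jacobi ?p \<phi>' n = 0" using \<phi>(2) by simp
    qed
    have "(\<mu> - l) * (\<Sum>\<^sub>\<infinity>n. v n * \<phi>' n) = (\<Sum>\<^sub>\<infinity>n. jacobi ?p v n * \<phi>' n)"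
      by (simp add: Jv mult.assoc infsum_cmult_right')
    also have "\<dots> = (\<Sum>\<^sub>\<infinity>n. v n * jacobi ?p \<phi>' n)"
      by (rule jacobi_pairing[OF v(1) \<phi>'])
        (use le_space_mult(1)[OF v(1), of "\<lambda>_. \<mu> - l"] in \<open>auto simp: Jv J\<phi>'\<close>)
    finally have "(\<Sum>\<^sub>\<infinity>n. v n * \<phi>' n) = 0" using \<mu>(2) by (simp add: J\<phi>')
    then have orth: "(\<Sum>\<^sub>\<infinity>n. v n * cnj (\<phi> n)) = 0" by (simp add: \<phi>'_def)
    obtain w where w: "w \<in> l2_space" "\<And>n. jacobi (?p(s := ?p s + 1)) w n = v n" "l2_norm w \<le> K * l2_norm v"
      using K(2)[OF v(1)] by blast
    \<comment> \<open>With this multiple of \<phi> the point source that the unit potential produces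
      at \<open>s\<close> cancels.\<close>
    define k where "k = v s / \<phi> s"
    have kw: "(\<lambda>n. (\<mu> - l) * w n) \<in> l2_space" "l2_norm (\<lambda>n. (\<mu> - l) * w n) \<le> cmod (\<mu> - l) * l2_norm w"
      using le_space_mult[OF w(1), of "\<lambda>_. \<mu> - l" "cmod (\<mu> - l)"] by auto
    have k\<phi>: "(\<lambda>n. k * \<phi> n) \<in> l2_space" using le_space_mult(1)[OF \<phi>(1), of "\<lambda>_. k"] by auto
    have dec: "v n - k * \<phi> n - (\<mu> - l) * w n = 0" for n
    proof (rule jacobi_site_injective[OF \<phi>, where u = "\<lambda>n. v n - k * \<phi> n - (\<mu> - l) * w n"])
      show "(\<lambda>n. v n - k * \<phi> n - (\<mu> - l) * w n) \<in> l2_space"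
        by (intro le_space_diff v(1) k\<phi> kw)
      show "jacobi (?p(s := ?p s + 1)) (\<lambda>n. v n - k * \<phi> n - (\<mu> - l) * w n) n = 0" for n
        unfolding jacobi_diff jacobi_cmult w(2) using \<phi>(2,3)
        by (simp add: jacobi_site Jv k_def del: fun_upd_apply)
    qed
    then have eq: "(\<lambda>n. v n - k * \<phi> n) = (\<lambda>n. (\<mu> - l) * w n)" by (auto simp: fun_eq_iff)
    have "(\<Sum>\<^sub>\<infinity>n. v n * cnj (k * \<phi> n)) = (\<Sum>\<^sub>\<infinity>n. cnj k * (v n * cnj (\<phi> n)))"
      by (simp add: mult_ac)
    also have "\<dots> = 0" unfolding infsum_cmult_right' orth by simp
    finally have "l2_norm v \<le> l2_norm (\<lambda>n. v n - k * \<phi> n)"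
      by (rule l2_norm_orthogonal[OF v(1) k\<phi>])
    also have "\<dots> \<le> cmod (\<mu> - l) * (K * l2_norm v)"
      using kw(2) mult_left_mono[OF w(3), of "cmod (\<mu> - l)"] by (simp add: eq)
    finally have 1: "l2_norm v \<le> (cmod (\<mu> - l) * K) * l2_norm v" by simp
    have "cmod (\<mu> - l) * (K + 1) < 1" using \<mu>(1) K(1) by (simp add: \<delta>_def pos_less_divide_eq)
    moreover have "cmod (\<mu> - l) * K \<le> cmod (\<mu> - l) * (K + 1)" by (rule mult_left_mono) auto
    ultimately have "cmod (\<mu> - l) * K < 1" by linarith
    then have "l2_norm v \<le> 0"
      using 1 le_norm_nonneg[of 0 v] mult_less_cancel_right2[of "cmod (\<mu> - l) * K" "l2_norm v"]
      by linarith
    then show ?thesis using le_norm_eq_0D[OF v(1)] by blast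
  qed
  have eqJ: "(\<lambda>n. schroedinger V u n - \<mu> * u n) = jacobi (opot V \<mu>) u" for u \<mu>
    by (auto simp: jacobi_opot)
  have res: "\<mu> \<notin> spectrum_on l2_space l2_norm (schroedinger V)" if \<mu>: "cmod (\<mu> - l) < \<delta>" "\<mu> \<noteq> l" for \<mu> :: complex
  proof -
    have far: "\<forall>n. n \<notin> F \<longrightarrow> (2 + c) / 2 \<le> cmod (opot V \<mu> n)"
    proof (intro allI impI)
      fix n assume n: "n \<notin> F"
      have "opot V \<mu> n = ?p n - (\<mu> - l)" by (simp add: opot_def)
      then have "cmod (?p n) - cmod (\<mu> - l) \<le> cmod (opot V \<mu> n)"
        by (metis norm_triangle_ineq2)
      moreover have "cmod (\<mu> - l) < (c - 2) / 2" using \<mu>(1) by (simp add: \<delta>_def)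
      ultimately show "(2 + c) / 2 \<le> cmod (opot V \<mu> n)"
        using cF(3)[rule_format, OF n] by (simp add: field_simps)
    qed
    have "2 * exp 0 < (2 + c) / 2" using cF(1) by simp
    from jacobi_solvable[OF order_refl cF(2) this far] inj[OF \<mu>]
    obtain L where L: "0 \<le> L" "\<And>f. f \<in> l2_space \<Longrightarrow> \<exists>u\<in>l2_space.
      (\<forall>n. jacobi (opot V \<mu>) u n = f n) \<and> l2_norm u \<le> L * l2_norm f" by blast
    have uniq: "u = v" if "u \<in> l2_space" "v \<in> l2_space" "jacobi (opot V \<mu>) u = jacobi (opot V \<mu>) v" for u v
    proof
      fix n
      have "u n - v n = 0"
        by (rule inj[OF \<mu>, of "\<lambda>n. u n - v n"]) (use that in \<open>auto simp: jacobi_diff le_space_diff\<close>)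
      then show "u n = v n" by simp
    qed
    have ran: "jacobi (opot V \<mu>) u \<in> l2_space" if "u \<in> l2_space" for u
    proof (rule le_space_jacobi[OF that])
      fix n
      have "cmod (opot V \<mu> n) \<le> cmod (complex_of_real (2 + V n)) + cmod \<mu>"
        unfolding opot_def by (rule norm_triangle_ineq4)
      also have "cmod (complex_of_real (2 + V n)) \<le> 2 + B"
        unfolding norm_of_real using VB[of n] by linarith
      finally show "cmod (opot V \<mu> n) \<le> 2 + B + cmod \<mu>" by simp
    qed simp
    have sol: "\<exists>u\<in>l2_space. jacobi (opot V \<mu>) u = f \<and> l2_norm u \<le> L * l2_norm f" if "f \<in> l2_space" for f
      using L(2)[OF that] by (auto simp: fun_eq_iff)
    have "bij_betw (\<lambda>u. jacobi (opot V \<mu>) u) l2_space l2_space"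
      unfolding bij_betw_def inj_on_def using uniq ran sol by blast
    moreover have "l2_norm u \<le> L * l2_norm (jacobi (opot V \<mu>) u)" if "u \<in> l2_space" for u
      using sol[OF ran[OF that]] uniq[OF that] by metis
    ultimately show ?thesis unfolding spectrum_on_def eqJ by blast
  qed
  have \<phi>ne: "\<phi> \<noteq> (\<lambda>n. 0)" using \<phi>(3) by auto
  have J\<phi>: "jacobi ?p \<phi> = (\<lambda>n. 0)" using \<phi>(2) by auto
  have J0: "jacobi ?p (\<lambda>n. 0) = (\<lambda>n. 0)" by (auto simp: jacobi_def)
  have "\<not> inj_on (jacobi ?p) l2_space"
    using J\<phi> J0 \<phi>ne \<phi>(1) le_space_zero(1) unfolding inj_on_def by metis
  then have insp: "complex_of_real l \<in> spectrum_on l2_space l2_norm (schroedinger V)"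
    unfolding spectrum_on_def eqJ by (auto simp: bij_betw_def)
  have iso: "complex_of_real l isolated_in spectrum_on l2_space l2_norm (schroedinger V)"
    unfolding isolated_in_def
  proof (intro conjI exI[of _ "ball (complex_of_real l) \<delta>"])
    show "ball (complex_of_real l) \<delta> \<inter> spectrum_on l2_space l2_norm (schroedinger V) = {complex_of_real l}"
    proof -
      have "x = complex_of_real l" if "cmod (x - l) < \<delta>" "x \<in> spectrum_on l2_space l2_norm (schroedinger V)" for x :: complex
        using res that by blast
      then show ?thesis using insp \<delta> by (auto simp: dist_norm norm_minus_commute)
    qed
  qed (use insp in auto)
  have mem: "v \<in> eigenspace_on l2_space (schroedinger V) l \<longleftrightarrow> v \<in> l2_space \<and> (\<forall>n. jacobi ?p v n = 0)" for v
    by (simp add: eigenspace_on_def jacobi_opot)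
  have "eigenspace_on l2_space (schroedinger V) l \<noteq> {0}"
    using mem[of \<phi>] \<phi> \<phi>ne by (auto simp: zero_fun_def)
  \<comment> \<open>Two real directions span a complex line. Agreement at \<open>s\<close> and, by
    the Wronskian, at \<open>s + 1\<close> identifies an eigenvector with a multiple of
    \<phi>.\<close>
  moreover have "eigenspace_on l2_space (schroedinger V) l \<subseteq> span {\<phi>, (\<lambda>n. \<i> * \<phi> n)}"
  proof
    fix v assume "v \<in> eigenspace_on l2_space (schroedinger V) l"
    then have v: "v \<in> l2_space" "\<And>n. jacobi ?p v n = 0" by (auto simp: mem)
    define k where "k = v s / \<phi> s"
    have ws: "v (s + 1) * \<phi> s = v s * \<phi> (s + 1)" by (rule jacobi_wronskian[OF v(1) \<phi>(1) v(2) \<phi>(2)])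
    have "v n - k * \<phi> n = 0" for n
    proof (rule jacobi_initial_unique[where u = "\<lambda>n. v n - k * \<phi> n" and s = s])
      show "jacobi ?p (\<lambda>n. v n - k * \<phi> n) n = 0" for n
        using v(2) \<phi>(2) by (simp add: jacobi_diff jacobi_cmult)
    qed (use \<phi>(3) ws in \<open>auto simp: k_def field_simps\<close>)
    then have "v = Re k *\<^sub>R \<phi> + Im k *\<^sub>R (\<lambda>n. \<i> * \<phi> n)"
      by (auto simp: fun_eq_iff complex_eq_iff)
    then show "v \<in> span {\<phi>, (\<lambda>n. \<i> * \<phi> n)}"
      by (auto intro!: span_add span_scale intro: span_base)
  qed
  moreover have "finite {\<phi>, (\<lambda>n. \<i> * \<phi> n)}" by simp
  ultimately show ?thesis
    unfolding discrete_spectrum_on_def mem_Collect_eq using iso by metis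
qed


section \<open>Resolvents at the harmonics\<close>

text \<open>One format for both kinds of harmonics: \<open>k * \<phi> n\<close> is the solvability
  correction at an eigenvalue and disappears when \<phi> is zero. The weight \<open>g\<close> will
  be \<open>1 + \<bar>m\<bar>\<close>, so that the bound records the decay of the resolvents in
  m.\<close>

definition harmonic_solvable ::
    "(int \<Rightarrow> real) \<Rightarrow> real \<Rightarrow> real \<Rightarrow> real \<Rightarrow> (int \<Rightarrow> real) \<Rightarrow> real \<Rightarrow> bool" where
  "harmonic_solvable V a K l \<phi> g \<longleftrightarrow> (\<forall>f\<in>le_space a. \<exists>u\<in>le_space a. \<exists>k.
     (\<forall>n. schroedinger V u n - l * u n = f n + k * \<phi> n) \<and>
     g * le_norm a u \<le> K * le_norm a f \<and> \<bar>k\<bar> \<le> K * le_norm a f)"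

lemma harmonic_solvable_mono:
  assumes "harmonic_solvable V a K l \<phi> g" "K \<le> K'"
  shows "harmonic_solvable V a K' l \<phi> g"
  using assms(1) mult_right_mono[OF assms(2) le_norm_nonneg] order_trans
  unfolding harmonic_solvable_def by meson

text \<open>V, \<open>l\<close>, f and \<phi> are real, so the real part of a complex solution is a
  solution. The constant \<open>K + g * K\<close> serves the bounds of u and of k
  simultaneously.\<close>

lemma harmonic_solvableI:
  fixes \<phi> :: "int \<Rightarrow> real"
  assumes g: "0 \<le> g" and K: "0 \<le> K"
    and cplx: "\<And>f. f \<in> le_space a \<Longrightarrow> \<exists>u\<in>le_space a. \<exists>k.
      (\<forall>n. jacobi (opot V (complex_of_real l)) u n = f n + k * complex_of_real (\<phi> n)) \<and>
      le_norm a u \<le> K * le_norm a f \<and> cmod k \<le> K * le_norm a f"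
  shows "harmonic_solvable V a (K + g * K) l \<phi> g"
  unfolding harmonic_solvable_def
proof
  fix f :: "int \<Rightarrow> real" assume f: "f \<in> le_space a"
  obtain u k where u: "u \<in> le_space a" "\<And>n. jacobi (opot V l) u n = complex_of_real (f n) + k * complex_of_real (\<phi> n)"
    "le_norm a u \<le> K * le_norm a f" "cmod k \<le> K * le_norm a f"
    using cplx[of "\<lambda>n. complex_of_real (f n)"] f by auto
  show "\<exists>u\<in>le_space a. \<exists>k. (\<forall>n. schroedinger V u n - l * u n = f n + k * \<phi> n)
      \<and> g * le_norm a u \<le> (K + g * K) * le_norm a f \<and> \<bar>k\<bar> \<le> (K + g * K) * le_norm a f"
  proof (intro bexI[of _ "\<lambda>n. Re (u n)"] exI[of _ "Re k"] conjI allI)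
    show "schroedinger V (\<lambda>n. Re (u n)) n - l * Re (u n) = f n + Re k * \<phi> n" for n
      using arg_cong[OF u(2)[of n], of Re]
      by (simp add: jacobi_opot schroedinger_def lap_def)
    have 1: "(\<lambda>n. Re (u n)) \<in> le_space a" "le_norm a (\<lambda>n. Re (u n)) \<le> le_norm a u"
      using le_space_dominated[OF u(1), of 1 "\<lambda>n. Re (u n)"] abs_Re_le_cmod by auto
    then show "(\<lambda>n. Re (u n)) \<in> le_space a" by simp
    have "g * le_norm a (\<lambda>n. Re (u n)) \<le> g * (K * le_norm a f)"
      using 1(2) u(3) g by (intro mult_left_mono) auto
    moreover have "0 \<le> K * le_norm a f" "0 \<le> g * (K * le_norm a f)" using K g by simp_all
    ultimately show "g * le_norm a (\<lambda>n. Re (u n)) \<le> (K + g * K) * le_norm a f"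
      by (simp add: algebra_simps)
    show "\<bar>Re k\<bar> \<le> (K + g * K) * le_norm a f"
      using abs_Re_le_cmod[of k] u(4) \<open>0 \<le> g * (K * le_norm a f)\<close> by (simp add: algebra_simps)
  qed
qed

lemma eventually_exp_less:
  assumes "2 < c"
  shows "\<forall>\<^sub>F a in at_right (0::real). 2 * exp a < c"
proof (rule order_tendstoD)
  have "((\<lambda>a::real. 2 * exp a) \<longlongrightarrow> 2 * exp 0) (at_right 0)" by (intro tendsto_intros)
  then show "((\<lambda>a::real. 2 * exp a) \<longlongrightarrow> 2) (at_right 0)" by simp
qed (fact assms)

text \<open>Stated for all sufficiently small a, so that finitely many harmonics can share one
  exponent. As \<phi> is real and normalised, its bilinear pairing with itself is 1.\<close>

lemma harmonic_eigenvalue: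
  fixes V \<phi> :: "int \<Rightarrow> real"
  assumes V: "\<And>\<epsilon>. 0 < \<epsilon> \<Longrightarrow> finite {n. \<epsilon> \<le> \<bar>V n\<bar>}" and l: "l \<notin> {0..4}"
    and \<phi>: "\<phi> \<in> l2_space" "l2_norm \<phi> = 1" "\<And>n. schroedinger V \<phi> n = l * \<phi> n" and g: "0 \<le> g"
  shows "\<forall>\<^sub>F a in at_right 0. \<phi> \<in> le_space a \<and> (\<exists>K\<ge>0. harmonic_solvable V a K l \<phi> g)"
proof -
  obtain c F where cF: "2 < c" "finite F" "\<forall>n. n \<notin> F \<longrightarrow> c \<le> cmod (opot V (complex_of_real l) n)"
    using opot_gap[OF V l] by blast
  define \<phi>' where "\<phi>' = (\<lambda>n. complex_of_real (\<phi> n))"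
  have \<phi>': "\<phi>' \<in> l2_space" "\<And>n. jacobi (opot V l) \<phi>' n = 0"
  proof -
    show "\<phi>' \<in> l2_space" using \<phi>(1) by (simp add: \<phi>'_def)
    fix n
    have "schroedinger V \<phi>' n = complex_of_real (schroedinger V \<phi> n)"
      by (simp add: schroedinger_def lap_def \<phi>'_def scaleR_conv_of_real)
    then show "jacobi (opot V l) \<phi>' n = 0" by (simp add: jacobi_opot \<phi>(3)) (simp add: \<phi>'_def)
  qed
  have "\<phi> \<noteq> (\<lambda>n. 0)" using \<phi>(2) by auto
  then obtain s where s: "\<phi>' s \<noteq> 0" by (auto simp: \<phi>'_def fun_eq_iff)
  have "(\<Sum>\<^sub>\<infinity>n. (\<phi> n)\<^sup>2) = 1" using \<phi>(2) by (simp add: le_norm_def)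
  moreover have "(\<lambda>n. (\<phi> n)\<^sup>2) summable_on UNIV" using \<phi>(1) by (simp add: le_space_def)
  ultimately have "((\<lambda>n. (\<phi> n)\<^sup>2) has_sum 1) UNIV" by (simp add: has_sum_iff)
  then have "((\<lambda>n. complex_of_real ((\<phi> n)\<^sup>2)) has_sum of_real 1) UNIV" by (rule has_sum_of_real)
  then have nz: "(\<Sum>\<^sub>\<infinity>n. \<phi>' n * \<phi>' n) \<noteq> 0" by (simp add: infsumI \<phi>'_def power2_eq_square)
  show ?thesis
    using eventually_exp_less[OF cF(1)] eventually_at_right_less
  proof eventually_elim
    case (elim a)
    have "\<phi>' \<in> le_space a"
      by (rule jacobi_eigenfunction_decay[OF _ cF(2) elim(1) cF(3) \<phi>' s]) (use elim in simp)
    moreover obtain K where K: "K \<ge> 0" "\<forall>f\<in>le_space a. \<exists>u\<in>le_space a. \<exists>k.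
      (\<forall>n. jacobi (opot V l) u n = f n + k * \<phi>' n) \<and> le_norm a u \<le> K * le_norm a f \<and> cmod k \<le> K * le_norm a f"
      using jacobi_eigen_solvable[OF _ cF(2) elim(1) cF(3) \<phi>' s nz] elim by auto
    have "harmonic_solvable V a (K + g * K) l \<phi> g"
      by (rule harmonic_solvableI[OF g K(1)]) (use K(2) in \<open>auto simp: \<phi>'_def\<close>)
    ultimately show ?case using K(1) g by (auto simp: \<phi>'_def intro!: exI[of _ "K + g * K"])
  qed
qed

text \<open>A null vector in l2 would make \<open>l\<close> a point of the discrete spectrum; the
  weighted spaces lie in l2, so the Fredholm alternative applies in them.\<close>

lemma harmonic_nonresonant:
  fixes V \<phi> :: "int \<Rightarrow> real"
  assumes VB: "\<And>n. \<bar>V n\<bar> \<le> B" and V: "\<And>\<epsilon>. 0 < \<epsilon> \<Longrightarrow> finite {n. \<epsilon> \<le> \<bar>V n\<bar>}"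
    and l: "l \<notin> {0..4}"
    and ns: "complex_of_real l \<notin> discrete_spectrum_on l2_space l2_norm (schroedinger V)"
    and g: "0 \<le> g"
  shows "\<forall>\<^sub>F a in at_right 0. \<exists>K\<ge>0. harmonic_solvable V a K l \<phi> g"
proof -
  obtain c F where cF: "2 < c" "finite F" "\<forall>n. n \<notin> F \<longrightarrow> c \<le> cmod (opot V (complex_of_real l) n)"
    using opot_gap[OF V l] by blast
  have inj: "u n = 0" if "u \<in> l2_space" "\<And>n. jacobi (opot V l) u n = 0" for u n
    using discrete_spectrum_schroedinger[OF VB V l that] ns by blast
  show ?thesis
    using eventually_exp_less[OF cF(1)] eventually_at_right_less
  proof eventually_elim
    case (elim a)
    then have a: "0 \<le> a" by simp
    obtain K where K: "K \<ge> 0" "\<And>f. f \<in> le_space a \<Longrightarrow> \<exists>u\<in>le_space a.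
      (\<forall>n. jacobi (opot V l) u n = f n) \<and> le_norm a u \<le> K * le_norm a f"
      using jacobi_solvable[OF a cF(2) elim(1) cF(3)] inj le_space_mono(1)[OF _ a] by blast
    have "harmonic_solvable V a (K + g * K) l \<phi> g"
    proof (rule harmonic_solvableI[OF g K(1)])
      fix f :: "int \<Rightarrow> complex" assume f: "f \<in> le_space a"
      obtain u where "u \<in> le_space a" "\<And>n. jacobi (opot V l) u n = f n" "le_norm a u \<le> K * le_norm a f"
        using K(2)[OF f] by blast
      then show "\<exists>u\<in>le_space a. \<exists>k. (\<forall>n. jacobi (opot V (complex_of_real l)) u n = f n + k * complex_of_real (\<phi> n)) \<and>
          le_norm a u \<le> K * le_norm a f \<and> cmod k \<le> K * le_norm a f"
        using K(1) by (intro bexI[of _ u] exI[of _ 0]) auto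
    qed
    then show ?case using K(1) g by (auto intro!: exI[of _ "K + g * K"])
  qed
qed

text \<open>Far away no finite set has to be excised: the diagonal exceeds \<open>2 * exp a\<close>
  by at least \<open>k * g\<close> at every site, and this margin gives the resolvent bound. The
  range of a does not depend on \<open>g\<close>, as infinitely many harmonics demand.\<close>

lemma harmonic_far:
  fixes V :: "int \<Rightarrow> real"
  assumes VB: "\<And>n. \<bar>V n\<bar> \<le> B" and a: "0 \<le> a" "a \<le> 1" and k: "0 < k"
    and far: "2 + B + 2 * exp 1 + k * g \<le> \<bar>l\<bar>" and g: "0 < g"
  shows "harmonic_solvable V a (1 / k) l (\<lambda>n. 0) g"
  unfolding harmonic_solvable_def
proof
  fix f :: "int \<Rightarrow> real" assume f: "f \<in> le_space a"
  define c where "c = 2 * exp a + k * g"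
  have c: "2 * exp a < c" using k g by (simp add: c_def)
  have ea: "exp a \<le> exp 1" using a by simp
  have p: "c \<le> cmod (opot V l n)" for n
  proof -
    have "c \<le> \<bar>2 + V n - l\<bar>" using VB[of n] far ea unfolding c_def by linarith
    also have "\<dots> = cmod (complex_of_real (2 + V n - l))" by (simp only: norm_of_real)
    finally show ?thesis by (simp add: opot_def)
  qed
  obtain u where u: "u \<in> le_space a" "\<And>n. jacobi (opot V l) u n = complex_of_real (f n)"
    "le_norm a u \<le> le_norm a f / (c - 2 * exp a)"
    using jacobi_dominant_solvable[of "\<lambda>n. complex_of_real (f n)" a c "opot V l"] f a(1) c p by auto
  show "\<exists>u\<in>le_space a. \<exists>k'. (\<forall>n. schroedinger V u n - l * u n = f n + k' * 0)
      \<and> g * le_norm a u \<le> 1 / k * le_norm a f \<and> \<bar>k'\<bar> \<le> 1 / k * le_norm a f"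
  proof (intro bexI[of _ "\<lambda>n. Re (u n)"] exI[of _ 0] conjI allI)
    show "schroedinger V (\<lambda>n. Re (u n)) n - l * Re (u n) = f n + 0 * 0" for n
      using arg_cong[OF u(2)[of n], of Re] by (simp add: jacobi_opot schroedinger_def lap_def)
    have 1: "(\<lambda>n. Re (u n)) \<in> le_space a" "le_norm a (\<lambda>n. Re (u n)) \<le> le_norm a u"
      using le_space_dominated[OF u(1), of 1 "\<lambda>n. Re (u n)"] abs_Re_le_cmod by auto
    then show "(\<lambda>n. Re (u n)) \<in> le_space a" by simp
    have "le_norm a (\<lambda>n. Re (u n)) \<le> le_norm a f / (k * g)" using 1(2) u(3) by (simp add: c_def)
    then have "g * le_norm a (\<lambda>n. Re (u n)) \<le> g * (le_norm a f / (k * g))"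
      using g by (intro mult_left_mono) auto
    then show "g * le_norm a (\<lambda>n. Re (u n)) \<le> 1 / k * le_norm a f" using g by simp
    show "\<bar>0\<bar> \<le> 1 / k * le_norm a f" using k by simp
  qed
qed

lemma harmonic_solvable_family:
  fixes V \<phi>1 \<phi>2 :: "int \<Rightarrow> real"
  assumes V: "(\<lambda>n. sqrt (1 + \<bar>real_of_int n\<bar>\<^sup>2) * \<bar>V n\<bar>) summable_on UNIV"
    and less: "e1 < e2"
    and spec: "discrete_spectrum_on l2_space l2_norm (schroedinger V) = {complex_of_real e1, complex_of_real e2}"
    and nonres: "\<And>n::int. e1 + of_int n * (e2 - e1) \<notin> {0..4}"
    and phi1: "\<phi>1 \<in> l2_space" "l2_norm \<phi>1 = 1" "\<And>n. schroedinger V \<phi>1 n = e1 * \<phi>1 n"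
    and phi2: "\<phi>2 \<in> l2_space" "l2_norm \<phi>2 = 1" "\<And>n. schroedinger V \<phi>2 n = e2 * \<phi>2 n"
    and a0: "0 < a0"
  shows "\<exists>a K. 0 < a \<and> a < a0 \<and> 0 \<le> K \<and> \<phi>1 \<in> le_space a \<and> \<phi>2 \<in> le_space a \<and>
    (\<forall>m::int. harmonic_solvable V a K (e1 + of_int m * (e2 - e1))
       (if m = 0 then \<phi>1 else if m = 1 then \<phi>2 else (\<lambda>n. 0)) (1 + \<bar>of_int m\<bar>))"
proof -
  define \<phi> where "\<phi> m = (if m = 0 then \<phi>1 else if m = 1 then \<phi>2 else (\<lambda>n. 0))" for m :: int
  define l where "l m = e1 + of_int m * (e2 - e1)" for m :: int
  define g :: "int \<Rightarrow> real" where "g m = 1 + \<bar>of_int m\<bar>" for m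
  have g: "0 < g m" for m by (simp add: g_def)
  obtain B where B: "\<And>n. \<bar>V n\<bar> \<le> B" using potential_decay(1)[OF V] by blast
  note fin = potential_decay(2)[OF V]
  have l: "l m \<notin> {0..4}" for m using nonres by (simp add: l_def)
  have l0: "l 0 = e1" "l 1 = e2" by (simp_all add: l_def)
  have e1: "\<forall>\<^sub>F a in at_right 0. \<phi>1 \<in> le_space a \<and> (\<exists>K\<ge>0. harmonic_solvable V a K (l 0) \<phi>1 (g 0))"
    by (rule harmonic_eigenvalue[OF fin l phi1(1,2)]) (use phi1(3) g[of 0] in \<open>auto simp: l0\<close>)
  have e2: "\<forall>\<^sub>F a in at_right 0. \<phi>2 \<in> le_space a \<and> (\<exists>K\<ge>0. harmonic_solvable V a K (l 1) \<phi>2 (g 1))"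
    by (rule harmonic_eigenvalue[OF fin l phi2(1,2)]) (use phi2(3) g[of 1] in \<open>auto simp: l0\<close>)
  have each: "\<forall>\<^sub>F a in at_right 0. \<exists>K\<ge>0. harmonic_solvable V a K (l m) (\<phi> m) (g m)" for m
  proof (cases "m = 0 \<or> m = 1")
    case True
    then show ?thesis using e1 e2 by (auto simp: \<phi>_def elim: eventually_mono)
  next
    case False
    have "l m - e1 = of_int m * (e2 - e1)" "l m - e2 = of_int (m - 1) * (e2 - e1)"
      by (simp_all add: l_def algebra_simps)
    then have "l m \<noteq> e1" "l m \<noteq> e2" using False less by auto
    then have "complex_of_real (l m) \<notin> discrete_spectrum_on l2_space l2_norm (schroedinger V)"
      unfolding spec by (simp del: of_real_add of_real_diff of_real_mult)
    then show ?thesis using g[of m] by (intro harmonic_nonresonant[OF B fin l]) auto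
  qed
  \<comment> \<open>Half the spacing: the displacement \<open>2 * k * \<bar>m\<bar>\<close> of the
    m-th harmonic pays \<open>k * \<bar>m\<bar>\<close> for the weight and leaves as much for the
    remaining constants, which determines \<open>M\<close>.\<close>
  define k where "k = (e2 - e1) / 2"
  have k: "0 < k" using less by (simp add: k_def)
  define M where "M = \<lceil>(2 + B + 2 * exp 1 + k + \<bar>e1\<bar>) / k\<rceil> + 1"
  have far: "harmonic_solvable V a (1 / k) (l m) (\<phi> m) (g m)" if "M < \<bar>m\<bar>" "0 \<le> a" "a \<le> 1" for m a
  proof -
    have B0: "0 \<le> B" using B[of 0] by linarith
    have "0 < (2 + B + 2 * exp 1 + k + \<bar>e1\<bar>) / k" using k B0 exp_gt_zero[of "1::real"]
      by (intro divide_pos_pos) linarith+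
    then have "1 \<le> M" unfolding M_def by linarith
    then have "m \<noteq> 0" "m \<noteq> 1" using that by auto
    then have z: "\<phi> m = (\<lambda>n. 0)" by (simp add: \<phi>_def)
    have "(2 + B + 2 * exp 1 + k + \<bar>e1\<bar>) / k \<le> \<bar>of_int m\<bar>"
      using that(1) unfolding M_def by linarith
    then have "2 + B + 2 * exp 1 + k + \<bar>e1\<bar> \<le> k * \<bar>of_int m\<bar>" using k by (simp add: field_simps)
    moreover have "\<bar>of_int m * (e2 - e1)\<bar> = 2 * (k * \<bar>of_int m\<bar>)" using less by (simp add: k_def abs_mult)
    ultimately have "2 + B + 2 * exp 1 + k * g m \<le> \<bar>l m\<bar>"
      unfolding l_def g_def distrib_left by linarith
    then show ?thesis unfolding z by (intro harmonic_far[OF B that(2,3) k _ g])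
  qed
  \<comment> \<open>An exponent small enough for the finitely many near harmonics and below 1 also
    serves all the far ones.\<close>
  have "finite {m. \<bar>m\<bar> \<le> M}"
    by (rule finite_subset[of _ "{-M..M}"]) auto
  then have "\<forall>\<^sub>F a in at_right 0. \<forall>m\<in>{m. \<bar>m\<bar> \<le> M}. \<exists>K\<ge>0. harmonic_solvable V a K (l m) (\<phi> m) (g m)"
    using each by (intro eventually_ball_finite) auto
  moreover have "\<forall>\<^sub>F a in at_right 0. a < min a0 1"
    using a0 by (intro order_tendstoD(2)[OF tendsto_ident_at]) auto
  ultimately have "\<forall>\<^sub>F a in at_right 0. 0 < a \<and> a < min a0 1 \<and> \<phi>1 \<in> le_space a \<and> \<phi>2 \<in> le_space a \<and>
      (\<forall>m\<in>{m. \<bar>m\<bar> \<le> M}. \<exists>K\<ge>0. harmonic_solvable V a K (l m) (\<phi> m) (g m))"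
    using e1 e2 eventually_at_right_less[of "0::real"] by eventually_elim auto
  from eventually_happens[OF this] obtain a where a: "0 < a" "a < min a0 1" "\<phi>1 \<in> le_space a" "\<phi>2 \<in> le_space a"
      "\<forall>m\<in>{m. \<bar>m\<bar> \<le> M}. \<exists>K\<ge>0. harmonic_solvable V a K (l m) (\<phi> m) (g m)"
    using trivial_limit_at_right_real by blast
  obtain K where K: "\<And>m. \<bar>m\<bar> \<le> M \<Longrightarrow> 0 \<le> K m \<and> harmonic_solvable V a (K m) (l m) (\<phi> m) (g m)"
    using a(5) by (metis mem_Collect_eq)
  define L where "L = 1 / k + (\<Sum>m | \<bar>m\<bar> \<le> M. K m)"
  have "harmonic_solvable V a L (l m) (\<phi> m) (g m)" for m
  proof (cases "\<bar>m\<bar> \<le> M")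
    case True
    have "K m \<le> (\<Sum>m | \<bar>m\<bar> \<le> M. K m)"
      using \<open>finite {m. \<bar>m\<bar> \<le> M}\<close> True K by (intro member_le_sum) auto
    moreover have "0 < 1 / k" using k by simp
    ultimately have "K m \<le> L" unfolding L_def by linarith
    with K[OF True] show ?thesis using harmonic_solvable_mono by blast
  next
    case False
    have "0 \<le> (\<Sum>m | \<bar>m\<bar> \<le> M. K m)" using K by (intro sum_nonneg) auto
    then have "1 / k \<le> L" by (simp add: L_def)
    moreover have "harmonic_solvable V a (1 / k) (l m) (\<phi> m) (g m)"
      by (rule far) (use False a in simp_all)
    ultimately show ?thesis using harmonic_solvable_mono by metis
  qed
  moreover have "0 \<le> L" using K k by (auto simp: L_def intro!: add_nonneg_nonneg sum_nonneg)
  ultimately have "0 < a \<and> a < a0 \<and> 0 \<le> L \<and> \<phi>1 \<in> le_space a \<and> \<phi>2 \<in> le_space a \<and>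
      (\<forall>m. harmonic_solvable V a L (l m) (\<phi> m) (g m))" using a by simp
  then show ?thesis unfolding \<phi>_def l_def g_def by blast
qed


section \<open>Power series in two complex variables and their conjugates\<close>

text \<open>The exponents of \<open>z1\<close>, \<open>cnj z1\<close>, \<open>z2\<close>, \<open>cnj z2\<close>.\<close>

datatype mono = Mono nat nat nat nat

instantiation mono :: plus
begin

fun plus_mono :: "mono \<Rightarrow> mono \<Rightarrow> mono" where
  "Mono a b c d + Mono a' b' c' d' = Mono (a + a') (b + b') (c + c') (d + d')"

instance ..

end

fun deg :: "mono \<Rightarrow> nat" where "deg (Mono a b c d) = a + b + c + d"
text \<open>Rotating z1 by \<alpha> and z2 by \<beta> rotates a monomial by
  \<open>(charge - hindex) * \<alpha> + hindex * \<beta>\<close>. Charge 1 is gauge covariance, and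
  there \<open>hindex\<close> alone fixes the frequency.\<close>

fun charge :: "mono \<Rightarrow> int" where "charge (Mono a b c d) = int a - int b + int c - int d"
fun hindex :: "mono \<Rightarrow> int" where "hindex (Mono a b c d) = int c - int d"
fun mixed :: "mono \<Rightarrow> bool" where "mixed (Mono a b c d) \<longleftrightarrow> 0 < a + b \<and> 0 < c + d"
fun mconj :: "mono \<Rightarrow> mono" where "mconj (Mono a b c d) = Mono b a d c"
fun mval :: "complex \<times> complex \<Rightarrow> mono \<Rightarrow> complex" where
  "mval (z, w) (Mono a b c d) = z ^ a * cnj z ^ b * w ^ c * cnj w ^ d"

lemma deg_add [simp]: "deg (\<mu> + \<nu>) = deg \<mu> + deg \<nu>"
  by (cases \<mu>; cases \<nu>) simp

lemma charge_add [simp]: "charge (\<mu> + \<nu>) = charge \<mu> + charge \<nu>"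
  by (cases \<mu>; cases \<nu>) simp

lemma mixed_add: "mixed \<mu> \<or> mixed \<nu> \<Longrightarrow> mixed (\<mu> + \<nu>)"
  by (cases \<mu>; cases \<nu>) auto

lemma mval_add: "mval z (\<mu> + \<nu>) = mval z \<mu> * mval z \<nu>"
  by (cases \<mu>; cases \<nu>; cases z) (simp add: power_add mult_ac)

lemma mconj_simps [simp]: "mconj (mconj \<mu>) = \<mu>" "deg (mconj \<mu>) = deg \<mu>" "charge (mconj \<mu>) = - charge \<mu>"
  by (cases \<mu>; simp)+

lemma mval_mconj: "mval z (mconj \<mu>) = cnj (mval z \<mu>)"
  by (cases \<mu>; cases z) (simp add: mult_ac)

lemma cmod_mval_le:
  assumes "cmod (fst z) \<le> r" "cmod (snd z) \<le> r"
  shows "cmod (mval z \<mu>) \<le> r ^ deg \<mu>"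
proof -
  obtain z1 z2 a b c d where [simp]: "z = (z1, z2)" "\<mu> = Mono a b c d" by (cases z; cases \<mu>)
  have "cmod (mval z \<mu>) = cmod z1 ^ (a + b) * cmod z2 ^ (c + d)"
    by (simp add: norm_mult norm_power power_add mult_ac)
  also have "\<dots> \<le> r ^ (a + b) * r ^ (c + d)"
    using assms order_trans[OF norm_ge_zero assms(1)] by (intro mult_mono power_mono) auto
  finally show ?thesis by (simp add: power_add mult_ac)
qed

section \<open>Cauchy products and weighted majorants\<close>

definition splits :: "mono \<Rightarrow> (mono \<times> mono) set" where
  "splits \<mu> = {p. fst p + snd p = \<mu>}"

lemma finite_splits [simp]: "finite (splits \<mu>)"
proof -
  obtain a b c d where \<mu>: "\<mu> = Mono a b c d" by (cases \<mu>)
  let ?T = "(\<lambda>(a, b, c, d). Mono a b c d) ` ({..a} \<times> {..b} \<times> {..c} \<times> {..d})"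
  have T: "x \<in> ?T" if e: "x + y = \<mu> \<or> y + x = \<mu>" for x y
  proof -
    obtain a' b' c' d' where x: "x = Mono a' b' c' d'" by (cases x)
    have "(a', b', c', d') \<in> {..a} \<times> {..b} \<times> {..c} \<times> {..d}"
      using e by (cases y) (auto simp: x \<mu>)
    then show ?thesis unfolding x by force
  qed
  have "splits \<mu> \<subseteq> ?T \<times> ?T"
  proof
    fix p assume "p \<in> splits \<mu>"
    then have e: "fst p + snd p = \<mu>" by (simp add: splits_def)
    show "p \<in> ?T \<times> ?T"
      unfolding mem_Times_iff using T[of "fst p" "snd p"] T[of "snd p" "fst p"] e by simp
  qed
  then show ?thesis by (rule finite_subset) simp
qed

definition conv :: "(mono \<Rightarrow> real) \<Rightarrow> (mono \<Rightarrow> real) \<Rightarrow> mono \<Rightarrow> real" where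
  "conv g h \<mu> = (\<Sum>p\<in>splits \<mu>. g (fst p) * h (snd p))"

lemma conv_nonzeroD:
  assumes "conv g h \<mu> \<noteq> 0"
  obtains \<nu> \<kappa> where "\<mu> = \<nu> + \<kappa>" "g \<nu> \<noteq> 0" "h \<kappa> \<noteq> 0"
proof -
  obtain p where "p \<in> splits \<mu>" "g (fst p) * h (snd p) \<noteq> 0"
    using assms sum.not_neutral_contains_not_neutral unfolding conv_def by blast
  then show thesis using that[of "fst p" "snd p"] by (auto simp: splits_def)
qed

text \<open>Factors of positive order gain degrees of agreement, so the iteration below stabilises degree by degree.\<close>

lemma conv_agree:
  assumes g: "\<And>\<mu>. deg \<mu> < d1 \<Longrightarrow> g \<mu> = g' \<mu>" and h: "\<And>\<mu>. deg \<mu> < d2 \<Longrightarrow> h \<mu> = h' \<mu>"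
    and gk: "\<And>\<mu>. deg \<mu> < k1 \<Longrightarrow> g \<mu> = 0 \<and> g' \<mu> = 0"
    and hk: "\<And>\<mu>. deg \<mu> < k2 \<Longrightarrow> h \<mu> = 0 \<and> h' \<mu> = 0"
    and d: "d \<le> d1 + k2" "d \<le> d2 + k1" and \<mu>: "deg \<mu> < d"
  shows "conv g h \<mu> = conv g' h' \<mu>"
  unfolding conv_def
proof (rule sum.cong)
  fix p assume p: "p \<in> splits \<mu>"
  have "deg \<mu> = deg (fst p + snd p)" using p by (simp add: splits_def)
  then have dg: "deg (fst p) + deg (snd p) < d" using \<mu> by simp
  consider "deg (fst p) < d1" "deg (snd p) < d2" | "d1 \<le> deg (fst p)" | "d2 \<le> deg (snd p)" by linarith
  then show "g (fst p) * h (snd p) = g' (fst p) * h' (snd p)"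
  proof cases
    case 2
    then have "deg (snd p) < k2" using dg d(1) by linarith
    from hk[OF this] show ?thesis by simp
  next
    case 3
    then have "deg (fst p) < k1" using dg d(2) by linarith
    from gk[OF this] show ?thesis by simp
  qed (use g h in simp)
qed simp

text \<open>A weighted l1 bound for a majorant on the polydisc of radius r. Testing on finite sets
  keeps the bound stable under limits taken degree by degree.\<close>

definition mbound :: "real \<Rightarrow> (mono \<Rightarrow> real) \<Rightarrow> real \<Rightarrow> bool" where
  "mbound r F R \<longleftrightarrow> (\<forall>\<mu>. 0 \<le> F \<mu>) \<and> (\<forall>S. finite S \<longrightarrow> (\<Sum>\<mu>\<in>S. r ^ deg \<mu> * F \<mu>) \<le> R)"

lemma mboundD: "mbound r F R \<Longrightarrow> 0 \<le> F \<mu>" "mbound r F R \<Longrightarrow> finite S \<Longrightarrow> (\<Sum>\<mu>\<in>S. r ^ deg \<mu> * F \<mu>) \<le> R"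
  by (auto simp: mbound_def)

lemma mbound_nonneg: "mbound r F R \<Longrightarrow> 0 \<le> R"
  using mboundD(2)[of r F R "{}"] by simp

lemma mbound_mono:
  assumes "mbound r F R" "\<And>\<mu>. 0 \<le> G \<mu>" "\<And>\<mu>. G \<mu> \<le> F \<mu>" "R \<le> R'" "0 \<le> r"
  shows "mbound r G R'"
  unfolding mbound_def
proof (intro conjI allI impI)
  fix S :: "mono set" assume S: "finite S"
  have "(\<Sum>\<mu>\<in>S. r ^ deg \<mu> * G \<mu>) \<le> (\<Sum>\<mu>\<in>S. r ^ deg \<mu> * F \<mu>)"
    using assms by (intro sum_mono mult_left_mono) auto
  also have "\<dots> \<le> R" using mboundD(2)[OF assms(1) S] .
  finally show "(\<Sum>\<mu>\<in>S. r ^ deg \<mu> * G \<mu>) \<le> R'" using assms(4) by simp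
qed (use assms in auto)

lemma mbound_add:
  assumes "mbound r F A" "mbound r G B"
  shows "mbound r (\<lambda>\<mu>. F \<mu> + G \<mu>) (A + B)"
  unfolding mbound_def
  using add_mono[OF mboundD(2)[OF assms(1)] mboundD(2)[OF assms(2)]] mboundD(1)[OF assms(1)] mboundD(1)[OF assms(2)]
  by (auto simp: distrib_left sum.distrib)

lemma mbound_cmult:
  assumes "mbound r F A" "0 \<le> c"
  shows "mbound r (\<lambda>\<mu>. c * F \<mu>) (c * A)"
  unfolding mbound_def
  using mult_left_mono[OF mboundD(2)[OF assms(1)] assms(2)] mboundD(1)[OF assms(1)] assms(2)
  by (auto simp: sum_distrib_left mult.left_commute)

text \<open>A pair determines the monomial that it splits, so the double sum over \<open>S\<close>
  and its splittings embeds into a rectangle, where it factors.\<close>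

lemma mbound_conv:
  assumes F: "mbound r F A" and G: "mbound r G B" and r: "0 \<le> r"
  shows "mbound r (conv F G) (A * B)"
  unfolding mbound_def
proof (intro conjI allI impI)
  show "0 \<le> conv F G \<mu>" for \<mu>
    using mboundD(1)[OF F] mboundD(1)[OF G] by (auto simp: conv_def intro!: sum_nonneg)
  fix S :: "mono set" assume S: "finite S"
  let ?P = "Sigma S splits"
  let ?S1 = "(\<lambda>x. fst (snd x)) ` ?P" and ?S2 = "(\<lambda>x. snd (snd x)) ` ?P"
  have fin: "finite ?P" using S by auto
  have nn: "0 \<le> r ^ deg \<mu> * F \<mu>" "0 \<le> r ^ deg \<mu> * G \<mu>" for \<mu>
    using r mboundD(1)[OF F] mboundD(1)[OF G] by simp_all
  have "(\<Sum>\<mu>\<in>S. r ^ deg \<mu> * conv F G \<mu>) = (\<Sum>x\<in>?P. r ^ deg (fst x) * (F (fst (snd x)) * G (snd (snd x))))"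
    using S by (simp add: conv_def sum_distrib_left sum.Sigma split_def)
  also have "\<dots> = (\<Sum>x\<in>?P. (r ^ deg (fst (snd x)) * F (fst (snd x))) * (r ^ deg (snd (snd x)) * G (snd (snd x))))"
    by (intro sum.cong) (auto simp: splits_def power_add mult_ac)
  also have "\<dots> = (\<Sum>q\<in>snd ` ?P. (r ^ deg (fst q) * F (fst q)) * (r ^ deg (snd q) * G (snd q)))"
    by (subst sum.reindex) (auto simp: inj_on_def splits_def)
  also have "\<dots> \<le> (\<Sum>q\<in>?S1 \<times> ?S2. (r ^ deg (fst q) * F (fst q)) * (r ^ deg (snd q) * G (snd q)))"
    using fin nn by (intro sum_mono2) (force intro: mult_nonneg_nonneg)+
  also have "\<dots> = (\<Sum>\<mu>\<in>?S1. r ^ deg \<mu> * F \<mu>) * (\<Sum>\<mu>\<in>?S2. r ^ deg \<mu> * G \<mu>)"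
    by (simp add: sum_product sum.cartesian_product split_def)
  also have "\<dots> \<le> A * B"
    using mboundD(2)[OF F, of ?S1] mboundD(2)[OF G, of ?S2] fin nn mbound_nonneg[OF F]
    by (intro mult_mono sum_nonneg) auto
  finally show "(\<Sum>\<mu>\<in>S. r ^ deg \<mu> * conv F G \<mu>) \<le> A * B" .
qed

text \<open>Dividing a series by a monomial of degree k costs \<open>r ^ k\<close>. With k = 1 this
  converts a bound for z1 or z2 times \<epsilon> into one for \<epsilon>.\<close>

lemma mbound_reindex:
  assumes F: "mbound r F A" and r: "0 < r" and inj: "inj_on h {\<mu>. P \<mu>}"
    and dg: "\<And>\<mu>. P \<mu> \<Longrightarrow> deg (h \<mu>) = deg \<mu> + k"
  shows "mbound r (\<lambda>\<mu>. if P \<mu> then F (h \<mu>) else 0) (A / r ^ k)"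
  unfolding mbound_def
proof (intro conjI allI impI)
  show "0 \<le> (if P \<mu> then F (h \<mu>) else 0)" for \<mu> using mboundD(1)[OF F] by simp
  fix S :: "mono set" assume S: "finite S"
  let ?T = "{\<mu>\<in>S. P \<mu>}"
  have "r ^ k * (\<Sum>\<mu>\<in>S. r ^ deg \<mu> * (if P \<mu> then F (h \<mu>) else 0)) = r ^ k * (\<Sum>\<mu>\<in>?T. r ^ deg \<mu> * F (h \<mu>))"
    using S by (simp add: sum.inter_filter if_distrib cong: if_cong)
  also have "\<dots> = (\<Sum>\<mu>\<in>?T. r ^ deg (h \<mu>) * F (h \<mu>))"
    unfolding sum_distrib_left using dg by (intro sum.cong) (auto simp: power_add mult_ac)
  also have "\<dots> = (\<Sum>\<mu>\<in>h ` ?T. r ^ deg \<mu> * F \<mu>)"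
    using inj by (subst sum.reindex) (auto simp: inj_on_def)
  also have "\<dots> \<le> A" using S by (intro mboundD(2)[OF F]) auto
  finally show "(\<Sum>\<mu>\<in>S. r ^ deg \<mu> * (if P \<mu> then F (h \<mu>) else 0)) \<le> A / r ^ k"
    using r by (simp add: pos_le_divide_eq mult.commute)
qed

lemma mbound_mconj:
  assumes "mbound r F A" "0 < r"
  shows "mbound r (\<lambda>\<mu>. F (mconj \<mu>)) A"
proof -
  have "inj_on mconj {\<mu>. True}" by (metis inj_onI mconj_simps(1))
  from mbound_reindex[OF assms this, of 0] show ?thesis by simp
qed

lemma mbound_summable:
  assumes F: "mbound r F A" and r: "0 \<le> r"
  shows "(\<lambda>\<mu>. r ^ deg \<mu> * F \<mu>) summable_on UNIV" "(\<Sum>\<^sub>\<infinity>\<mu>. r ^ deg \<mu> * F \<mu>) \<le> A"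
proof -
  show s: "(\<lambda>\<mu>. r ^ deg \<mu> * F \<mu>) summable_on UNIV"
    using mboundD[OF F] r by (intro nonneg_bdd_above_summable_on) (auto intro!: bdd_aboveI2[where M = A])
  show "(\<Sum>\<^sub>\<infinity>\<mu>. r ^ deg \<mu> * F \<mu>) \<le> A"
    using mboundD(2)[OF F] by (intro infsum_le_finite_sums[OF s]) auto
qed

section \<open>Evaluation of scalar series\<close>

definition ev :: "(mono \<Rightarrow> real) \<Rightarrow> complex \<times> complex \<Rightarrow> complex" where
  "ev g z = (\<Sum>\<^sub>\<infinity>\<mu>. of_real (g \<mu>) * mval z \<mu>)"

definition abs_conv :: "real \<Rightarrow> (mono \<Rightarrow> real) \<Rightarrow> bool" where
  "abs_conv r g \<longleftrightarrow> (\<exists>R. mbound r (\<lambda>\<mu>. \<bar>g \<mu>\<bar>) R)"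

abbreviation bidisc :: "real \<Rightarrow> (complex \<times> complex) set" where
  "bidisc r \<equiv> {z. cmod (fst z) \<le> r \<and> cmod (snd z) \<le> r}"

lemma abs_convI: "mbound r F R \<Longrightarrow> (\<And>\<mu>. \<bar>g \<mu>\<bar> \<le> F \<mu>) \<Longrightarrow> 0 \<le> r \<Longrightarrow> abs_conv r g"
  unfolding abs_conv_def by (meson abs_ge_zero mbound_mono order_refl)

lemma ev_abs_summable:
  assumes "abs_conv r g" "0 \<le> r" "z \<in> bidisc r"
  shows "(\<lambda>\<mu>. norm (of_real (g \<mu>) * mval z \<mu>)) summable_on UNIV"
proof -
  obtain R where R: "mbound r (\<lambda>\<mu>. \<bar>g \<mu>\<bar>) R" using assms(1) by (auto simp: abs_conv_def)
  have "(\<lambda>\<mu>. norm (r ^ deg \<mu> * \<bar>g \<mu>\<bar>)) summable_on UNIV"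
    using mbound_summable(1)[OF R assms(2)] assms(2) by (simp add: abs_mult)
  then show ?thesis
  proof (rule Infinite_Sum.abs_summable_on_comparison_test)
    fix \<mu>
    have "cmod (mval z \<mu>) * \<bar>g \<mu>\<bar> \<le> r ^ deg \<mu> * \<bar>g \<mu>\<bar>"
      using assms(3) by (intro mult_right_mono cmod_mval_le) auto
    then show "norm (of_real (g \<mu>) * mval z \<mu>) \<le> norm (r ^ deg \<mu> * \<bar>g \<mu>\<bar>)"
      using assms(2) by (simp add: norm_mult abs_mult mult.commute)
  qed
qed

lemma ev_has_sum:
  assumes "abs_conv r g" "0 \<le> r" "z \<in> bidisc r"
  shows "((\<lambda>\<mu>. of_real (g \<mu>) * mval z \<mu>) has_sum ev g z) UNIV"
  unfolding ev_def by (rule has_sum_infsum[OF abs_summable_summable[OF ev_abs_summable[OF assms]]])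

lemma evI: "((\<lambda>\<mu>. of_real (g \<mu>) * mval z \<mu>) has_sum s) UNIV \<Longrightarrow> ev g z = s"
  unfolding ev_def by (rule infsumI)

text \<open>The absolutely summable double family is summed in two ways: iterated, which gives the
  product, and along the fibres of addition, which gives the convolution.\<close>

lemma ev_conv:
  assumes g: "abs_conv r g" and h: "abs_conv r h" and r: "0 \<le> r" and z: "z \<in> bidisc r"
  shows "ev (conv g h) z = ev g z * ev h z"
proof -
  let ?g = "\<lambda>\<mu>. of_real (g \<mu>) * mval z \<mu>" and ?h = "\<lambda>\<mu>. of_real (h \<mu>) * mval z \<mu>"
  let ?f = "\<lambda>p. ?g (fst p) * ?h (snd p)"
  note sg = ev_abs_summable[OF g r z] and sh = ev_abs_summable[OF h r z]
  have "(\<lambda>p. norm (?f p)) summable_on (UNIV \<times> UNIV)"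
  proof (rule Infinite_Sum.abs_summable_on_Sigma_iff[THEN iffD2], intro conjI ballI)
    fix x :: mono
    show "(\<lambda>y. norm (?f (x, y))) summable_on UNIV"
      using summable_on_cmult_right[OF sh, of "norm (?g x)"] by (simp add: norm_mult)
  next
    have "(\<lambda>x. infsum (\<lambda>y. norm (?h y)) UNIV * norm (?g x)) summable_on UNIV"
      using sg by (rule summable_on_cmult_right)
    moreover have "norm (infsum (\<lambda>y. norm (?f (x, y))) UNIV) = infsum (\<lambda>y. norm (?h y)) UNIV * norm (?g x)" for x
    proof -
      have "infsum (\<lambda>y. norm (?f (x, y))) UNIV = infsum (\<lambda>y. norm (?g x) * norm (?h y)) UNIV"
        by (simp add: norm_mult)
      also have "\<dots> = norm (?g x) * infsum (\<lambda>y. norm (?h y)) UNIV"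
        by (rule infsum_cmult_right')
      finally show ?thesis by (simp add: abs_mult infsum_nonneg)
    qed
    ultimately show "(\<lambda>x. norm (infsum (\<lambda>y. norm (?f (x, y))) UNIV)) summable_on UNIV"
      by simp
  qed
  then have s: "?f summable_on UNIV" unfolding UNIV_Times_UNIV by (rule abs_summable_summable)
  have "infsum ?f UNIV = infsum (\<lambda>(x, y). ?g x * ?h y) (UNIV \<times> UNIV)"
    by (simp add: split_def)
  also have "\<dots> = (\<Sum>\<^sub>\<infinity>x. \<Sum>\<^sub>\<infinity>y. ?g x * ?h y)"
    by (subst infsum_Sigma'_banach[symmetric]) (use s in \<open>auto simp: split_def\<close>)
  also have "\<dots> = ev g z * ev h z"
    unfolding infsum_cmult_right' infsum_cmult_left' ev_def ..
  finally have prod: "infsum ?f UNIV = ev g z * ev h z" .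
  have bij: "bij_betw snd (Sigma UNIV splits) (UNIV :: (mono \<times> mono) set)"
    by (rule bij_betwI[of _ _ _ "\<lambda>p. (fst p + snd p, p)"]) (auto simp: splits_def)
  have s': "(\<lambda>x. ?f (snd x)) summable_on (Sigma UNIV splits)"
    using summable_on_reindex_bij_betw[OF bij, of ?f] s by simp
  have "infsum ?f UNIV = infsum (\<lambda>x. ?f (snd x)) (Sigma UNIV splits)"
    using infsum_reindex_bij_betw[OF bij, of ?f] by simp
  also have "\<dots> = (\<Sum>\<^sub>\<infinity>\<mu>. infsum (\<lambda>p. ?f p) (splits \<mu>))"
    using infsum_Sigma_banach[OF s'] by simp
  also have "\<dots> = (\<Sum>\<^sub>\<infinity>\<mu>. of_real (conv g h \<mu>) * mval z \<mu>)"
  proof (rule infsum_cong)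
    fix \<mu>
    have "infsum (\<lambda>p. ?f p) (splits \<mu>) = (\<Sum>p\<in>splits \<mu>. ?f p)" by simp
    also have "\<dots> = (\<Sum>p\<in>splits \<mu>. of_real (g (fst p) * h (snd p)) * mval z \<mu>)"
      by (intro sum.cong) (auto simp: splits_def mval_add mult_ac)
    finally show "infsum (\<lambda>p. ?f p) (splits \<mu>) = of_real (conv g h \<mu>) * mval z \<mu>"
      by (simp add: conv_def sum_distrib_right)
  qed
  finally show ?thesis using prod by (simp add: ev_def)
qed

lemma abs_conv_conv:
  assumes "abs_conv r g" "abs_conv r h" "0 \<le> r"
  shows "abs_conv r (conv g h)"
proof -
  obtain A B where "mbound r (\<lambda>\<mu>. \<bar>g \<mu>\<bar>) A" "mbound r (\<lambda>\<mu>. \<bar>h \<mu>\<bar>) B"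
    using assms by (auto simp: abs_conv_def)
  note b = mbound_conv[OF this assms(3)]
  show ?thesis
  proof (rule abs_convI[OF b _ assms(3)])
    show "\<bar>conv g h \<mu>\<bar> \<le> conv (\<lambda>\<mu>. \<bar>g \<mu>\<bar>) (\<lambda>\<mu>. \<bar>h \<mu>\<bar>) \<mu>" for \<mu>
      unfolding conv_def by (rule order_trans[OF sum_abs]) (simp add: abs_mult)
  qed
qed

lemma abs_conv_add:
  assumes "abs_conv r g" "abs_conv r h" "0 \<le> r"
  shows "abs_conv r (\<lambda>\<mu>. g \<mu> + h \<mu>)"
proof -
  obtain A B where "mbound r (\<lambda>\<mu>. \<bar>g \<mu>\<bar>) A" "mbound r (\<lambda>\<mu>. \<bar>h \<mu>\<bar>) B"
    using assms by (auto simp: abs_conv_def)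
  from mbound_add[OF this] show ?thesis
    by (rule abs_convI) (use assms in \<open>auto intro: abs_triangle_ineq\<close>)
qed

lemma abs_conv_mconj: "abs_conv r g \<Longrightarrow> 0 < r \<Longrightarrow> abs_conv r (\<lambda>\<mu>. g (mconj \<mu>))"
  unfolding abs_conv_def using mbound_mconj by blast

text \<open>The coefficients are real, so conjugating the value only exchanges the exponents of each
  variable and its conjugate.\<close>

lemma ev_mconj:
  assumes "abs_conv r g" "0 \<le> r" "z \<in> bidisc r"
  shows "ev (\<lambda>\<mu>. g (mconj \<mu>)) z = cnj (ev g z)"
proof (rule evI)
  have bij: "bij_betw mconj UNIV UNIV" by (rule bij_betwI[of _ _ _ mconj]) auto
  have "((\<lambda>\<mu>. cnj (of_real (g \<mu>) * mval z \<mu>)) has_sum cnj (ev g z)) UNIV"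
    using ev_has_sum[OF assms] by (simp only: has_sum_cnj_iff)
  then have "((\<lambda>\<mu>. cnj (of_real (g (mconj \<mu>)) * mval z (mconj \<mu>))) has_sum cnj (ev g z)) UNIV"
    using has_sum_reindex_bij_betw[OF bij, of "\<lambda>\<mu>. cnj (of_real (g \<mu>) * mval z \<mu>)"] by simp
  then show "((\<lambda>\<mu>. of_real (g (mconj \<mu>)) * mval z \<mu>) has_sum cnj (ev g z)) UNIV"
    by (simp add: mval_mconj)
qed

lemma ev_add:
  assumes "abs_conv r g" "abs_conv r h" "0 \<le> r" "z \<in> bidisc r"
  shows "ev (\<lambda>\<mu>. g \<mu> + h \<mu>) z = ev g z + ev h z"
  using has_sum_add[OF ev_has_sum[OF assms(1,3,4)] ev_has_sum[OF assms(2,3,4)]]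
  by (intro evI) (simp add: distrib_right)

text \<open>Inclusion-exclusion: the restrictions to the axes see exactly the monomials in one mode,
  and the constant term, subtracted twice, is restored once. This isolates the interaction part of
  the nonlinearity.\<close>

lemma ev_mixed:
  assumes "abs_conv r g" "0 \<le> r" "(z, w) \<in> bidisc r"
  shows "ev (\<lambda>\<mu>. if mixed \<mu> then g \<mu> else 0) (z, w) = ev g (z, w) - ev g (z, 0) - ev g (0, w) + ev g (0, 0)"
proof (rule evI)
  have b: "(z, 0) \<in> bidisc r" "(0, w) \<in> bidisc r" "(0, 0) \<in> bidisc r" using assms by auto
  note s = ev_has_sum[OF assms] ev_has_sum[OF assms(1,2) b(1)] ev_has_sum[OF assms(1,2) b(2)] ev_has_sum[OF assms(1,2) b(3)]
  have "((\<lambda>\<mu>. of_real (g \<mu>) * mval (z, w) \<mu> + - (of_real (g \<mu>) * mval (z, 0) \<mu>)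
      + - (of_real (g \<mu>) * mval (0, w) \<mu>) + of_real (g \<mu>) * mval (0, 0) \<mu>) has_sum
      (ev g (z, w) + - ev g (z, 0) + - ev g (0, w) + ev g (0, 0))) UNIV"
    by (intro has_sum_add s has_sum_uminus[THEN iffD2]) (use s in auto)
  moreover have "of_real (g \<mu>) * mval (z, w) \<mu> + - (of_real (g \<mu>) * mval (z, 0) \<mu>)
      + - (of_real (g \<mu>) * mval (0, w) \<mu>) + of_real (g \<mu>) * mval (0, 0) \<mu>
    = of_real (if mixed \<mu> then g \<mu> else 0) * mval (z, w) \<mu>" for \<mu>
  proof -
    obtain a b c d where \<mu>: "\<mu> = Mono a b c d" by (cases \<mu>)
    consider "a + b = 0" "c + d = 0" | "a + b = 0" "0 < c + d" | "0 < a + b" "c + d = 0" | "0 < a + b" "0 < c + d"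
      by linarith
    then show ?thesis by cases (auto simp: \<mu> power_0_left)
  qed
  ultimately show "((\<lambda>\<mu>. of_real (if mixed \<mu> then g \<mu> else 0) * mval (z, w) \<mu>) has_sum
     (ev g (z, w) - ev g (z, 0) - ev g (0, w) + ev g (0, 0))) UNIV" by simp
qed

subsection \<open>Series with values in the weighted spaces\<close>

definition vconv :: "(mono \<Rightarrow> int \<Rightarrow> real) \<Rightarrow> (mono \<Rightarrow> int \<Rightarrow> real) \<Rightarrow> mono \<Rightarrow> int \<Rightarrow> real" where
  "vconv f g \<mu> n = conv (\<lambda>\<nu>. f \<nu> n) (\<lambda>\<nu>. g \<nu> n) \<mu>"

definition vbound :: "real \<Rightarrow> real \<Rightarrow> (mono \<Rightarrow> int \<Rightarrow> real) \<Rightarrow> real \<Rightarrow> bool" where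
  "vbound r a f R \<longleftrightarrow> (\<forall>\<mu>. f \<mu> \<in> le_space a) \<and> mbound r (\<lambda>\<mu>. le_norm a (f \<mu>)) R"

text \<open>One factor is measured in the supremum over sites, the other in the weighted norm.
  Scalar series such as \<epsilon> are thereby covered as sequences constant in n, which need no
  decay.\<close>

lemma vbound_vconv:
  assumes f: "\<And>\<mu> n. \<bar>f \<mu> n\<bar> \<le> F \<mu>" and F: "mbound r F A" and g: "vbound r a g B" and r: "0 \<le> r"
  shows "vbound r a (vconv f g) (A * B)"
proof -
  have m: "vconv f g \<mu> \<in> le_space a \<and> le_norm a (vconv f g \<mu>) \<le> conv F (\<lambda>\<mu>. le_norm a (g \<mu>)) \<mu>" for \<mu>
  proof -
    have p: "(\<lambda>n. f \<nu> n * g \<kappa> n) \<in> le_space a \<and> le_norm a (\<lambda>n. f \<nu> n * g \<kappa> n) \<le> F \<nu> * le_norm a (g \<kappa>)" for \<nu> \<kappa>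
      using le_space_mult[of "g \<kappa>" a "f \<nu>" "F \<nu>"] f g by (auto simp: vbound_def)
    have e: "vconv f g \<mu> = (\<lambda>n. \<Sum>p\<in>splits \<mu>. f (fst p) n * g (snd p) n)"
      by (auto simp: vconv_def conv_def)
    have "(\<lambda>n. \<Sum>p\<in>splits \<mu>. f (fst p) n * g (snd p) n) \<in> le_space a \<and>
       le_norm a (\<lambda>n. \<Sum>p\<in>splits \<mu>. f (fst p) n * g (snd p) n) \<le> (\<Sum>p\<in>splits \<mu>. le_norm a (\<lambda>n. f (fst p) n * g (snd p) n))"
      by (rule le_space_sum) (use p in auto)
    moreover have "(\<Sum>p\<in>splits \<mu>. le_norm a (\<lambda>n. f (fst p) n * g (snd p) n)) \<le> conv F (\<lambda>\<mu>. le_norm a (g \<mu>)) \<mu>"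
      unfolding conv_def by (intro sum_mono) (use p in auto)
    ultimately show ?thesis unfolding e by auto
  qed
  have "mbound r (conv F (\<lambda>\<mu>. le_norm a (g \<mu>))) (A * B)"
    using g by (intro mbound_conv[OF F _ r]) (simp add: vbound_def)
  then have "mbound r (\<lambda>\<mu>. le_norm a (vconv f g \<mu>)) (A * B)"
    by (rule mbound_mono) (use m r in auto)
  with m show ?thesis by (simp add: vbound_def)
qed

lemma vbound_vconv':
  assumes f: "vbound r a f A" and g: "vbound r a g B" and r: "0 \<le> r" and a: "0 \<le> a"
  shows "vbound r a (vconv f g) (A * B)"
proof (rule vbound_vconv[OF _ _ g r])
  show "\<bar>f \<mu> n\<bar> \<le> le_norm a (f \<mu>)" for \<mu> n
    using norm_le_le_norm'[of "f \<mu>" a n] f a by (auto simp: vbound_def)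
qed (use f in \<open>simp add: vbound_def\<close>)

lemma vbound_add:
  assumes f: "vbound r a f A" and g: "vbound r a g B" and r: "0 \<le> r"
  shows "vbound r a (\<lambda>\<mu> n. f \<mu> n + g \<mu> n) (A + B)"
proof -
  have le: "f \<mu> \<in> le_space a" "g \<mu> \<in> le_space a" for \<mu> using f g by (auto simp: vbound_def)
  have "mbound r (\<lambda>\<mu>. le_norm a (f \<mu>) + le_norm a (g \<mu>)) (A + B)"
    using f g by (intro mbound_add) (auto simp: vbound_def)
  then have "mbound r (\<lambda>\<mu>. le_norm a (\<lambda>n. f \<mu> n + g \<mu> n)) (A + B)"
    by (rule mbound_mono) (simp_all add: r le_space_add(2)[OF le])
  then show ?thesis using le_space_add(1)[OF le] by (simp add: vbound_def)
qed

lemma vbound_uminus: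
  assumes "vbound r a f A"
  shows "vbound r a (\<lambda>\<mu> n. - f \<mu> n) A"
  using assms by (simp add: vbound_def le_space_def le_norm_def)

lemma vbound_dominated:
  assumes f: "mbound r F A" and r: "0 \<le> r" "A \<le> B"
    and g: "\<And>\<mu>. g \<mu> \<in> le_space a" "\<And>\<mu>. le_norm a (g \<mu>) \<le> F \<mu>"
  shows "vbound r a g B"
  using mbound_mono[OF f, of "\<lambda>\<mu>. le_norm a (g \<mu>)" B] g r by (auto simp: vbound_def)

lemma vbound_mconj:
  assumes "vbound r a f A" "0 < r"
  shows "vbound r a (\<lambda>\<mu>. f (mconj \<mu>)) A"
  using assms mbound_mconj[of r "\<lambda>\<mu>. le_norm a (f \<mu>)" A] by (auto simp: vbound_def)

lemma vbound_abs_conv: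
  assumes "vbound r a f A" "0 \<le> a" "0 \<le> r"
  shows "abs_conv r (\<lambda>\<mu>. f \<mu> n)"
proof (rule abs_convI)
  show "mbound r (\<lambda>\<mu>. le_norm a (f \<mu>)) A" using assms by (simp add: vbound_def)
  show "\<bar>f \<mu> n\<bar> \<le> le_norm a (f \<mu>)" for \<mu>
    using norm_le_le_norm'[of "f \<mu>" a n] assms by (auto simp: vbound_def)
qed fact

text \<open>|u|^6 u is the fourth power of u times the cube of its conjugate, hence polynomial in
  the two series; \<open>mconj\<close> produces the conjugate one.\<close>

definition seventh :: "(mono \<Rightarrow> int \<Rightarrow> real) \<Rightarrow> mono \<Rightarrow> int \<Rightarrow> real" where
  "seventh f = (let g = (\<lambda>\<mu>. f (mconj \<mu>)) in
     vconv f (vconv f (vconv f (vconv f (vconv g (vconv g g))))))"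

lemma vbound_seventh:
  assumes "vbound r a f A" "0 < r" "0 \<le> a"
  shows "vbound r a (seventh f) (A ^ 7)"
proof -
  have "vbound r a (seventh f) (A * (A * (A * (A * (A * (A * A))))))"
    unfolding seventh_def Let_def using assms by (intro vbound_vconv' vbound_mconj) auto
  then show ?thesis by (simp add: power_def numeral_eq_Suc)
qed

lemma ev_seventh:
  assumes f: "abs_conv r (\<lambda>\<mu>. f \<mu> n)" and r: "0 < r" and z: "z \<in> bidisc r"
  shows "ev (\<lambda>\<mu>. seventh f \<mu> n) z = of_real (cmod (ev (\<lambda>\<mu>. f \<mu> n) z) ^ 6) * ev (\<lambda>\<mu>. f \<mu> n) z"
proof -
  define u where "u = ev (\<lambda>\<mu>. f \<mu> n) z"
  have e: "(\<lambda>\<mu>. seventh f \<mu> n) = (let c = (\<lambda>\<mu>. f \<mu> n); d = (\<lambda>\<mu>. c (mconj \<mu>)) in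
     conv c (conv c (conv c (conv c (conv d (conv d d))))))"
    by (simp add: seventh_def vconv_def Let_def)
  have r0: "0 \<le> r" using r by simp
  note f' = abs_conv_mconj[OF f r]
  have "ev (\<lambda>\<mu>. seventh f \<mu> n) z = u * (u * (u * (u * (cnj u * (cnj u * cnj u)))))"
    unfolding e Let_def u_def ev_mconj[OF f r0 z, symmetric]
    by (simp only: ev_conv[OF f _ r0 z] ev_conv[OF f' _ r0 z] abs_conv_conv f f' r0)
  also have "\<dots> = (u * cnj u) ^ 3 * u" by (simp add: power3_eq_cube mult_ac)
  also have "u * cnj u = of_real ((cmod u)\<^sup>2)" by (rule complex_norm_square[symmetric])
  also have "\<dots> ^ 3 = of_real (cmod u ^ 6)" by (simp flip: power_mult)
  finally show ?thesis by (simp add: u_def)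
qed

text \<open>Four factors of charge 1 and three of charge -1 leave charge 1, and seven factors of
  positive degree give degree at least 7.\<close>

lemma seventh_support:
  assumes "\<And>\<mu>. f \<mu> n \<noteq> 0 \<Longrightarrow> charge \<mu> = 1 \<and> 0 < deg \<mu>" and "seventh f \<mu> n \<noteq> 0"
  shows "charge \<mu> = 1 \<and> 7 \<le> deg \<mu>"
proof -
  define S where "S c k g \<longleftrightarrow> (\<forall>\<mu>. g \<mu> n \<noteq> 0 \<longrightarrow> charge \<mu> = c \<and> k \<le> deg \<mu>)"
    for c k and g :: "mono \<Rightarrow> int \<Rightarrow> real"
  have mult: "S (c + c') (k + k') (vconv g h)" if "S c k g" "S c' k' h" for c c' k k' g h
    unfolding S_def vconv_def
  proof (intro allI impI)
    fix \<mu> assume "conv (\<lambda>\<nu>. g \<nu> n) (\<lambda>\<nu>. h \<nu> n) \<mu> \<noteq> 0"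
    then obtain \<nu> \<kappa> where "\<mu> = \<nu> + \<kappa>" "g \<nu> n \<noteq> 0" "h \<kappa> n \<noteq> 0" by (rule conv_nonzeroD)
    then show "charge \<mu> = c + c' \<and> k + k' \<le> deg \<mu>" using that unfolding S_def by fastforce
  qed
  have f: "S 1 1 f" using assms(1) by (force simp: S_def)
  have g: "S (-1) 1 (\<lambda>\<mu>. f (mconj \<mu>))" unfolding S_def
  proof (intro allI impI)
    fix \<mu> assume "f (mconj \<mu>) n \<noteq> 0"
    from assms(1)[OF this] show "charge \<mu> = - 1 \<and> 1 \<le> deg \<mu>" by simp
  qed
  have "S (1 + (1 + (1 + (1 + (-1 + (-1 + -1)))))) (1 + (1 + (1 + (1 + (1 + (1 + 1)))))) (seventh f)"
    unfolding seventh_def Let_def by (intro mult f g)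
  with assms(2) show ?thesis by (auto simp: S_def)
qed

text \<open>A discrepancy of degree d in one factor is accompanied by factors of positive degree. A
  gain of one degree is all that is carried through the nested products.\<close>

lemma seventh_agree:
  assumes ag: "\<And>\<mu>. deg \<mu> < d \<Longrightarrow> f \<mu> n = f' \<mu> n" and 0: "\<And>\<mu>. deg \<mu> < 1 \<Longrightarrow> f \<mu> n = 0 \<and> f' \<mu> n = 0"
    and \<mu>: "deg \<mu> < Suc d"
  shows "seventh f \<mu> n = seventh f' \<mu> n"
proof -
  define A where "A d k g g' \<longleftrightarrow> (\<forall>\<mu>. deg \<mu> < d \<longrightarrow> g \<mu> n = g' \<mu> n) \<and> (\<forall>\<mu>. deg \<mu> < k \<longrightarrow> g \<mu> n = 0 \<and> g' \<mu> n = 0)"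
    for d k and g g' :: "mono \<Rightarrow> int \<Rightarrow> real"
  have mult: "A (Suc d) 1 (vconv g h) (vconv g' h')" if g: "A d 1 g g'" and h: "A e 1 h h'" and e: "e \<in> {d, Suc d}" for g g' h h' e
  proof -
    have "conv (\<lambda>\<nu>. g \<nu> n) (\<lambda>\<nu>. h \<nu> n) \<mu> = conv (\<lambda>\<nu>. g' \<nu> n) (\<lambda>\<nu>. h' \<nu> n) \<mu>" if "deg \<mu> < Suc d" for \<mu>
      by (rule conv_agree[where ?d1.0 = d and ?d2.0 = e and ?k1.0 = 1 and ?k2.0 = 1 and d = "Suc d"]) (use g h e that in \<open>auto simp: A_def\<close>)
    moreover have "conv (\<lambda>\<nu>. c \<nu> n) (\<lambda>\<nu>. h \<nu> n) \<mu> = 0"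
      if "deg \<mu> < 1" and c: "\<And>\<nu>. deg \<nu> < 1 \<Longrightarrow> c \<nu> n = 0" for \<mu> and c h :: "mono \<Rightarrow> int \<Rightarrow> real"
    proof (rule ccontr)
      assume "conv (\<lambda>\<nu>. c \<nu> n) (\<lambda>\<nu>. h \<nu> n) \<mu> \<noteq> 0"
      then obtain \<nu> \<kappa> where "\<mu> = \<nu> + \<kappa>" "c \<nu> n \<noteq> 0" by (rule conv_nonzeroD)
      then show False using that(1) c[of \<nu>] by simp
    qed
    ultimately show ?thesis using g unfolding A_def vconv_def by blast
  qed
  have m1: "A (Suc d) 1 (vconv g h) (vconv g' h')" if "A d 1 g g'" "A d 1 h h'" for g g' h h'
    using that by (rule mult) simp
  have m2: "A (Suc d) 1 (vconv g h) (vconv g' h')" if "A d 1 g g'" "A (Suc d) 1 h h'" for g g' h h'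
    using that by (rule mult) simp
  have f: "A d 1 f f'" using ag 0 by (simp add: A_def)
  have g: "A d 1 (\<lambda>\<mu>. f (mconj \<mu>)) (\<lambda>\<mu>. f' (mconj \<mu>))" using ag 0 by (simp add: A_def)
  have "A (Suc d) 1 (seventh f) (seventh f')"
    unfolding seventh_def Let_def by (intro m2[OF f] m2[OF g] m1[OF g g])
  then show ?thesis using \<mu> by (simp add: A_def)
qed


section \<open>Solving for the coefficients\<close>

text \<open>\<open>diag1 t\<close> encodes the power series in |z1|^2 with coefficients
  \<open>t\<close>, and \<open>ray1 q\<close> encodes z1 times such a series. For the corrections of
  the bound states the entry \<open>q 0\<close> is zero, so the slot is free:
  \<open>q(0 := \<phi>)\<close> encodes the whole bound state.\<close>

fun diag1 :: "(nat \<Rightarrow> real) \<Rightarrow> mono \<Rightarrow> real" where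
  "diag1 t (Mono a b c d) = (if a = b \<and> c = 0 \<and> d = 0 then t a else 0)"
fun diag2 :: "(nat \<Rightarrow> real) \<Rightarrow> mono \<Rightarrow> real" where
  "diag2 t (Mono a b c d) = (if a = 0 \<and> b = 0 \<and> c = d then t c else 0)"
fun ray1 :: "(nat \<Rightarrow> int \<Rightarrow> real) \<Rightarrow> mono \<Rightarrow> int \<Rightarrow> real" where
  "ray1 q (Mono a b c d) = (if a = Suc b \<and> c = 0 \<and> d = 0 then q b else (\<lambda>n. 0))"
fun ray2 :: "(nat \<Rightarrow> int \<Rightarrow> real) \<Rightarrow> mono \<Rightarrow> int \<Rightarrow> real" where
  "ray2 q (Mono a b c d) = (if a = 0 \<and> b = 0 \<and> c = Suc d then q d else (\<lambda>n. 0))"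

fun balanced :: "mono \<Rightarrow> bool" where "balanced (Mono a b c d) \<longleftrightarrow> a = b \<and> c = d"
fun inc1 :: "mono \<Rightarrow> mono" where "inc1 (Mono a b c d) = Mono (Suc a) b c d"
fun inc2 :: "mono \<Rightarrow> mono" where "inc2 (Mono a b c d) = Mono a b (Suc c) d"

text \<open>7 is the degree of the nonlinearity. \<open>eadm1\<close> describes what remains of an
  admissible monomial after division by z1 when the quotient is balanced: degree at least 6 and a
  factor |z2|^2; \<open>eadm2\<close> is the analogue for z2. These supports produce the exponents
  in the final estimates.\<close>

definition admissible :: "mono \<Rightarrow> bool" where
  "admissible \<mu> \<longleftrightarrow> charge \<mu> = 1 \<and> mixed \<mu> \<and> 7 \<le> deg \<mu>"
fun eadm1 :: "mono \<Rightarrow> bool" where "eadm1 (Mono a b c d) \<longleftrightarrow> a = b \<and> c = d \<and> 0 < c \<and> 3 \<le> a + c"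
fun eadm2 :: "mono \<Rightarrow> bool" where "eadm2 (Mono a b c d) \<longleftrightarrow> a = b \<and> c = d \<and> 0 < a \<and> 3 \<le> a + c"

lemma deg_inc [simp]: "deg (inc1 \<mu>) = Suc (deg \<mu>)" "deg (inc2 \<mu>) = Suc (deg \<mu>)"
  by (cases \<mu>; simp)+

lemma inj_inc: "inj_on inc1 A" "inj_on inc2 A"
proof -
  show "inj_on inc1 A"
  proof (rule inj_onI)
    show "x = y" if "inc1 x = inc1 y" for x y using that by (cases x; cases y) simp
  qed
  show "inj_on inc2 A"
  proof (rule inj_onI)
    show "x = y" if "inc2 x = inc2 y" for x y using that by (cases x; cases y) simp
  qed
qed

lemma admissible_inc: 
  "balanced \<mu> \<Longrightarrow> admissible (inc1 \<mu>) \<Longrightarrow> eadm1 \<mu>" "balanced \<mu> \<Longrightarrow> admissible (inc2 \<mu>) \<Longrightarrow> eadm2 \<mu>"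
  by (cases \<mu>; auto simp: admissible_def)+

lemma eadm_props:
  "eadm1 \<mu> \<Longrightarrow> balanced \<mu> \<and> charge \<mu> = 0 \<and> 6 \<le> deg \<mu>"
  "eadm2 \<mu> \<Longrightarrow> balanced \<mu> \<and> charge \<mu> = 0 \<and> 6 \<le> deg \<mu>"
  by (cases \<mu>; auto)+

text \<open>The unknowns are \<open>\<psi>\<close> and the frequency corrections \<open>\<epsilon>1\<close>, \<open>\<epsilon>2\<close>. Since a monomial of charge 1
  and harmonic index \<open>m\<close> evolves with frequency \<open>(1 - m) E1 + m E2\<close>, the equation for its coefficient
  \<open>\<psi>\<^sub>\<mu>\<close> is \<open>(H - freq m) \<psi>\<^sub>\<mu> = rhs \<mu>\<close>, up to a multiple of the eigenfunction if \<open>m\<close> is 0 or 1; that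
  multiple is the new coefficient of \<open>\<epsilon>1\<close> or \<open>\<epsilon>2\<close>.\<close>

type_synonym unknowns = "(mono \<Rightarrow> int \<Rightarrow> real) \<times> (mono \<Rightarrow> real) \<times> (mono \<Rightarrow> real)"

text \<open>A finite set of monomials has bounded degree, so its sum is already that of a single
  approximant.\<close>

lemma mbound_degreewise:
  assumes H: "\<And>k. mbound r (H k) R" and eq: "\<And>\<mu> k. deg \<mu> < k \<Longrightarrow> G \<mu> = H k \<mu>"
  shows "mbound r G R"
  unfolding mbound_def
proof (intro conjI allI impI)
  show "0 \<le> G \<mu>" for \<mu> using eq[of \<mu> "Suc (deg \<mu>)"] mboundD(1)[OF H] by simp
  fix S :: "mono set" assume S: "finite S"
  then obtain k where k: "\<forall>\<mu>\<in>S. deg \<mu> < k"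
    using finite_imageI[OF S, of deg] unfolding finite_nat_set_iff_bounded by auto
  have "(\<Sum>\<mu>\<in>S. r ^ deg \<mu> * G \<mu>) = (\<Sum>\<mu>\<in>S. r ^ deg \<mu> * H k \<mu>)"
    using k eq by (intro sum.cong) auto
  also have "\<dots> \<le> R" using H S by (rule mboundD(2))
  finally show "(\<Sum>\<mu>\<in>S. r ^ deg \<mu> * G \<mu>) \<le> R" .
qed

text \<open>K bounds the resolvents and B the data, with powers of r recording orders: bound states
  r, their corrections r^2, energy shifts r. By \<open>small\<close>, the bound of order r^3 for the
  right-hand side becomes r^2 after the resolvents are applied.\<close>

locale two_mode =
  fixes V :: "int \<Rightarrow> real" and e1 e2 a K B r :: real and \<phi>1 \<phi>2 :: "int \<Rightarrow> real"
    and t1 t2 :: "nat \<Rightarrow> real" and q1 q2 :: "nat \<Rightarrow> int \<Rightarrow> real"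
  assumes a: "0 < a" and r: "0 < r" "r \<le> 1" and K: "0 \<le> K" and B: "0 \<le> B"
    and solvable: "\<And>m::int. harmonic_solvable V a K (e1 + of_int m * (e2 - e1))
       (if m = 0 then \<phi>1 else if m = 1 then \<phi>2 else (\<lambda>n. 0)) (1 + \<bar>of_int m\<bar>)"
    and zero: "t1 0 = 0" "t2 0 = 0" "q1 0 = (\<lambda>n. 0)" "q2 0 = (\<lambda>n. 0)"
    and ray_bd: "vbound r a (ray1 (q1(0 := \<phi>1))) (B * r)" "vbound r a (ray2 (q2(0 := \<phi>2))) (B * r)"
      "vbound r a (ray1 q1) (B * r\<^sup>2)" "vbound r a (ray2 q2) (B * r\<^sup>2)"
    and diag_bd: "mbound r (\<lambda>\<mu>. \<bar>diag1 t1 \<mu>\<bar>) (B * r)" "mbound r (\<lambda>\<mu>. \<bar>diag2 t2 \<mu>\<bar>) (B * r)"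
    and small: "K * (4 * B + 2 + (2 * B + 1) ^ 7) * r \<le> 1"
begin

abbreviation "mode m \<equiv> (if m = 0 then \<phi>1 else if m = 1 then \<phi>2 else (\<lambda>n. 0))"
abbreviation "freq m \<equiv> e1 + of_int m * (e2 - e1)"

definition profile :: "(mono \<Rightarrow> int \<Rightarrow> real) \<Rightarrow> mono \<Rightarrow> int \<Rightarrow> real" where
  "profile \<psi> = (\<lambda>\<mu> n. ray1 (q1(0 := \<phi>1)) \<mu> n + ray2 (q2(0 := \<phi>2)) \<mu> n + \<psi> \<mu> n)"

text \<open>What is left of the coefficient equation once the linear part at zero amplitude and the
  bound state equations are removed: \<epsilon> times the corrections q, the frequency shifts times
  \<psi> with the factors \<open>1 - m\<close> and \<open>m\<close> of the time derivative, and the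
  interaction part of the nonlinearity. The products of \<epsilon> with the eigenfunctions are
  absent because they are the solvability corrections.\<close>

fun rhs :: "unknowns \<Rightarrow> mono \<Rightarrow> int \<Rightarrow> real" where
  "rhs (\<psi>, \<epsilon>1, \<epsilon>2) = (\<lambda>\<mu> n.
     vconv (\<lambda>\<nu> n. \<epsilon>1 \<nu>) (ray1 q1) \<mu> n + vconv (\<lambda>\<nu> n. \<epsilon>2 \<nu>) (ray2 q2) \<mu> n +
     vconv (\<lambda>\<nu> n. diag1 t1 \<nu> + \<epsilon>1 \<nu>) (\<lambda>\<nu> n. (1 - of_int (hindex \<nu>)) * \<psi> \<nu> n) \<mu> n +
     vconv (\<lambda>\<nu> n. diag2 t2 \<nu> + \<epsilon>2 \<nu>) (\<lambda>\<nu> n. of_int (hindex \<nu>) * \<psi> \<nu> n) \<mu> n +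
     (if mixed \<mu> then - seventh (profile \<psi>) \<mu> n else 0))"

text \<open>The choice need not be linear: the iteration uses only the equation and the bound.\<close>

definition res :: "int \<Rightarrow> (int \<Rightarrow> real) \<Rightarrow> (int \<Rightarrow> real) \<times> real" where
  "res m f = (SOME p. fst p \<in> le_space a \<and>
     (\<forall>n. schroedinger V (fst p) n - freq m * fst p n = f n + snd p * mode m n) \<and>
     (1 + \<bar>of_int m\<bar>) * le_norm a (fst p) \<le> K * le_norm a f \<and> \<bar>snd p\<bar> \<le> K * le_norm a f)"

lemma res:
  assumes "f \<in> le_space a"
  shows "fst (res m f) \<in> le_space a"
    "schroedinger V (fst (res m f)) n - freq m * fst (res m f) n = f n + snd (res m f) * mode m n"
    "(1 + \<bar>of_int m\<bar>) * le_norm a (fst (res m f)) \<le> K * le_norm a f" "\<bar>snd (res m f)\<bar> \<le> K * le_norm a f"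
proof -
  obtain u k where "u \<in> le_space a" "\<forall>n. schroedinger V u n - freq m * u n = f n + k * mode m n"
    "(1 + \<bar>of_int m\<bar>) * le_norm a u \<le> K * le_norm a f" "\<bar>k\<bar> \<le> K * le_norm a f"
    using solvable[of m] assms unfolding harmonic_solvable_def by blast
  then have "\<exists>p. fst p \<in> le_space a \<and>
     (\<forall>n. schroedinger V (fst p) n - freq m * fst p n = f n + snd p * mode m n) \<and>
     (1 + \<bar>of_int m\<bar>) * le_norm a (fst p) \<le> K * le_norm a f \<and> \<bar>snd p\<bar> \<le> K * le_norm a f"
    by (intro exI[of _ "(u, k)"]) simp
  from someI_ex[OF this] show "fst (res m f) \<in> le_space a"
    "schroedinger V (fst (res m f)) n - freq m * fst (res m f) n = f n + snd (res m f) * mode m n"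
    "(1 + \<bar>of_int m\<bar>) * le_norm a (fst (res m f)) \<le> K * le_norm a f" "\<bar>snd (res m f)\<bar> \<le> K * le_norm a f"
    by (simp_all only: res_def)
qed

text \<open>The bound forces the chosen solution to vanish together with f. Hence
  \<open>step\<close> creates no monomials outside the support of the right-hand side.\<close>

lemma res_zero: "fst (res m (\<lambda>n. 0)) = (\<lambda>n. 0)" "snd (res m (\<lambda>n. 0)) = 0"
proof -
  have z: "(\<lambda>n. 0) \<in> le_space a" by simp
  have "(1 + \<bar>of_int m\<bar>) * le_norm a (fst (res m (\<lambda>n. 0))) \<le> 0" using res(3)[OF z, of m] by simp
  moreover have "le_norm a (fst (res m (\<lambda>n. 0))) \<le> (1 + \<bar>of_int m\<bar>) * le_norm a (fst (res m (\<lambda>n. 0)))"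
    using mult_right_mono[of 1 "1 + \<bar>of_int m\<bar>" "le_norm a (fst (res m (\<lambda>n. 0)))"] by simp
  ultimately have "le_norm a (fst (res m (\<lambda>n. 0))) \<le> 0" by linarith
  then show "fst (res m (\<lambda>n. 0)) = (\<lambda>n. 0)" using le_norm_eq_0D[OF res(1)[OF z]] by blast
  show "snd (res m (\<lambda>n. 0)) = 0" using res(4)[OF z, of m] by simp
qed

text \<open>\<epsilon>1 multiplies z1 in the equation, so its coefficient at a balanced monomial is
  read off at z1 times that monomial, where \<open>hindex\<close> is 0; for \<epsilon>2 it is z2,
  and \<open>hindex\<close> is 1.\<close>

fun step :: "unknowns \<Rightarrow> unknowns" where
  "step X = (\<lambda>\<mu>. fst (res (hindex \<mu>) (rhs X \<mu>)),
     \<lambda>\<mu>. if balanced \<mu> then snd (res 0 (rhs X (inc1 \<mu>))) else 0,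
     \<lambda>\<mu>. if balanced \<mu> then snd (res 1 (rhs X (inc2 \<mu>))) else 0)"

text \<open>The weight \<open>1 + \<bar>m\<bar>\<close> is what the resolvents gain and what the
  factors \<open>1 - m\<close> and \<open>m\<close> in \<open>rhs\<close> consume. The radius is r^2
  for \<psi> but r for \<epsilon>, because \<epsilon> is one degree lower.\<close>

fun invar :: "unknowns \<Rightarrow> bool" where
  "invar (\<psi>, \<epsilon>1, \<epsilon>2) \<longleftrightarrow> (\<forall>\<mu>. \<psi> \<mu> \<in> le_space a) \<and>
     mbound r (\<lambda>\<mu>. (1 + \<bar>of_int (hindex \<mu>)\<bar>) * le_norm a (\<psi> \<mu>)) (r\<^sup>2) \<and>
     mbound r (\<lambda>\<mu>. \<bar>\<epsilon>1 \<mu>\<bar>) r \<and> mbound r (\<lambda>\<mu>. \<bar>\<epsilon>2 \<mu>\<bar>) r \<and>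
     (\<forall>\<mu> n. \<psi> \<mu> n \<noteq> 0 \<longrightarrow> admissible \<mu>) \<and> (\<forall>\<mu>. \<epsilon>1 \<mu> \<noteq> 0 \<longrightarrow> eadm1 \<mu>) \<and> (\<forall>\<mu>. \<epsilon>2 \<mu> \<noteq> 0 \<longrightarrow> eadm2 \<mu>)"

section \<open>Support and size of the right-hand side\<close>

lemma profile_support:
  assumes "invar (\<psi>, \<epsilon>1, \<epsilon>2)" "profile \<psi> \<mu> n \<noteq> 0"
  shows "charge \<mu> = 1 \<and> 0 < deg \<mu>"
proof -
  have "ray1 (q1(0 := \<phi>1)) \<mu> n \<noteq> 0 \<or> ray2 (q2(0 := \<phi>2)) \<mu> n \<noteq> 0 \<or> \<psi> \<mu> n \<noteq> 0"
    using assms(2) by (auto simp: profile_def)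
  then show ?thesis using assms(1)
    by (cases \<mu>) (auto simp: admissible_def split: if_splits)
qed

text \<open>Charge 0 times charge 1 gives charge 1. For \<epsilon>1 times the z1-ray, mixedness
  comes from the factor |z2|^2 of \<epsilon>1 and degree 7 from 6 + 1; products with \<psi> inherit
  both properties from \<psi>; in the nonlinearity the single-mode part is cut off.\<close>

lemma rhs_support:
  assumes X: "invar (\<psi>, \<epsilon>1, \<epsilon>2)" and nz: "rhs (\<psi>, \<epsilon>1, \<epsilon>2) \<mu> n \<noteq> 0"
  shows "admissible \<mu>"
proof -
  have \<psi>: "admissible \<nu>" if "\<psi> \<nu> n \<noteq> 0" for \<nu> using X that by auto
  have \<epsilon>: "\<epsilon>1 \<nu> \<noteq> 0 \<Longrightarrow> eadm1 \<nu>" "\<epsilon>2 \<nu> \<noteq> 0 \<Longrightarrow> eadm2 \<nu>" for \<nu> using X by auto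
  have d1: "charge \<nu> = 0" if "diag1 t1 \<nu> + \<epsilon>1 \<nu> \<noteq> 0" for \<nu>
  proof (cases "\<epsilon>1 \<nu> = 0")
    case True
    then show ?thesis using that by (cases \<nu>) (auto split: if_splits)
  qed (use \<epsilon>(1) eadm_props(1) in blast)
  have d2: "charge \<nu> = 0" if "diag2 t2 \<nu> + \<epsilon>2 \<nu> \<noteq> 0" for \<nu>
  proof (cases "\<epsilon>2 \<nu> = 0")
    case True
    then show ?thesis using that by (cases \<nu>) (auto split: if_splits)
  qed (use \<epsilon>(2) eadm_props(2) in blast)
  have "conv \<epsilon>1 (\<lambda>\<nu>. ray1 q1 \<nu> n) \<mu> \<noteq> 0 \<or> conv \<epsilon>2 (\<lambda>\<nu>. ray2 q2 \<nu> n) \<mu> \<noteq> 0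
    \<or> conv (\<lambda>\<nu>. diag1 t1 \<nu> + \<epsilon>1 \<nu>) (\<lambda>\<nu>. (1 - of_int (hindex \<nu>)) * \<psi> \<nu> n) \<mu> \<noteq> 0
    \<or> conv (\<lambda>\<nu>. diag2 t2 \<nu> + \<epsilon>2 \<nu>) (\<lambda>\<nu>. of_int (hindex \<nu>) * \<psi> \<nu> n) \<mu> \<noteq> 0
    \<or> mixed \<mu> \<and> seventh (profile \<psi>) \<mu> n \<noteq> 0"
    using nz by (auto simp: vconv_def split: if_splits)
  then consider
    (1) "conv \<epsilon>1 (\<lambda>\<nu>. ray1 q1 \<nu> n) \<mu> \<noteq> 0" | (2) "conv \<epsilon>2 (\<lambda>\<nu>. ray2 q2 \<nu> n) \<mu> \<noteq> 0"
    | (3) "conv (\<lambda>\<nu>. diag1 t1 \<nu> + \<epsilon>1 \<nu>) (\<lambda>\<nu>. (1 - of_int (hindex \<nu>)) * \<psi> \<nu> n) \<mu> \<noteq> 0"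
    | (4) "conv (\<lambda>\<nu>. diag2 t2 \<nu> + \<epsilon>2 \<nu>) (\<lambda>\<nu>. of_int (hindex \<nu>) * \<psi> \<nu> n) \<mu> \<noteq> 0"
    | (5) "mixed \<mu>" "seventh (profile \<psi>) \<mu> n \<noteq> 0"
    by blast
  then show ?thesis
  proof cases
    case 1
    then obtain \<nu> \<kappa> where nk: "\<mu> = \<nu> + \<kappa>" "\<epsilon>1 \<nu> \<noteq> 0" "ray1 q1 \<kappa> n \<noteq> 0" by (rule conv_nonzeroD)
    show ?thesis using \<epsilon>(1)[OF nk(2)] nk(1,3)
      by (cases \<nu>; cases \<kappa>) (auto simp: admissible_def split: if_splits)
  next
    case 2
    then obtain \<nu> \<kappa> where nk: "\<mu> = \<nu> + \<kappa>" "\<epsilon>2 \<nu> \<noteq> 0" "ray2 q2 \<kappa> n \<noteq> 0" by (rule conv_nonzeroD)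
    show ?thesis using \<epsilon>(2)[OF nk(2)] nk(1,3)
      by (cases \<nu>; cases \<kappa>) (auto simp: admissible_def split: if_splits)
  next
    case 3
    then obtain \<nu> \<kappa> where nk: "\<mu> = \<nu> + \<kappa>" "diag1 t1 \<nu> + \<epsilon>1 \<nu> \<noteq> 0" "\<psi> \<kappa> n \<noteq> 0"
      by (rule conv_nonzeroD) auto
    show ?thesis using d1[OF nk(2)] \<psi>[OF nk(3)] by (auto simp: nk(1) admissible_def mixed_add)
  next
    case 4
    then obtain \<nu> \<kappa> where nk: "\<mu> = \<nu> + \<kappa>" "diag2 t2 \<nu> + \<epsilon>2 \<nu> \<noteq> 0" "\<psi> \<kappa> n \<noteq> 0"
      by (rule conv_nonzeroD) auto
    show ?thesis using d2[OF nk(2)] \<psi>[OF nk(3)] by (auto simp: nk(1) admissible_def mixed_add)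
  next
    case 5
    then show ?thesis using seventh_support[of "profile \<psi>" n \<mu>] profile_support[OF X] by (auto simp: admissible_def)
  qed
qed

lemma inv_psi_bound:
  assumes "invar (\<psi>, \<epsilon>1, \<epsilon>2)"
  shows "vbound r a \<psi> (r\<^sup>2)" "vbound r a (\<lambda>\<nu> n. (1 - of_int (hindex \<nu>)) * \<psi> \<nu> n) (r\<^sup>2)"
    "vbound r a (\<lambda>\<nu> n. of_int (hindex \<nu>) * \<psi> \<nu> n) (r\<^sup>2)"
proof -
  have m: "mbound r (\<lambda>\<mu>. (1 + \<bar>of_int (hindex \<mu>)\<bar>) * le_norm a (\<psi> \<mu>)) (r\<^sup>2)" and s: "\<And>\<mu>. \<psi> \<mu> \<in> le_space a"
    using assms by auto
  have gen: "vbound r a (\<lambda>\<nu> n. c \<nu> * \<psi> \<nu> n) (r\<^sup>2)" if "\<And>\<nu>. \<bar>c \<nu>\<bar> \<le> 1 + \<bar>of_int (hindex \<nu>)\<bar>" for c :: "mono \<Rightarrow> real"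
  proof (rule vbound_dominated[OF m])
    fix \<nu>
    show "(\<lambda>n. c \<nu> * \<psi> \<nu> n) \<in> le_space a"
      "le_norm a (\<lambda>n. c \<nu> * \<psi> \<nu> n) \<le> (1 + \<bar>of_int (hindex \<nu>)\<bar>) * le_norm a (\<psi> \<nu>)"
      using le_space_mult[OF s, of "\<lambda>_. c \<nu>" "1 + \<bar>of_int (hindex \<nu>)\<bar>" \<nu>] that[of \<nu>] by auto
  qed (use r in auto)
  from gen[of "\<lambda>_. 1"] show "vbound r a \<psi> (r\<^sup>2)" by simp
  show "vbound r a (\<lambda>\<nu> n. (1 - of_int (hindex \<nu>)) * \<psi> \<nu> n) (r\<^sup>2)"
    by (rule gen) linarith
  show "vbound r a (\<lambda>\<nu> n. of_int (hindex \<nu>) * \<psi> \<nu> n) (r\<^sup>2)"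
    by (rule gen) linarith
qed

lemma profile_bound:
  assumes "invar (\<psi>, \<epsilon>1, \<epsilon>2)"
  shows "vbound r a (profile \<psi>) ((2 * B + 1) * r)"
proof -
  have "vbound r a (profile \<psi>) (B * r + B * r + r\<^sup>2)"
    unfolding profile_def by (intro vbound_add ray_bd inv_psi_bound[OF assms]) (use r in auto)
  moreover have "B * r + B * r + r\<^sup>2 \<le> (2 * B + 1) * r"
    using r by (simp add: algebra_simps power2_eq_square)
  ultimately show ?thesis
    unfolding vbound_def using r by (auto intro: mbound_mono)
qed

text \<open>Each product is of order r times r^2, and r^7 is at most r^3. The terms with q
  contribute 2 B to the constant, those with \<psi> contribute 2 B + 2, and the nonlinearity
  contributes the seventh power of the profile constant 2 B + 1.\<close>

lemma rhs_bound:
  assumes X: "invar (\<psi>, \<epsilon>1, \<epsilon>2)"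
  shows "vbound r a (rhs (\<psi>, \<epsilon>1, \<epsilon>2)) ((4 * B + 2 + (2 * B + 1) ^ 7) * r ^ 3)"
proof -
  have r0: "0 \<le> r" using r by simp
  have \<epsilon>: "mbound r (\<lambda>\<mu>. \<bar>\<epsilon>1 \<mu>\<bar>) r" "mbound r (\<lambda>\<mu>. \<bar>\<epsilon>2 \<mu>\<bar>) r" using X by auto
  have 1: "vbound r a (vconv (\<lambda>\<nu> n. \<epsilon>1 \<nu>) (ray1 q1)) (r * (B * r\<^sup>2))"
    by (rule vbound_vconv[OF _ \<epsilon>(1) ray_bd(3) r0]) simp
  have 2: "vbound r a (vconv (\<lambda>\<nu> n. \<epsilon>2 \<nu>) (ray2 q2)) (r * (B * r\<^sup>2))"
    by (rule vbound_vconv[OF _ \<epsilon>(2) ray_bd(4) r0]) simp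
  have 3: "vbound r a (vconv (\<lambda>\<nu> n. diag1 t1 \<nu> + \<epsilon>1 \<nu>) (\<lambda>\<nu> n. (1 - of_int (hindex \<nu>)) * \<psi> \<nu> n)) ((B * r + r) * r\<^sup>2)"
    by (rule vbound_vconv[OF _ mbound_add[OF diag_bd(1) \<epsilon>(1)] inv_psi_bound(2)[OF X] r0]) (rule abs_triangle_ineq)
  have 4: "vbound r a (vconv (\<lambda>\<nu> n. diag2 t2 \<nu> + \<epsilon>2 \<nu>) (\<lambda>\<nu> n. of_int (hindex \<nu>) * \<psi> \<nu> n)) ((B * r + r) * r\<^sup>2)"
    by (rule vbound_vconv[OF _ mbound_add[OF diag_bd(2) \<epsilon>(2)] inv_psi_bound(3)[OF X] r0]) (rule abs_triangle_ineq)
  have s: "vbound r a (\<lambda>\<mu> n. - seventh (profile \<psi>) \<mu> n) (((2 * B + 1) * r) ^ 7)"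
    using a by (intro vbound_uminus vbound_seventh[OF profile_bound[OF X] r(1)]) simp
  have 5: "vbound r a (\<lambda>\<mu> n. if mixed \<mu> then - seventh (profile \<psi>) \<mu> n else 0) (((2 * B + 1) * r) ^ 7)"
  proof (rule vbound_dominated[where F = "\<lambda>\<mu>. le_norm a (\<lambda>n. - seventh (profile \<psi>) \<mu> n)", OF _ r0 order_refl])
    fix \<mu>
    show "(\<lambda>n. if mixed \<mu> then - seventh (profile \<psi>) \<mu> n else 0) \<in> le_space a"
      "le_norm a (\<lambda>n. if mixed \<mu> then - seventh (profile \<psi>) \<mu> n else 0) \<le> le_norm a (\<lambda>n. - seventh (profile \<psi>) \<mu> n)"
      using s by (cases "mixed \<mu>"; simp add: vbound_def)+
  qed (use s in \<open>simp add: vbound_def\<close>)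
  have b: "vbound r a (rhs (\<psi>, \<epsilon>1, \<epsilon>2)) (r * (B * r\<^sup>2) + r * (B * r\<^sup>2) + (B * r + r) * r\<^sup>2 + (B * r + r) * r\<^sup>2 + ((2 * B + 1) * r) ^ 7)"
    unfolding rhs.simps by (intro vbound_add 1 2 3 4 5 r0)
  have "r ^ 7 \<le> r ^ 3" using r by (intro power_decreasing) auto
  then have "((2 * B + 1) * r) ^ 7 \<le> (2 * B + 1) ^ 7 * r ^ 3"
    using B unfolding power_mult_distrib by (intro mult_left_mono) auto
  then have "r * (B * r\<^sup>2) + r * (B * r\<^sup>2) + (B * r + r) * r\<^sup>2 + (B * r + r) * r\<^sup>2 + ((2 * B + 1) * r) ^ 7
      \<le> (4 * B + 2 + (2 * B + 1) ^ 7) * r ^ 3"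
    by (simp add: algebra_simps power3_eq_cube power2_eq_square)
  with b show ?thesis unfolding vbound_def using r0 by (auto intro: mbound_mono)
qed

text \<open>By \<open>small\<close> the resolvents return a bound by r^2; the passage from z1 or z2
  times \<epsilon> to \<epsilon> divides it by r and leaves r.\<close>

lemma inv_step:
  assumes X: "invar X"
  shows "invar (step X)"
proof -
  obtain \<psi> \<epsilon>1 \<epsilon>2 where Xe: "X = (\<psi>, \<epsilon>1, \<epsilon>2)" by (cases X)
  define M where "M = 4 * B + 2 + (2 * B + 1) ^ 7"
  note b = rhs_bound[OF X[unfolded Xe], folded Xe M_def]
  have f: "rhs X \<mu> \<in> le_space a" for \<mu> using b by (simp add: vbound_def)
  have m: "mbound r (\<lambda>\<mu>. K * le_norm a (rhs X \<mu>)) (K * (M * r ^ 3))"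
    using b K by (intro mbound_cmult) (auto simp: vbound_def)
  have sm: "K * (M * r ^ 3) \<le> r\<^sup>2"
  proof -
    have "(K * M * r) * r\<^sup>2 \<le> 1 * r\<^sup>2" using small by (intro mult_right_mono) (auto simp: M_def)
    then show ?thesis by (simp add: power3_eq_cube power2_eq_square mult_ac)
  qed
  have z: "rhs X \<mu> = (\<lambda>n. 0)" if "\<not> admissible \<mu>" for \<mu>
    using rhs_support[OF X[unfolded Xe], folded Xe] that by blast
  have 1: "mbound r (\<lambda>\<mu>. (1 + \<bar>of_int (hindex \<mu>)\<bar>) * le_norm a (fst (res (hindex \<mu>) (rhs X \<mu>)))) (r\<^sup>2)"
    by (rule mbound_mono[OF m _ _ sm]) (use r res(3)[OF f] in auto)
  have mE: "mbound r (\<lambda>\<mu>. if balanced \<mu> then K * le_norm a (rhs X (h \<mu>)) else 0) r"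
    if "inj_on h {\<mu>. balanced \<mu>}" "\<And>\<mu>. deg (h \<mu>) = Suc (deg \<mu>)" for h
  proof -
    have m1: "mbound r (\<lambda>\<mu>. if balanced \<mu> then K * le_norm a (rhs X (h \<mu>)) else 0) (K * (M * r ^ 3) / r ^ 1)"
      using that by (intro mbound_reindex[OF m r(1)]) auto
    have le: "K * (M * r ^ 3) / r ^ 1 \<le> r" using sm r by (simp add: pos_divide_le_eq power2_eq_square)
    show ?thesis by (rule mbound_mono[OF m1 mboundD(1)[OF m1] order_refl le]) (use r in simp)
  qed
  have 2: "mbound r (\<lambda>\<mu>. \<bar>if balanced \<mu> then snd (res 0 (rhs X (inc1 \<mu>))) else 0\<bar>) r"
    by (rule mbound_mono[OF mE[of inc1]]) (use r inj_inc res(4)[OF f] in auto)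
  have 3: "mbound r (\<lambda>\<mu>. \<bar>if balanced \<mu> then snd (res 1 (rhs X (inc2 \<mu>))) else 0\<bar>) r"
    by (rule mbound_mono[OF mE[of inc2]]) (use r inj_inc res(4)[OF f] in auto)
  have 4: "admissible \<mu>" if "fst (res (hindex \<mu>) (rhs X \<mu>)) n \<noteq> 0" for \<mu> n
    using that z[of \<mu>] res_zero(1)[of "hindex \<mu>"] by (cases "admissible \<mu>") auto
  have 5: "eadm1 \<mu>" if "(if balanced \<mu> then snd (res 0 (rhs X (inc1 \<mu>))) else 0) \<noteq> 0" for \<mu>
    using that z[of "inc1 \<mu>"] res_zero(2)[of 0] admissible_inc(1)[of \<mu>]
    by (cases "admissible (inc1 \<mu>)") (auto split: if_splits)
  have 6: "eadm2 \<mu>" if "(if balanced \<mu> then snd (res 1 (rhs X (inc2 \<mu>))) else 0) \<noteq> 0" for \<mu>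
    using that z[of "inc2 \<mu>"] res_zero(2)[of 1] admissible_inc(2)[of \<mu>]
    by (cases "admissible (inc2 \<mu>)") (auto split: if_splits)
  show ?thesis
    unfolding step.simps invar.simps using 1 2 3 4 5 6 res(1)[OF f] by blast
qed

text \<open>The offset between \<psi> and \<epsilon> is forced by \<open>step\<close>: a coefficient
  of \<epsilon> in degree d is computed from the right-hand side in degree d + 1.\<close>

definition agree :: "nat \<Rightarrow> unknowns \<Rightarrow> unknowns \<Rightarrow> bool" where
  "agree d X Y \<longleftrightarrow> (\<forall>\<mu>. deg \<mu> < Suc d \<longrightarrow> fst X \<mu> = fst Y \<mu>) \<and>
     (\<forall>\<mu>. deg \<mu> < d \<longrightarrow> fst (snd X) \<mu> = fst (snd Y) \<mu> \<and> snd (snd X) \<mu> = snd (snd Y) \<mu>)"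

lemma inv_low:
  assumes "invar (\<psi>, \<epsilon>1, \<epsilon>2)"
  shows "deg \<mu> < 7 \<Longrightarrow> \<psi> \<mu> n = 0" "deg \<mu> < 6 \<Longrightarrow> \<epsilon>1 \<mu> = 0" "deg \<mu> < 6 \<Longrightarrow> \<epsilon>2 \<mu> = 0"
proof -
  show "\<psi> \<mu> n = 0" if "deg \<mu> < 7" using assms that unfolding invar.simps admissible_def by fastforce
  show "\<epsilon>1 \<mu> = 0" if "deg \<mu> < 6" using assms that eadm_props(1)[of \<mu>] unfolding invar.simps by fastforce
  show "\<epsilon>2 \<mu> = 0" if "deg \<mu> < 6" using assms that eadm_props(2)[of \<mu>] unfolding invar.simps by fastforce
qed

text \<open>\<epsilon> agrees below degree d and is multiplied by series of order at least 2; \<psi>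
  agrees below d + 1 and is multiplied by series of order at least 1. Both give agreement below d +
  2. For the given data these orders come from the vanishing of q and t at index 0.\<close>

lemma rhs_agree:
  assumes X: "invar X" and Y: "invar Y" and ag: "agree d X Y" and \<mu>: "deg \<mu> < Suc (Suc d)"
  shows "rhs X \<mu> = rhs Y \<mu>"
proof
  fix n
  obtain \<psi> \<epsilon>1 \<epsilon>2 where Xe: "X = (\<psi>, \<epsilon>1, \<epsilon>2)" by (cases X)
  obtain \<psi>' \<epsilon>1' \<epsilon>2' where Ye: "Y = (\<psi>', \<epsilon>1', \<epsilon>2')" by (cases Y)
  note lX = inv_low[OF X[unfolded Xe]] and lY = inv_low[OF Y[unfolded Ye]]
  have ps: "\<psi> \<nu> = \<psi>' \<nu>" if "deg \<nu> < Suc d" for \<nu> using ag that by (simp add: agree_def Xe Ye)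
  have es: "\<epsilon>1 \<nu> = \<epsilon>1' \<nu>" "\<epsilon>2 \<nu> = \<epsilon>2' \<nu>" if "deg \<nu> < d" for \<nu> using ag that by (simp_all add: agree_def Xe Ye)
  have low: "ray1 q1 \<nu> n = 0" "ray2 q2 \<nu> n = 0" if "deg \<nu> < 2" for \<nu>
    using that zero by (cases \<nu>; auto)+
  have dlow: "diag1 t1 \<nu> = 0" "diag2 t2 \<nu> = 0" if "deg \<nu> < 1" for \<nu>
    using that zero by (cases \<nu>; auto)+
  have c1: "conv \<epsilon>1 (\<lambda>\<nu>. ray1 q1 \<nu> n) \<mu> = conv \<epsilon>1' (\<lambda>\<nu>. ray1 q1 \<nu> n) \<mu>"
    by (rule conv_agree[where ?d1.0 = d and ?d2.0 = "Suc (Suc d)" and ?k1.0 = 1 and ?k2.0 = 2, OF _ _ _ _ _ _ \<mu>])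
      (use es low lX lY in auto)
  have c2: "conv \<epsilon>2 (\<lambda>\<nu>. ray2 q2 \<nu> n) \<mu> = conv \<epsilon>2' (\<lambda>\<nu>. ray2 q2 \<nu> n) \<mu>"
    by (rule conv_agree[where ?d1.0 = d and ?d2.0 = "Suc (Suc d)" and ?k1.0 = 1 and ?k2.0 = 2, OF _ _ _ _ _ _ \<mu>])
      (use es low lX lY in auto)
  have c3: "conv (\<lambda>\<nu>. diag1 t1 \<nu> + \<epsilon>1 \<nu>) (\<lambda>\<nu>. (1 - of_int (hindex \<nu>)) * \<psi> \<nu> n) \<mu>
      = conv (\<lambda>\<nu>. diag1 t1 \<nu> + \<epsilon>1' \<nu>) (\<lambda>\<nu>. (1 - of_int (hindex \<nu>)) * \<psi>' \<nu> n) \<mu>"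
    by (rule conv_agree[where ?d1.0 = d and ?d2.0 = "Suc d" and ?k1.0 = 1 and ?k2.0 = 2, OF _ _ _ _ _ _ \<mu>])
      (use es ps dlow lX lY in auto)
  have c4: "conv (\<lambda>\<nu>. diag2 t2 \<nu> + \<epsilon>2 \<nu>) (\<lambda>\<nu>. of_int (hindex \<nu>) * \<psi> \<nu> n) \<mu>
      = conv (\<lambda>\<nu>. diag2 t2 \<nu> + \<epsilon>2' \<nu>) (\<lambda>\<nu>. of_int (hindex \<nu>) * \<psi>' \<nu> n) \<mu>"
    by (rule conv_agree[where ?d1.0 = d and ?d2.0 = "Suc d" and ?k1.0 = 1 and ?k2.0 = 2, OF _ _ _ _ _ _ \<mu>])
      (use es ps dlow lX lY in auto)
  have c5: "seventh (profile \<psi>) \<mu> n = seventh (profile \<psi>') \<mu> n"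
  proof (rule seventh_agree[where d = "Suc d", OF _ _ \<mu>])
    show "profile \<psi> \<nu> n = profile \<psi>' \<nu> n" if "deg \<nu> < Suc d" for \<nu>
      using ps[OF that] by (simp add: profile_def)
    show "profile \<psi> \<nu> n = 0 \<and> profile \<psi>' \<nu> n = 0" if "deg \<nu> < 1" for \<nu>
      using that profile_support[OF X[unfolded Xe], of \<nu> n] profile_support[OF Y[unfolded Ye], of \<nu> n] by auto
  qed
  show "rhs X \<mu> n = rhs Y \<mu> n"
    by (simp add: Xe Ye vconv_def c1 c2 c3 c4 c5)
qed

lemma agree_step:
  assumes "invar X" "invar Y" "agree d X Y"
  shows "agree (Suc d) (step X) (step Y)"
  using rhs_agree[OF assms] by (simp add: agree_def)

lemma agree_sym: "agree d X Y \<Longrightarrow> agree d Y X"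
  and agree_trans: "agree d X Y \<Longrightarrow> agree d Y Z \<Longrightarrow> agree d X Z"
  and agree_le: "agree d X Y \<Longrightarrow> d' \<le> d \<Longrightarrow> agree d' X Y"
  by (auto simp: agree_def)

section \<open>The iteration and its limit\<close>

definition iter :: "nat \<Rightarrow> unknowns" where
  "iter k = (step ^^ k) (\<lambda>\<mu> n. 0, \<lambda>\<mu>. 0, \<lambda>\<mu>. 0)"

lemma iter_Suc: "iter (Suc k) = step (iter k)"
  by (simp add: iter_def)

lemma inv_iter: "invar (iter k)"
proof (induction k)
  case 0
  have "mbound r (\<lambda>\<mu>. 0) R" if "0 \<le> R" for R using that by (simp add: mbound_def)
  then show ?case using r by (simp add: iter_def)
qed (simp only: iter_Suc inv_step)

lemma agree_iter: "agree k (iter k) (iter (k + j))"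
proof (induction k)
  case 0
  obtain \<psi> \<epsilon>1 \<epsilon>2 where e: "iter j = (\<psi>, \<epsilon>1, \<epsilon>2)" by (cases "iter j")
  from inv_low(1)[OF inv_iter[of j, unfolded e]] show ?case
    by (auto simp: e agree_def fun_eq_iff) (simp add: iter_def)
next
  case (Suc k)
  from agree_step[OF inv_iter inv_iter Suc] show ?case by (simp add: iter_Suc)
qed

text \<open>Each coefficient is taken from an iterate in which it is already final; the index is one
  larger for \<epsilon> because of the offset in \<open>agree\<close>.\<close>

definition limit :: unknowns where
  "limit = (\<lambda>\<mu>. fst (iter (deg \<mu>)) \<mu>, \<lambda>\<mu>. fst (snd (iter (Suc (deg \<mu>)))) \<mu>, \<lambda>\<mu>. snd (snd (iter (Suc (deg \<mu>)))) \<mu>)"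

lemma agree_limit: "agree k (iter k) limit"
  unfolding agree_def
proof (intro conjI allI impI)
  fix \<mu>
  show "fst (iter k) \<mu> = fst limit \<mu>" if "deg \<mu> < Suc k"
    using agree_iter[of "deg \<mu>" "k - deg \<mu>"] that by (simp add: agree_def limit_def)
  show "fst (snd (iter k)) \<mu> = fst (snd limit) \<mu>" "snd (snd (iter k)) \<mu> = snd (snd limit) \<mu>" if "deg \<mu> < k"
    using agree_iter[of "Suc (deg \<mu>)" "k - Suc (deg \<mu>)"] that by (simp_all add: agree_def limit_def)
qed

lemma inv_limit: "invar limit"
proof -
  obtain \<psi> \<epsilon>1 \<epsilon>2 where e: "limit = (\<psi>, \<epsilon>1, \<epsilon>2)" by (cases limit)
  define P where "P k = fst (iter k)" for k
  define E where "E k = fst (snd (iter k))" for k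
  define F where "F k = snd (snd (iter k))" for k
  have it: "iter k = (P k, E k, F k)" for k by (simp add: P_def E_def F_def)
  note iv = inv_iter[unfolded it invar.simps]
  have eq: "\<psi> \<mu> = P k \<mu>" "\<epsilon>1 \<mu> = E k \<mu>" "\<epsilon>2 \<mu> = F k \<mu>" if "deg \<mu> < k" for k \<mu>
    using agree_limit[of k] that by (simp_all add: agree_def e it)
  have 1: "mbound r (\<lambda>\<mu>. (1 + \<bar>of_int (hindex \<mu>)\<bar>) * le_norm a (\<psi> \<mu>)) (r\<^sup>2)"
    by (rule mbound_degreewise[where H = "\<lambda>k \<mu>. (1 + \<bar>of_int (hindex \<mu>)\<bar>) * le_norm a (P k \<mu>)"]) (use iv eq(1) in auto)
  have 2: "mbound r (\<lambda>\<mu>. \<bar>\<epsilon>1 \<mu>\<bar>) r"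
    by (rule mbound_degreewise[where H = "\<lambda>k \<mu>. \<bar>E k \<mu>\<bar>"]) (use iv eq(2) in auto)
  have 3: "mbound r (\<lambda>\<mu>. \<bar>\<epsilon>2 \<mu>\<bar>) r"
    by (rule mbound_degreewise[where H = "\<lambda>k \<mu>. \<bar>F k \<mu>\<bar>"]) (use iv eq(3) in auto)
  have sup: "\<psi> \<mu> \<in> le_space a" "\<psi> \<mu> n \<noteq> 0 \<Longrightarrow> admissible \<mu>" "\<epsilon>1 \<mu> \<noteq> 0 \<Longrightarrow> eadm1 \<mu>" "\<epsilon>2 \<mu> \<noteq> 0 \<Longrightarrow> eadm2 \<mu>" for \<mu> n
    using eq[of \<mu> "Suc (deg \<mu>)"] iv[of "Suc (deg \<mu>)"] by auto
  show ?thesis unfolding e invar.simps using 1 2 3 sup by blast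
qed

text \<open>No continuity is involved: \<open>limit\<close> and its image under \<open>step\<close>
  agree with the same iterate in arbitrarily many degrees.\<close>

lemma step_limit: "step limit = limit"
proof -
  have ag: "agree k (step limit) limit" for k
  proof -
    have "agree (Suc k) (step (iter k)) (step limit)"
      by (rule agree_step[OF inv_iter inv_limit agree_limit])
    then have "agree (Suc k) (step limit) (iter (Suc k))" by (simp only: iter_Suc agree_sym)
    then have "agree (Suc k) (step limit) limit" using agree_limit agree_trans by blast
    then show ?thesis by (rule agree_le) simp
  qed
  obtain \<psi> \<epsilon>1 \<epsilon>2 where e: "limit = (\<psi>, \<epsilon>1, \<epsilon>2)" by (cases limit)
  obtain \<psi>' \<epsilon>1' \<epsilon>2' where s: "step limit = (\<psi>', \<epsilon>1', \<epsilon>2')" by (cases "step limit")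
  have "\<psi>' \<mu> = \<psi> \<mu> \<and> \<epsilon>1' \<mu> = \<epsilon>1 \<mu> \<and> \<epsilon>2' \<mu> = \<epsilon>2 \<mu>" for \<mu>
    using ag[of "Suc (deg \<mu>)"] unfolding s agree_def by (simp add: e)
  then show ?thesis unfolding s by (auto simp: e fun_eq_iff)
qed

fun solves :: "unknowns \<Rightarrow> bool" where
  "solves (\<psi>, \<epsilon>1, \<epsilon>2) \<longleftrightarrow> (\<forall>\<mu> n. schroedinger V (\<psi> \<mu>) n - freq (hindex \<mu>) * \<psi> \<mu> n = rhs (\<psi>, \<epsilon>1, \<epsilon>2) \<mu> n +
     (case \<mu> of Mono i j k l \<Rightarrow> (if i = Suc j \<and> k = l then \<epsilon>1 (Mono j j k k) * \<phi>1 n else 0) +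
        (if i = j \<and> k = Suc l then \<epsilon>2 (Mono i i l l) * \<phi>2 n else 0)))"

lemma solution_exists:
  obtains \<psi> \<epsilon>1 \<epsilon>2 where "invar (\<psi>, \<epsilon>1, \<epsilon>2)" "solves (\<psi>, \<epsilon>1, \<epsilon>2)"
proof -
  obtain \<psi> \<epsilon>1 \<epsilon>2 where e: "limit = (\<psi>, \<epsilon>1, \<epsilon>2)" by (cases limit)
  let ?X = "(\<psi>, \<epsilon>1, \<epsilon>2)"
  have iv: "invar ?X" using inv_limit by (simp add: e)
  note st = step_limit[unfolded e step.simps prod.inject]
  have p: "\<psi> \<mu> = fst (res (hindex \<mu>) (rhs ?X \<mu>))" for \<mu>
    using fun_cong[OF conjunct1[OF st], of \<mu>] by (rule sym)
  have E1: "\<epsilon>1 \<mu> = (if balanced \<mu> then snd (res 0 (rhs ?X (inc1 \<mu>))) else 0)" for \<mu>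
    using fun_cong[OF conjunct1[OF conjunct2[OF st]], of \<mu>] by (rule sym)
  have E2: "\<epsilon>2 \<mu> = (if balanced \<mu> then snd (res 1 (rhs ?X (inc2 \<mu>))) else 0)" for \<mu>
    using fun_cong[OF conjunct2[OF conjunct2[OF st]], of \<mu>] by (rule sym)
  have f: "rhs ?X \<mu> \<in> le_space a" for \<mu> using rhs_bound[OF iv] unfolding vbound_def by blast
  show thesis
  proof (rule that[OF iv], unfold solves.simps, intro allI)
    fix \<mu> n
    obtain i j k l where \<mu>: "\<mu> = Mono i j k l" by (cases \<mu>)
    have eq: "schroedinger V (\<psi> \<mu>) n - freq (hindex \<mu>) * \<psi> \<mu> n = rhs ?X \<mu> n + snd (res (hindex \<mu>) (rhs ?X \<mu>)) * mode (hindex \<mu>) n"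
      using res(2)[OF f, of "hindex \<mu>" \<mu> n] unfolding p[of \<mu>] .
    \<comment> \<open>In charge 1, index 0 forces equal exponents of z2 and its conjugate and index
      1 those of z1, which is where \<epsilon>1 and \<epsilon>2 are stored. In any other charge the
      right-hand side vanishes, and so does the multiple.\<close>
    have "snd (res (hindex \<mu>) (rhs ?X \<mu>)) * mode (hindex \<mu>) n =
       (if i = Suc j \<and> k = l then \<epsilon>1 (Mono j j k k) * \<phi>1 n else 0) +
          (if i = j \<and> k = Suc l then \<epsilon>2 (Mono i i l l) * \<phi>2 n else 0)"
    proof (cases "charge \<mu> = 1")
      case False
      then have "rhs ?X \<mu> = (\<lambda>n. 0)" using rhs_support[OF iv, of \<mu>] by (auto simp: admissible_def)
      then have "snd (res (hindex \<mu>) (rhs ?X \<mu>)) = 0" by (simp only: res_zero)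
      moreover have "\<not> (i = Suc j \<and> k = l)" "\<not> (i = j \<and> k = Suc l)" using False by (auto simp: \<mu>)
      ultimately show ?thesis by auto
    next
      case True
      consider "hindex \<mu> = 0" "i = Suc j" "k = l" | "hindex \<mu> = 1" "i = j" "k = Suc l" | "hindex \<mu> \<noteq> 0" "hindex \<mu> \<noteq> 1"
        using True unfolding \<mu> by (simp) linarith
      then show ?thesis
      proof cases
        case 1
        then have "\<mu> = inc1 (Mono j j k k)" by (simp add: \<mu>)
        then show ?thesis using 1 E1[of "Mono j j k k"] by simp
      next
        case 2
        then have "\<mu> = inc2 (Mono i i l l)" by (simp add: \<mu>)
        then show ?thesis using 2 E2[of "Mono i i l l"] by simp
      next
        case 3
        then show ?thesis by (auto simp: \<mu>)
      qed
    qed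
    then show "schroedinger V (\<psi> \<mu>) n - freq (hindex \<mu>) * \<psi> \<mu> n = rhs ?X \<mu> n +
       (case \<mu> of Mono i j k l \<Rightarrow> (if i = Suc j \<and> k = l then \<epsilon>1 (Mono j j k k) * \<phi>1 n else 0) +
          (if i = j \<and> k = Suc l then \<epsilon>2 (Mono i i l l) * \<phi>2 n else 0))"
      using eq by (simp add: \<mu>)
  qed
qed

end


section \<open>Analytic functions and their coefficients\<close>

lemma nlinear_diagonal:
  fixes A :: "(nat \<Rightarrow> real) \<Rightarrow> 'b::real_vector"
  assumes "nlinear n A"
  shows "A (\<lambda>_. s) = s ^ n *\<^sub>R A (\<lambda>_. 1)"
proof -
  have "A (\<lambda>i. if i < j then s else 1) = s ^ j *\<^sub>R A (\<lambda>_. 1)" if "j \<le> n" for j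
    using that
  proof (induction j)
    case (Suc j)
    let ?x = "\<lambda>i. if i < j then s else 1"
    have lin: "linear (\<lambda>v. A (?x(j := v)))" using assms Suc.prems by (simp add: nlinear_def)
    have "(\<lambda>i. if i < Suc j then s else 1) = ?x(j := s *\<^sub>R 1)" "?x(j := 1) = ?x" by (auto simp: fun_eq_iff)
    then have "A (\<lambda>i. if i < Suc j then s else 1) = s *\<^sub>R A ?x"
      using linear_scale[OF lin, of s 1] by simp
    then show ?case using Suc by simp
  qed simp
  moreover have "A (\<lambda>_. s) = A (\<lambda>i. if i < n then s else 1)"
    using assms unfolding nlinear_def by auto
  ultimately show ?thesis by simp
qed

text \<open>On the real line a k-linear map is fixed on the diagonal by its value at (1, ..., 1), so
  the multilinear maps reduce to a sequence of coefficients.\<close>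

lemma analytic_coefficients:
  fixes f :: "real \<Rightarrow> 'b::real_vector"
  assumes f: "analytic_on_ball Y N \<delta> f" and N: "\<And>x. 0 \<le> N x"
  obtains c where "\<And>k. c k \<in> Y" "\<And>\<rho>. 0 \<le> \<rho> \<Longrightarrow> \<rho> < \<delta> \<Longrightarrow> summable (\<lambda>k. N (c k) * \<rho> ^ k)"
    "\<And>s. \<bar>s\<bar> < \<delta> \<Longrightarrow> f s \<in> Y \<and> (\<lambda>m. N (f s - (\<Sum>k<m. s ^ k *\<^sub>R c k))) \<longlonglongrightarrow> 0"
proof -
  obtain A where A0: "\<forall>n. bounded_nlinear n Y N (A n)"
    "\<forall>r. 0 \<le> r \<and> r < \<delta> \<longrightarrow> summable (\<lambda>n. nlinear_norm n N (A n) * r ^ n)"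
    "\<forall>x\<in>ball 0 \<delta>. f x \<in> Y \<and> (\<lambda>m. N (f x - (\<Sum>n<m. A n (\<lambda>_. x)))) \<longlonglongrightarrow> 0"
    using f unfolding analytic_on_ball_def by (elim exE conjE)
  note A = A0(1)[rule_format] A0(2)[rule_format, OF conjI] A0(3)[rule_format]
  define c where "c k = A k (\<lambda>_. 1)" for k
  have cN: "N (c k) \<le> nlinear_norm k N (A k)" for k
    unfolding nlinear_norm_def
  proof (rule cInf_greatest)
    show "nlinear_bounds k N (A k) \<noteq> {}" using A(1) by (simp add: bounded_nlinear_def)
    fix C assume "C \<in> nlinear_bounds k N (A k)"
    then have "N (A k (\<lambda>_. 1)) \<le> C * (\<Prod>i<k. norm (1::real))" unfolding nlinear_bounds_def by blast
    then show "N (c k) \<le> C" by (simp add: c_def)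
  qed
  show thesis
  proof (rule that[of c])
    show "c k \<in> Y" for k using A(1)[of k] by (auto simp: bounded_nlinear_def c_def)
    show "summable (\<lambda>k. N (c k) * \<rho> ^ k)" if "0 \<le> \<rho>" "\<rho> < \<delta>" for \<rho>
      by (rule summable_comparison_test'[OF A(2)[OF that], of 0])
        (use N cN that in \<open>simp add: abs_mult mult_right_mono\<close>)
    show "f s \<in> Y \<and> (\<lambda>m. N (f s - (\<Sum>k<m. s ^ k *\<^sub>R c k))) \<longlonglongrightarrow> 0" if "\<bar>s\<bar> < \<delta>" for s
    proof -
      have "A k (\<lambda>_. s) = s ^ k *\<^sub>R c k" for k
        unfolding c_def by (rule nlinear_diagonal[of k "A k"]) (use A(1)[of k] in \<open>simp add: bounded_nlinear_def\<close>)
      then show ?thesis using A(3)[of s] that by simp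
    qed
  qed
qed

text \<open>An index i stands for a monomial of degree \<open>dg i\<close>, the product of the
  linear forms \<open>L i j\<close>, with coefficient map \<open>g i\<close>. Feeding a separate
  argument to each form makes the part of degree n an n-linear map. Through \<open>tail\<close>,
  convergence to f follows from absolute sums off a finite set.\<close>

lemma analytic_on_ballI:
  fixes f :: "'a::real_normed_vector \<Rightarrow> 'b::real_vector"
    and dg :: "'i \<Rightarrow> nat" and g :: "'i \<Rightarrow> 'k::real_normed_field \<Rightarrow> 'b" and L :: "'i \<Rightarrow> nat \<Rightarrow> 'a \<Rightarrow> 'k"
  assumes Y: "subspace Y" and N0: "N 0 = 0" and Nadd: "\<And>x y. x \<in> Y \<Longrightarrow> y \<in> Y \<Longrightarrow> N (x + y) \<le> N x + N y"
    and Npos: "\<And>x. 0 \<le> N x"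
    and fin: "\<And>n. finite {i. dg i = n}"
    and g: "\<And>i. linear (g i)" "\<And>i k. g i k \<in> Y" "\<And>i k. N (g i k) \<le> norm k * b i" and b: "\<And>i. 0 \<le> b i"
    and L: "\<And>i j. linear (L i j)" "\<And>i j v. norm (L i j v) \<le> norm v"
    and bd: "\<And>S. finite S \<Longrightarrow> (\<Sum>i\<in>S. \<rho> ^ dg i * b i) \<le> R" and \<rho>: "0 < \<rho>" "\<delta> \<le> \<rho>"
    and fY: "\<And>x. x \<in> ball 0 \<delta> \<Longrightarrow> f x \<in> Y"
    and tail: "\<And>x F D. x \<in> ball 0 \<delta> \<Longrightarrow> finite F \<Longrightarrow>
      (\<And>S. finite S \<Longrightarrow> S \<inter> F = {} \<Longrightarrow> (\<Sum>i\<in>S. norm x ^ dg i * b i) \<le> D) \<Longrightarrow>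
      N (f x - (\<Sum>i\<in>F. g i (\<Prod>j<dg i. L i j x))) \<le> D"
  shows "analytic_on_ball Y N \<delta> f"
proof -
  let ?I = "\<lambda>n. {i. dg i = n}"
  define A where "A n x = (\<Sum>i\<in>?I n. g i (\<Prod>j<n. L i j (x j)))" for n and x :: "nat \<Rightarrow> 'a"
  have Nsum: "(\<Sum>i\<in>S. h i) \<in> Y \<and> N (\<Sum>i\<in>S. h i) \<le> (\<Sum>i\<in>S. N (h i))" if "\<And>i. i \<in> S \<Longrightarrow> h i \<in> Y"
    for S :: "'i set" and h
    using that
  proof (induction S rule: infinite_finite_induct)
    case (insert i S)
    then show ?case using Nadd[of "h i" "sum h S"] subspace_add[OF Y, of "h i" "sum h S"] by auto
  qed (use N0 subspace_0[OF Y] in auto)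
  have nl: "nlinear n (A n)" for n
    unfolding nlinear_def
  proof (intro conjI allI impI)
    fix x y :: "nat \<Rightarrow> 'a" assume "\<forall>i<n. x i = y i"
    then show "A n x = A n y" by (simp add: A_def)
  next
    fix x :: "nat \<Rightarrow> 'a" and m assume m: "m < n"
    \<comment> \<open>The m-th argument occurs in exactly one factor of each product, which makes
      the dependence on it linear.\<close>
    have "(\<lambda>v. A n (x(m := v))) = (\<lambda>v. \<Sum>i\<in>?I n. g i ((\<Prod>j\<in>{..<n} - {m}. L i j (x j)) * L i m v))"
    proof
      fix v
      have "(\<Prod>j<n. L i j ((x(m := v)) j)) = (\<Prod>j\<in>{..<n} - {m}. L i j (x j)) * L i m v" for i
        using m by (subst prod.remove[of _ m]) (auto simp: mult.commute)
      then show "A n (x(m := v)) = (\<Sum>i\<in>?I n. g i ((\<Prod>j\<in>{..<n} - {m}. L i j (x j)) * L i m v))"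
        by (simp add: A_def)
    qed
    moreover have "linear (\<lambda>v. g i ((\<Prod>j\<in>{..<n} - {m}. L i j (x j)) * L i m v))" for i
      using g(1)[of i] L(1)[of i m]
      by (intro linearI) (simp_all add: linear_add linear_scale distrib_left)
    ultimately show "linear (\<lambda>v. A n (x(m := v)))" by (simp add: linear_compose_sum)
  qed
  have AY: "A n x \<in> Y" and AN: "N (A n x) \<le> (\<Sum>i\<in>?I n. N (g i (\<Prod>j<n. L i j (x j))))" for n x
    unfolding A_def by (rule conjunct1[OF Nsum] conjunct2[OF Nsum], rule g(2))+
  have bnd: "(\<Sum>i\<in>?I n. b i) \<in> nlinear_bounds n N (A n)" for n
    unfolding nlinear_bounds_def mem_Collect_eq
  proof (intro conjI allI)
    show "0 \<le> (\<Sum>i\<in>?I n. b i)" using b by (intro sum_nonneg) auto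
    fix x :: "nat \<Rightarrow> 'a"
    have "N (A n x) \<le> (\<Sum>i\<in>?I n. N (g i (\<Prod>j<n. L i j (x j))))"
      by (rule AN)
    also have "\<dots> \<le> (\<Sum>i\<in>?I n. b i * (\<Prod>i<n. norm (x i)))"
    proof (rule sum_mono)
      fix i
      have "N (g i (\<Prod>j<n. L i j (x j))) \<le> norm (\<Prod>j<n. L i j (x j)) * b i" by (rule g(3))
      also have "\<dots> \<le> (\<Prod>j<n. norm (x j)) * b i"
        using b L(2) by (intro mult_right_mono) (auto simp: prod_norm[symmetric] intro!: prod_mono)
      finally show "N (g i (\<Prod>j<n. L i j (x j))) \<le> b i * (\<Prod>i<n. norm (x i))" by (simp add: mult.commute)
    qed
    finally show "N (A n x) \<le> (\<Sum>i\<in>?I n. b i) * (\<Prod>i<n. norm (x i))" by (simp add: sum_distrib_right)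
  qed
  have nn: "0 \<le> nlinear_norm n N (A n)" for n
    unfolding nlinear_norm_def using bnd by (intro cInf_greatest) (auto simp: nlinear_bounds_def)
  have nb: "nlinear_norm n N (A n) \<le> (\<Sum>i\<in>?I n. b i)" for n
    unfolding nlinear_norm_def by (rule cInf_lower[OF bnd]) (auto simp: nlinear_bounds_def intro!: bdd_belowI[of _ 0])
  have low: "(\<Sum>n<m. \<Sum>i\<in>?I n. h i) = (\<Sum>i | dg i < m. h i)" for h :: "'i \<Rightarrow> 'c::comm_monoid_add" and m
  proof -
    have "{i. dg i < m} = (\<Union>n\<in>{..<m}. ?I n)" by auto
    then show ?thesis using fin by (simp only:) (subst sum.UNION_disjoint, auto)
  qed
  have finlow: "finite {i. dg i < m}" for m
  proof -
    have "{i. dg i < m} = (\<Union>n\<in>{..<m}. ?I n)" by auto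
    then show ?thesis using fin by simp
  qed
  show ?thesis
    unfolding analytic_on_ball_def
  proof (intro exI[of _ A] conjI allI impI ballI)
    show "bounded_nlinear n Y N (A n)" for n
      unfolding bounded_nlinear_def using nl bnd AY by blast
    fix r :: real assume r: "0 \<le> r \<and> r < \<delta>"
    have "summable (\<lambda>n. (\<Sum>i\<in>?I n. b i) * r ^ n)"
    proof (rule summableI_nonneg_bounded[of _ R])
      show "0 \<le> (\<Sum>i\<in>?I n. b i) * r ^ n" for n using b r by (auto intro!: mult_nonneg_nonneg sum_nonneg)
      fix m
      have "(\<Sum>n<m. (\<Sum>i\<in>?I n. b i) * r ^ n) = (\<Sum>n<m. \<Sum>i\<in>?I n. r ^ dg i * b i)"
        unfolding sum_distrib_right by (intro sum.cong) (auto simp: mult.commute)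
      also have "\<dots> = (\<Sum>i | dg i < m. r ^ dg i * b i)" by (rule low)
      also have "\<dots> \<le> (\<Sum>i | dg i < m. \<rho> ^ dg i * b i)"
        using r \<rho> b by (intro sum_mono mult_right_mono power_mono) auto
      also have "\<dots> \<le> R" by (rule bd[OF finlow])
      finally show "(\<Sum>n<m. (\<Sum>i\<in>?I n. b i) * r ^ n) \<le> R" .
    qed
    then show "summable (\<lambda>n. nlinear_norm n N (A n) * r ^ n)"
      by (rule summable_comparison_test'[of _ 0]) (use r nn nb in \<open>simp add: abs_mult mult_right_mono\<close>)
  next
    fix x :: 'a assume x: "x \<in> ball 0 \<delta>"
    show "f x \<in> Y" by (rule fY[OF x])
    \<comment> \<open>At radius \<rho> the absolute sums are bounded by \<open>R\<close>; at
      \<open>norm x\<close> the terms of degree at least m are smaller by the factor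
      \<open>\<theta> ^ m\<close>.\<close>
    define \<theta> where "\<theta> = norm x / \<rho>"
    have \<theta>: "0 \<le> \<theta>" "\<theta> < 1" using x \<rho> by (auto simp: \<theta>_def)
    have est: "N (f x - (\<Sum>n<m. A n (\<lambda>_. x))) \<le> \<theta> ^ m * R" for m
    proof -
      have "(\<Sum>n<m. A n (\<lambda>_. x)) = (\<Sum>n<m. \<Sum>i\<in>?I n. g i (\<Prod>j<dg i. L i j x))" by (simp add: A_def)
      also have "\<dots> = (\<Sum>i | dg i < m. g i (\<Prod>j<dg i. L i j x))" by (rule low)
      finally have e: "(\<Sum>n<m. A n (\<lambda>_. x)) = (\<Sum>i | dg i < m. g i (\<Prod>j<dg i. L i j x))" .
      show ?thesis unfolding e
      proof (rule tail[OF x finlow])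
        fix S assume S: "finite S" "S \<inter> {i. dg i < m} = {}"
        have "(\<Sum>i\<in>S. norm x ^ dg i * b i) \<le> (\<Sum>i\<in>S. \<theta> ^ m * (\<rho> ^ dg i * b i))"
        proof (rule sum_mono)
          fix i assume "i \<in> S"
          then have "m \<le> dg i" using S(2) by auto
          then have "\<theta> ^ dg i \<le> \<theta> ^ m" using \<theta> by (intro power_decreasing) auto
          moreover have "norm x ^ dg i = \<theta> ^ dg i * \<rho> ^ dg i" using \<rho> by (simp add: \<theta>_def power_divide)
          ultimately have "norm x ^ dg i \<le> \<theta> ^ m * \<rho> ^ dg i" using \<rho> by simp
          then show "norm x ^ dg i * b i \<le> \<theta> ^ m * (\<rho> ^ dg i * b i)"
            using b[of i] mult_right_mono by fastforce
        qed
        also have "\<dots> \<le> \<theta> ^ m * R"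
          using bd[OF S(1)] \<theta> by (simp add: sum_distrib_left[symmetric] mult_left_mono)
        finally show "(\<Sum>i\<in>S. norm x ^ dg i * b i) \<le> \<theta> ^ m * R" .
      qed
    qed
    have "(\<lambda>m. \<theta> ^ m * R) \<longlonglongrightarrow> 0 * R" using \<theta> by (intro tendsto_mult_right LIMSEQ_realpow_zero) auto
    then have lim: "(\<lambda>m. \<theta> ^ m * R) \<longlonglongrightarrow> 0" by simp
    show "(\<lambda>m. N (f x - (\<Sum>n<m. A n (\<lambda>_. x)))) \<longlonglongrightarrow> 0"
      by (rule tendsto_sandwich[OF always_eventually always_eventually tendsto_const lim], rule allI, rule Npos, rule allI, rule est)
  qed
qed

section \<open>Series with values in weighted spaces as analytic maps\<close>

lemma has_sum_cofinite:
  fixes f :: "'i \<Rightarrow> 'b::real_normed_vector"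
  assumes f: "(f has_sum s) UNIV" and F: "finite F"
  shows "(f has_sum (s - sum f F)) (- F)"
proof -
  have "f summable_on (UNIV - F)" using f F by (intro summable_on_cofin_subset) (auto simp: summable_on_def)
  then obtain t where t: "(f has_sum t) (- F)" by (auto simp: summable_on_def Compl_eq_Diff_UNIV)
  have "(f has_sum (sum f F + t)) (F \<union> - F)"
    by (rule has_sum_Un_disjoint[OF has_sum_finite[OF F] t]) auto
  then have "s = sum f F + t" using f has_sum_unique by fastforce
  with t show ?thesis by simp
qed

lemma finite_deg: "finite {\<mu>. deg \<mu> = n}"
proof -
  have "{\<mu>. deg \<mu> = n} \<subseteq> (\<lambda>(a, b, c, d). Mono a b c d) ` ({..n} \<times> {..n} \<times> {..n} \<times> {..n})"
  proof
    fix \<mu> assume "\<mu> \<in> {\<mu>. deg \<mu> = n}"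
    then obtain a b c d where "\<mu> = Mono a b c d" "(a, b, c, d) \<in> {..n} \<times> {..n} \<times> {..n} \<times> {..n}"
      by (cases \<mu>) auto
    then show "\<mu> \<in> (\<lambda>(a, b, c, d). Mono a b c d) ` ({..n} \<times> {..n} \<times> {..n} \<times> {..n})"
      by (metis (no_types, lifting) case_prod_conv image_eqI)
  qed
  then show ?thesis by (rule finite_subset) simp
qed

text \<open>The linear forms whose product is the monomial, one for each of the first
  \<open>deg\<close> slots. Conjugation is linear over the reals, and that is the linearity which
  \<open>analytic_on_ball\<close> asks for.\<close>

fun coord :: "mono \<Rightarrow> nat \<Rightarrow> complex \<times> complex \<Rightarrow> complex" where
  "coord (Mono a b c d) j v = (if j < a then fst v else if j < a + b then cnj (fst v)
     else if j < a + b + c then snd v else cnj (snd v))"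

lemma prod_coord: "(\<Prod>j<deg \<mu>. coord \<mu> j z) = mval z \<mu>"
proof -
  obtain a b c d where \<mu>: "\<mu> = Mono a b c d" by (cases \<mu>)
  obtain z1 z2 where z: "z = (z1, z2)" by (cases z)
  have split: "(\<Prod>j<m + k. h j) = (\<Prod>j<m. h j) * (\<Prod>j<k. h (m + j))" for h :: "nat \<Rightarrow> complex" and m k
    by (induction k) (simp_all add: mult.assoc)
  show ?thesis unfolding \<mu> z deg.simps split by simp
qed

lemma linear_coord: "linear (coord \<mu> j)"
  by (cases \<mu>) (auto intro!: linearI simp: scaleR_conv_of_real)

lemma norm_coord: "norm (coord \<mu> j v) \<le> norm v"
  using norm_fst_le[of "fst v" "snd v"] norm_snd_le[of "snd v" "fst v"] by (cases \<mu>) auto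

lemma subspace_le_space: "subspace (le_space a :: (int \<Rightarrow> 'b::real_normed_vector) set)"
  unfolding subspace_def
proof (intro conjI ballI allI)
  show "0 \<in> (le_space a :: (int \<Rightarrow> 'b) set)" using le_space_zero(1) by (simp add: zero_fun_def)
  show "x + y \<in> le_space a" if "x \<in> le_space a" "y \<in> le_space a" for x y :: "int \<Rightarrow> 'b"
    using le_space_add(1)[OF that] by (simp add: plus_fun_def)
  show "c *\<^sub>R x \<in> le_space a" if "x \<in> le_space a" for c and x :: "int \<Rightarrow> 'b"
    using le_space_scaleR(1)[OF that] by (simp add: scaleR_fun_def)
qed

lemma series_term_bound:
  fixes u :: "int \<Rightarrow> real" and k :: complex
  assumes "u \<in> le_space a"
  shows "(\<lambda>n. of_real (u n) * k) \<in> le_space a" "le_norm a (\<lambda>n. of_real (u n) * k) \<le> cmod k * le_norm a u"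
  using le_space_dominated[OF assms, of "cmod k" "\<lambda>n. of_real (u n) * k"] by (auto simp: norm_mult mult.commute)

definition evs :: "(mono \<Rightarrow> int \<Rightarrow> real) \<Rightarrow> complex \<times> complex \<Rightarrow> int \<Rightarrow> complex" where
  "evs f z n = ev (\<lambda>\<mu>. f \<mu> n) z"

lemma ball_bidisc: "z \<in> ball 0 \<delta> \<Longrightarrow> \<delta> \<le> r \<Longrightarrow> z \<in> bidisc r"
  using norm_fst_le[of "fst z" "snd z"] norm_snd_le[of "snd z" "fst z"] by auto

text \<open>The remainder is the sum over the complement of \<open>F\<close>, to which the
  semicontinuity of the norm applies. With \<open>F\<close> empty this bounds the whole
  series.\<close>

lemma evs_tail:
  assumes f: "vbound r a f R" and r: "0 < r" and a: "0 \<le> a" and z: "z \<in> bidisc r" and F: "finite F"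
    and D: "\<And>S. finite S \<Longrightarrow> S \<inter> F = {} \<Longrightarrow> (\<Sum>\<mu>\<in>S. cmod (mval z \<mu>) * le_norm a (f \<mu>)) \<le> D"
  shows "(\<lambda>n. evs f z n - (\<Sum>\<mu>\<in>F. of_real (f \<mu> n) * mval z \<mu>)) \<in> le_space a"
    "le_norm a (\<lambda>n. evs f z n - (\<Sum>\<mu>\<in>F. of_real (f \<mu> n) * mval z \<mu>)) \<le> D"
proof -
  have fs: "f \<mu> \<in> le_space a" for \<mu> using f by (simp add: vbound_def)
  have hs: "((\<lambda>\<mu>. of_real (f \<mu> n) * mval z \<mu>) has_sum (evs f z n - (\<Sum>\<mu>\<in>F. of_real (f \<mu> n) * mval z \<mu>))) (- F)" for n
    unfolding evs_def using r by (intro has_sum_cofinite[OF _ F] ev_has_sum[OF vbound_abs_conv[OF f a] _ z]) auto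
  have bd: "(\<Sum>\<mu>\<in>S. le_norm a (\<lambda>n. of_real (f \<mu> n) * mval z \<mu>)) \<le> D" if "finite S" "S \<subseteq> - F" for S
  proof -
    have "(\<Sum>\<mu>\<in>S. le_norm a (\<lambda>n. of_real (f \<mu> n) * mval z \<mu>)) \<le> (\<Sum>\<mu>\<in>S. cmod (mval z \<mu>) * le_norm a (f \<mu>))"
      by (intro sum_mono series_term_bound fs)
    also have "\<dots> \<le> D" using that by (intro D) auto
    finally show ?thesis .
  qed
  show "(\<lambda>n. evs f z n - (\<Sum>\<mu>\<in>F. of_real (f \<mu> n) * mval z \<mu>)) \<in> le_space a"
    "le_norm a (\<lambda>n. evs f z n - (\<Sum>\<mu>\<in>F. of_real (f \<mu> n) * mval z \<mu>)) \<le> D"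
    using le_space_has_sum[OF series_term_bound(1)[OF fs] hs bd] by auto
qed

lemma mval_sum_bound:
  assumes F: "mbound r F R" and z: "z \<in> bidisc r" and S: "finite S"
  shows "(\<Sum>\<mu>\<in>S. cmod (mval z \<mu>) * F \<mu>) \<le> R"
proof -
  have "(\<Sum>\<mu>\<in>S. cmod (mval z \<mu>) * F \<mu>) \<le> (\<Sum>\<mu>\<in>S. r ^ deg \<mu> * F \<mu>)"
    using z mboundD(1)[OF F] by (intro sum_mono mult_right_mono cmod_mval_le) auto
  with mboundD(2)[OF F S] show ?thesis by linarith
qed

lemma evs_le_space:
  assumes f: "vbound r a f R" and r: "0 < r" and a: "0 \<le> a" and z: "z \<in> bidisc r"
  shows "evs f z \<in> le_space a"
proof -
  have "(\<lambda>n. evs f z n - (\<Sum>\<mu>\<in>{}. of_real (f \<mu> n) * mval z \<mu>)) \<in> le_space a"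
    by (rule evs_tail(1)[OF f r a z finite.emptyI, where D = R], rule mval_sum_bound[OF _ z])
      (use f in \<open>simp_all add: vbound_def\<close>)
  then show ?thesis by simp
qed

lemma analytic_evs:
  assumes f: "vbound r a f R" and r: "0 < r" and a: "0 \<le> a" and \<delta>: "\<delta> \<le> r"
  shows "analytic_on_ball (le_space a) (le_norm a) \<delta> (evs f)"
proof -
  have fs: "f \<mu> \<in> le_space a" and fm: "mbound r (\<lambda>\<mu>. le_norm a (f \<mu>)) R" for \<mu>
    using f by (auto simp: vbound_def)
  have zero: "le_norm a (0 :: int \<Rightarrow> complex) = 0" using le_space_zero(2)[of a] by (simp add: zero_fun_def)
  show ?thesis
  proof (rule analytic_on_ballI[where dg = deg and g = "\<lambda>\<mu> k n. of_real (f \<mu> n) * k" and L = coord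
        and b = "\<lambda>\<mu>. le_norm a (f \<mu>)" and \<rho> = r and R = R])
    show "le_norm a (x + y) \<le> le_norm a x + le_norm a y" if "x \<in> le_space a" "y \<in> le_space a" for x y :: "int \<Rightarrow> complex"
      using le_space_add(2)[OF that] by (simp add: plus_fun_def)
    show "linear (\<lambda>k n. complex_of_real (f \<mu> n) * k)" for \<mu>
      by (rule linearI) (auto simp: fun_eq_iff distrib_left)
    show "evs f x \<in> le_space a" if "x \<in> ball 0 \<delta>" for x
      by (rule evs_le_space[OF f r a ball_bidisc[OF that \<delta>]])
    fix x :: "complex \<times> complex" and F D
    assume x: "x \<in> ball 0 \<delta>" and F: "finite F"
      and D: "\<And>S. finite S \<Longrightarrow> S \<inter> F = {} \<Longrightarrow> (\<Sum>\<mu>\<in>S. norm x ^ deg \<mu> * le_norm a (f \<mu>)) \<le> D"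
    have e: "evs f x - (\<Sum>\<mu>\<in>F. (\<lambda>n. complex_of_real (f \<mu> n) * (\<Prod>j<deg \<mu>. coord \<mu> j x)))
        = (\<lambda>n. evs f x n - (\<Sum>\<mu>\<in>F. of_real (f \<mu> n) * mval x \<mu>))"
    proof -
      have "(\<Sum>\<mu>\<in>F. h \<mu>) n = (\<Sum>\<mu>\<in>F. h \<mu> n)" for h :: "mono \<Rightarrow> int \<Rightarrow> complex" and n
        by (induction F rule: infinite_finite_induct) auto
      then show ?thesis by (auto simp: fun_eq_iff prod_coord)
    qed
    have xb: "cmod (fst x) \<le> norm x" "cmod (snd x) \<le> norm x"
      using norm_fst_le[of "fst x" "snd x"] norm_snd_le[of "snd x" "fst x"] by auto
    show "le_norm a (evs f x - (\<Sum>\<mu>\<in>F. (\<lambda>n. complex_of_real (f \<mu> n) * (\<Prod>j<deg \<mu>. coord \<mu> j x)))) \<le> D"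
      unfolding e
    proof (rule evs_tail(2)[OF f r a ball_bidisc[OF x \<delta>] F])
      fix S :: "mono set" assume S: "finite S" "S \<inter> F = {}"
      have "(\<Sum>\<mu>\<in>S. cmod (mval x \<mu>) * le_norm a (f \<mu>)) \<le> (\<Sum>\<mu>\<in>S. norm x ^ deg \<mu> * le_norm a (f \<mu>))"
        using xb by (intro sum_mono mult_right_mono cmod_mval_le) auto
      also have "\<dots> \<le> D" by (rule D[OF S])
      finally show "(\<Sum>\<mu>\<in>S. cmod (mval x \<mu>) * le_norm a (f \<mu>)) \<le> D" .
    qed
  qed (use zero subspace_le_space finite_deg series_term_bound[OF fs] linear_coord norm_coord mboundD[OF fm] r \<delta> in auto)
qed

subsection \<open>Real functions of the squared moduli\<close>

definition modval :: "real \<times> real \<Rightarrow> nat \<times> nat \<Rightarrow> real" where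
  "modval s p = fst s ^ fst p * snd s ^ snd p"

text \<open>Only balanced exponents are read. The degree of such a monomial in z is twice its degree
  in the squared moduli, hence the radius \<open>r\<^sup>2\<close> below.\<close>

definition evm :: "(mono \<Rightarrow> real) \<Rightarrow> real \<times> real \<Rightarrow> real" where
  "evm e s = (\<Sum>\<^sub>\<infinity>p. e (Mono (fst p) (fst p) (snd p) (snd p)) * modval s p)"

lemma modval_bound:
  assumes "\<bar>fst s\<bar> \<le> x" "\<bar>snd s\<bar> \<le> x"
  shows "\<bar>modval s p\<bar> \<le> x ^ (fst p + snd p)"
  using assms unfolding modval_def abs_mult power_abs power_add
  by (intro mult_mono power_mono) (auto intro: order_trans[OF abs_ge_zero])

lemma mbound_balanced:
  assumes "mbound r F R" "finite S" "0 < r"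
  shows "(\<Sum>p\<in>S. (r\<^sup>2) ^ (fst p + snd p) * F (Mono (fst p) (fst p) (snd p) (snd p))) \<le> R"
proof -
  let ?h = "\<lambda>p. Mono (fst p) (fst p) (snd p) (snd p)"
  have "(\<Sum>p\<in>S. (r\<^sup>2) ^ (fst p + snd p) * F (?h p)) = (\<Sum>p\<in>S. r ^ deg (?h p) * F (?h p))"
  proof (rule sum.cong)
    fix p assume "p \<in> S"
    have "deg (?h p) = 2 * (fst p + snd p)" by simp
    then show "(r\<^sup>2) ^ (fst p + snd p) * F (?h p) = r ^ deg (?h p) * F (?h p)" by (simp only: power_mult)
  qed simp
  also have "\<dots> = (\<Sum>\<mu>\<in>?h ` S. r ^ deg \<mu> * F \<mu>)"
    by (subst sum.reindex) (auto simp: inj_on_def prod_eq_iff)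
  also have "\<dots> \<le> R" using assms by (intro mboundD(2)) auto
  finally show ?thesis .
qed

lemma evm_abs_summable:
  assumes e: "mbound r (\<lambda>\<mu>. \<bar>e \<mu>\<bar>) R" and r: "0 < r" and s: "\<bar>fst s\<bar> \<le> r\<^sup>2" "\<bar>snd s\<bar> \<le> r\<^sup>2"
  shows "(\<lambda>p. norm (e (Mono (fst p) (fst p) (snd p) (snd p)) * modval s p)) summable_on UNIV"
proof (rule nonneg_bdd_above_summable_on)
  show "bdd_above (sum (\<lambda>p. norm (e (Mono (fst p) (fst p) (snd p) (snd p)) * modval s p)) ` {F. F \<subseteq> UNIV \<and> finite F})"
  proof (rule bdd_aboveI2[where M = R])
    fix F :: "(nat \<times> nat) set" assume "F \<in> {F. F \<subseteq> UNIV \<and> finite F}"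
    then have F: "finite F" by simp
    have "(\<Sum>p\<in>F. norm (e (Mono (fst p) (fst p) (snd p) (snd p)) * modval s p))
        \<le> (\<Sum>p\<in>F. (r\<^sup>2) ^ (fst p + snd p) * \<bar>e (Mono (fst p) (fst p) (snd p) (snd p))\<bar>)"
    proof (rule sum_mono)
      fix p
      show "norm (e (Mono (fst p) (fst p) (snd p) (snd p)) * modval s p)
          \<le> (r\<^sup>2) ^ (fst p + snd p) * \<bar>e (Mono (fst p) (fst p) (snd p) (snd p))\<bar>"
        using mult_right_mono[OF modval_bound[OF s, of p] abs_ge_zero[of "e (Mono (fst p) (fst p) (snd p) (snd p))"]]
        by (simp add: abs_mult mult.commute)
    qed
    also have "\<dots> \<le> R" by (rule mbound_balanced[OF e F r])
    finally show "(\<Sum>p\<in>F. norm (e (Mono (fst p) (fst p) (snd p) (snd p)) * modval s p)) \<le> R" .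
  qed
qed auto

lemma analytic_evm:
  assumes e: "mbound r (\<lambda>\<mu>. \<bar>e \<mu>\<bar>) R" and r: "0 < r" and \<delta>: "\<delta> \<le> r\<^sup>2"
  shows "analytic_on_ball UNIV norm \<delta> (evm e)"
proof -
  let ?h = "\<lambda>p. Mono (fst p) (fst p) (snd p) (snd p)"
  let ?L = "\<lambda>(p :: nat \<times> nat) j (s :: real \<times> real). if j < fst p then fst s else snd s"
  have pr: "(\<Prod>j<fst p + snd p. ?L p j s) = modval s p" for p s
  proof -
    have split: "(\<Prod>j<m + k. h j) = (\<Prod>j<m. h j) * (\<Prod>j<k. h (m + j))" for h :: "nat \<Rightarrow> real" and m k
      by (induction k) (simp_all add: mult.assoc)
    show ?thesis unfolding split by (simp add: modval_def)
  qed
  have fin: "finite {p :: nat \<times> nat. fst p + snd p = n}" for n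
    by (rule finite_subset[of _ "{..n} \<times> {..n}"]) auto
  show ?thesis
  proof (rule analytic_on_ballI[where dg = "\<lambda>p. fst p + snd p" and g = "\<lambda>p k. e (?h p) * k" and L = ?L
        and b = "\<lambda>p. \<bar>e (?h p)\<bar>" and \<rho> = "r\<^sup>2" and R = R])
    show "linear ((*) (e (?h p)))" for p by (rule linearI) (auto simp: distrib_left)
    show "linear (?L p j)" for p j by (rule linearI) auto
    show "norm (?L p j s) \<le> norm s" for p j and s :: "real \<times> real"
      using norm_fst_le[of "fst s" "snd s"] norm_snd_le[of "snd s" "fst s"] by auto
    show "(\<Sum>p\<in>S. (r\<^sup>2) ^ (fst p + snd p) * \<bar>e (?h p)\<bar>) \<le> R" if "finite S" for S
      by (rule mbound_balanced[OF e that r])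
    fix s :: "real \<times> real" and F D
    assume s: "s \<in> ball 0 \<delta>" and F: "finite F"
      and D: "\<And>S. finite S \<Longrightarrow> S \<inter> F = {} \<Longrightarrow> (\<Sum>p\<in>S. norm s ^ (fst p + snd p) * \<bar>e (?h p)\<bar>) \<le> D"
    have sb: "\<bar>fst s\<bar> \<le> norm s" "\<bar>snd s\<bar> \<le> norm s"
      using norm_fst_le[of "fst s" "snd s"] norm_snd_le[of "snd s" "fst s"] by auto
    have sb': "\<bar>fst s\<bar> \<le> r\<^sup>2" "\<bar>snd s\<bar> \<le> r\<^sup>2" using sb s \<delta> by auto
    have "((\<lambda>p. e (?h p) * modval s p) has_sum evm e s) UNIV"
      unfolding evm_def by (rule has_sum_infsum[OF abs_summable_summable[OF evm_abs_summable[OF e r sb']]])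
    from has_sum_cofinite[OF this F]
    have lim: "((\<lambda>p. e (?h p) * modval s p) has_sum (evm e s - (\<Sum>p\<in>F. e (?h p) * modval s p))) (- F)" .
    have "norm (evm e s - (\<Sum>p\<in>F. e (?h p) * modval s p)) \<le> D"
    proof (rule tendsto_upperbound[OF tendsto_norm[OF lim[unfolded has_sum_def]] _ finite_subsets_at_top_neq_bot])
      show "\<forall>\<^sub>F S in finite_subsets_at_top (- F). norm (\<Sum>p\<in>S. e (?h p) * modval s p) \<le> D"
      proof (rule eventually_finite_subsets_at_top_weakI)
        fix S assume S: "finite S" "S \<subseteq> - F"
        have "norm (\<Sum>p\<in>S. e (?h p) * modval s p) \<le> (\<Sum>p\<in>S. norm s ^ (fst p + snd p) * \<bar>e (?h p)\<bar>)"
        proof (rule sum_norm_le)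
          fix p
          show "norm (e (?h p) * modval s p) \<le> norm s ^ (fst p + snd p) * \<bar>e (?h p)\<bar>"
            using mult_right_mono[OF modval_bound[OF sb, of p] abs_ge_zero[of "e (?h p)"]]
            by (simp add: abs_mult mult.commute)
        qed
        also have "\<dots> \<le> D" using S by (intro D) auto
        finally show "norm (\<Sum>p\<in>S. e (?h p) * modval s p) \<le> D" .
      qed
    qed
    then show "norm (evm e s - (\<Sum>p\<in>F. e (?h p) * (\<Prod>j<fst p + snd p. ?L p j s))) \<le> D"
      by (simp only: pr)
  qed (use fin r \<delta> in \<open>auto simp: norm_triangle_ineq abs_mult mult.commute\<close>)
qed

lemma ev_balanced:
  assumes e: "mbound r (\<lambda>\<mu>. \<bar>e \<mu>\<bar>) R" and r: "0 < r" and z: "(z, w) \<in> bidisc r"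
    and bal: "\<And>\<mu>. e \<mu> \<noteq> 0 \<Longrightarrow> balanced \<mu>"
  shows "ev e (z, w) = of_real (evm e ((cmod z)\<^sup>2, (cmod w)\<^sup>2))"
proof (rule evI)
  let ?h = "\<lambda>p :: nat \<times> nat. Mono (fst p) (fst p) (snd p) (snd p)"
  let ?s = "((cmod z)\<^sup>2, (cmod w)\<^sup>2)"
  have s: "\<bar>fst ?s\<bar> \<le> r\<^sup>2" "\<bar>snd ?s\<bar> \<le> r\<^sup>2" using z by (auto intro: power_mono)
  have "((\<lambda>p. e (?h p) * modval ?s p) has_sum evm e ?s) UNIV"
    unfolding evm_def by (rule has_sum_infsum[OF abs_summable_summable[OF evm_abs_summable[OF e r s]]])
  then have 1: "((\<lambda>p. complex_of_real (e (?h p) * modval ?s p)) has_sum of_real (evm e ?s)) UNIV"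
    by (rule has_sum_of_real)
  have cc: "z ^ k * cnj z ^ k = complex_of_real (((cmod z)\<^sup>2) ^ k)" for z k
    unfolding power_mult_distrib[symmetric] complex_norm_square[symmetric] by simp
  have mv: "complex_of_real (e (?h p) * modval ?s p) = of_real (e (?h p)) * mval (z, w) (?h p)" for p
    using cc[of z "fst p"] cc[of w "snd p"] by (simp add: modval_def mult.assoc)
  have inj: "inj ?h" by (auto simp: inj_on_def prod_eq_iff)
  have "((\<lambda>\<mu>. of_real (e \<mu>) * mval (z, w) \<mu>) has_sum of_real (evm e ?s)) (range ?h)"
    unfolding has_sum_reindex[OF inj] o_def using 1 by (simp only: mv)
  moreover have "e \<mu> = 0" if "\<mu> \<notin> range ?h" for \<mu>
  proof (rule ccontr)
    assume "e \<mu> \<noteq> 0"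
    then have "balanced \<mu>" by (rule bal)
    then obtain i j where "\<mu> = ?h (i, j)" by (cases \<mu>) auto
    with that show False by blast
  qed
  ultimately show "((\<lambda>\<mu>. of_real (e \<mu>) * mval (z, w) \<mu>) has_sum of_real (evm e ?s)) UNIV"
    by (subst has_sum_cong_neutral[where T = "range ?h"]) auto
qed

lemma ev_line:
  assumes g: "abs_conv r g" and r: "0 \<le> r" and z: "z \<in> bidisc r" and h: "inj h"
    and sup: "\<And>\<mu>. g \<mu> \<noteq> 0 \<Longrightarrow> \<mu> \<in> range h"
  shows "(\<lambda>k :: nat. of_real (g (h k)) * mval z (h k)) sums ev g z"
proof -
  have "((\<lambda>\<mu>. of_real (g \<mu>) * mval z \<mu>) has_sum ev g z) (range h)"
    using ev_has_sum[OF g r z] by (subst has_sum_cong_neutral[where T = UNIV]) (use sup in auto)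
  then have "((\<lambda>k. of_real (g (h k)) * mval z (h k)) has_sum ev g z) UNIV"
    unfolding has_sum_reindex[OF h] o_def .
  then show ?thesis by (rule has_sum_imp_sums)
qed


subsection \<open>Series in one squared modulus\<close>

text \<open>For series supported on a one-parameter family of exponents: e = 0 for functions of one
  squared modulus, e = 1 for such a function times the variable.\<close>

lemma mbound_line:
  assumes c: "\<And>k. 0 \<le> c k" and inj: "inj_on idx {\<mu>. P \<mu>}"
    and dg: "\<And>\<mu>. P \<mu> \<Longrightarrow> deg \<mu> = 2 * idx \<mu> + e"
    and D: "\<And>A. finite A \<Longrightarrow> (\<Sum>k\<in>A. r ^ (2 * k) * c k) \<le> D" and r: "0 < r"
  shows "mbound r (\<lambda>\<mu>. if P \<mu> then c (idx \<mu>) else 0) (r ^ e * D)"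
  unfolding mbound_def
proof (intro conjI allI impI)
  show "0 \<le> (if P \<mu> then c (idx \<mu>) else 0)" for \<mu> using c by simp
  fix S :: "mono set" assume S: "finite S"
  let ?T = "{\<mu>\<in>S. P \<mu>}"
  have "(\<Sum>\<mu>\<in>S. r ^ deg \<mu> * (if P \<mu> then c (idx \<mu>) else 0)) = (\<Sum>\<mu>\<in>?T. r ^ deg \<mu> * c (idx \<mu>))"
    using S by (simp add: sum.inter_filter if_distrib cong: if_cong)
  also have "\<dots> = r ^ e * (\<Sum>\<mu>\<in>?T. r ^ (2 * idx \<mu>) * c (idx \<mu>))"
    unfolding sum_distrib_left using dg by (intro sum.cong) (auto simp: power_add mult_ac)
  also have "(\<Sum>\<mu>\<in>?T. r ^ (2 * idx \<mu>) * c (idx \<mu>)) = (\<Sum>k\<in>idx ` ?T. r ^ (2 * k) * c k)"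
    using inj by (subst sum.reindex) (auto simp: inj_on_def)
  also have "r ^ e * \<dots> \<le> r ^ e * D" using D S r by (intro mult_left_mono) auto
  finally show "(\<Sum>\<mu>\<in>S. r ^ deg \<mu> * (if P \<mu> then c (idx \<mu>) else 0)) \<le> r ^ e * D" .
qed

lemma mbound_diag:
  assumes D: "\<And>A. finite A \<Longrightarrow> (\<Sum>k\<in>A. r ^ (2 * k) * \<bar>t k\<bar>) \<le> D" and r: "0 < r"
  shows "mbound r (\<lambda>\<mu>. \<bar>diag1 t \<mu>\<bar>) D" "mbound r (\<lambda>\<mu>. \<bar>diag2 t \<mu>\<bar>) D"
proof -
  let ?P1 = "\<lambda>\<mu>. case \<mu> of Mono a b c d \<Rightarrow> a = b \<and> c = 0 \<and> d = 0" and ?i1 = "\<lambda>\<mu>. case \<mu> of Mono a b c d \<Rightarrow> a"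
  have "mbound r (\<lambda>\<mu>. if ?P1 \<mu> then \<bar>t (?i1 \<mu>)\<bar> else 0) (r ^ 0 * D)"
    by (rule mbound_line[OF _ _ _ D r]) (auto simp: inj_on_def split: mono.splits)
  moreover have "(\<lambda>\<mu>. if ?P1 \<mu> then \<bar>t (?i1 \<mu>)\<bar> else 0) = (\<lambda>\<mu>. \<bar>diag1 t \<mu>\<bar>)"
    by (auto simp: fun_eq_iff split: mono.splits)
  ultimately show "mbound r (\<lambda>\<mu>. \<bar>diag1 t \<mu>\<bar>) D" by simp
  let ?P2 = "\<lambda>\<mu>. case \<mu> of Mono a b c d \<Rightarrow> a = 0 \<and> b = 0 \<and> c = d" and ?i2 = "\<lambda>\<mu>. case \<mu> of Mono a b c d \<Rightarrow> c"
  have "mbound r (\<lambda>\<mu>. if ?P2 \<mu> then \<bar>t (?i2 \<mu>)\<bar> else 0) (r ^ 0 * D)"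
    by (rule mbound_line[OF _ _ _ D r]) (auto simp: inj_on_def split: mono.splits)
  moreover have "(\<lambda>\<mu>. if ?P2 \<mu> then \<bar>t (?i2 \<mu>)\<bar> else 0) = (\<lambda>\<mu>. \<bar>diag2 t \<mu>\<bar>)"
    by (auto simp: fun_eq_iff split: mono.splits)
  ultimately show "mbound r (\<lambda>\<mu>. \<bar>diag2 t \<mu>\<bar>) D" by simp
qed

lemma vbound_ray:
  assumes q: "\<And>k. q k \<in> le_space a"
    and D: "\<And>A. finite A \<Longrightarrow> (\<Sum>k\<in>A. r ^ (2 * k) * le_norm a (q k)) \<le> D" and r: "0 < r"
  shows "vbound r a (ray1 q) (r * D)" "vbound r a (ray2 q) (r * D)"
proof -
  let ?P1 = "\<lambda>\<mu>. case \<mu> of Mono a b c d \<Rightarrow> a = Suc b \<and> c = 0 \<and> d = 0" and ?i1 = "\<lambda>\<mu>. case \<mu> of Mono a b c d \<Rightarrow> b"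
  have "mbound r (\<lambda>\<mu>. if ?P1 \<mu> then le_norm a (q (?i1 \<mu>)) else 0) (r ^ 1 * D)"
    by (rule mbound_line[OF _ _ _ D r]) (auto simp: inj_on_def split: mono.splits)
  moreover have "(\<lambda>\<mu>. if ?P1 \<mu> then le_norm a (q (?i1 \<mu>)) else 0) = (\<lambda>\<mu>. le_norm a (ray1 q \<mu>))"
    by (auto simp: fun_eq_iff split: mono.splits)
  moreover have "ray1 q \<mu> \<in> le_space a" for \<mu> using q by (cases \<mu>) auto
  ultimately show "vbound r a (ray1 q) (r * D)" by (simp add: vbound_def)
  let ?P2 = "\<lambda>\<mu>. case \<mu> of Mono a b c d \<Rightarrow> a = 0 \<and> b = 0 \<and> c = Suc d" and ?i2 = "\<lambda>\<mu>. case \<mu> of Mono a b c d \<Rightarrow> d"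
  have "mbound r (\<lambda>\<mu>. if ?P2 \<mu> then le_norm a (q (?i2 \<mu>)) else 0) (r ^ 1 * D)"
    by (rule mbound_line[OF _ _ _ D r]) (auto simp: inj_on_def split: mono.splits)
  moreover have "(\<lambda>\<mu>. if ?P2 \<mu> then le_norm a (q (?i2 \<mu>)) else 0) = (\<lambda>\<mu>. le_norm a (ray2 q \<mu>))"
    by (auto simp: fun_eq_iff split: mono.splits)
  moreover have "ray2 q \<mu> \<in> le_space a" for \<mu> using q by (cases \<mu>) auto
  ultimately show "vbound r a (ray2 q) (r * D)" by (simp add: vbound_def)
qed

text \<open>The missing constant term yields a factor r^2 / R^2 against the sum at the fixed radius
  R. This makes the data small in r with a constant independent of r.\<close>

lemma power_series_tail:
  fixes c :: "nat \<Rightarrow> real"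
  assumes c: "\<And>k. 0 \<le> c k" "c 0 = 0" and s: "summable (\<lambda>k. c k * (R\<^sup>2) ^ k)" and r: "0 < r" "r \<le> R" and A: "finite A"
  shows "(\<Sum>k\<in>A. r ^ (2 * k) * c k) \<le> r\<^sup>2 * ((\<Sum>k. c k * (R\<^sup>2) ^ k) / R\<^sup>2)"
proof -
  have R: "0 < R" using r by simp
  have "(\<Sum>k\<in>A. r ^ (2 * k) * c k) \<le> (\<Sum>k\<in>A. r\<^sup>2 / R\<^sup>2 * (c k * (R\<^sup>2) ^ k))"
  proof (rule sum_mono)
    fix k
    show "r ^ (2 * k) * c k \<le> r\<^sup>2 / R\<^sup>2 * (c k * (R\<^sup>2) ^ k)"
    proof (cases k)
      case (Suc j)
      have "(r\<^sup>2) ^ j \<le> (R\<^sup>2) ^ j" using r by (intro power_mono) auto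
      then have "r\<^sup>2 * (r\<^sup>2) ^ j * c k \<le> r\<^sup>2 * (R\<^sup>2) ^ j * c k"
        using c by (intro mult_right_mono mult_left_mono) auto
      moreover have "r ^ (2 * k) = r\<^sup>2 * (r\<^sup>2) ^ j" by (simp only: Suc power_mult power_Suc)
      moreover have "r\<^sup>2 / R\<^sup>2 * (c k * (R\<^sup>2) ^ k) = r\<^sup>2 * (R\<^sup>2) ^ j * c k" using R by (simp add: Suc)
      ultimately show ?thesis by simp
    qed (use c in simp)
  qed
  also have "\<dots> = r\<^sup>2 / R\<^sup>2 * (\<Sum>k\<in>A. c k * (R\<^sup>2) ^ k)" by (simp add: sum_distrib_left)
  also have "\<dots> \<le> r\<^sup>2 / R\<^sup>2 * (\<Sum>k. c k * (R\<^sup>2) ^ k)"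
    using c A by (intro mult_left_mono sum_le_suminf[OF s]) auto
  finally show ?thesis by simp
qed

lemma modulus_power: "z ^ k * cnj z ^ k = complex_of_real (((cmod z)\<^sup>2) ^ k)"
  unfolding power_mult_distrib[symmetric] complex_norm_square[symmetric] by simp

lemma ev_line_sums:
  assumes g: "abs_conv r g" and r: "0 < r" and z: "z \<in> bidisc r" and h: "inj h"
    and sup: "\<And>\<mu>. g \<mu> \<noteq> 0 \<Longrightarrow> \<mu> \<in> range h"
    and trm: "\<And>k. of_real (g (h k)) * mval z (h k) = w * of_real (s ^ k * c k)"
    and v: "(\<lambda>k. s ^ k * c k) sums v"
  shows "ev g z = w * of_real v"
proof (rule sums_unique2)
  show "(\<lambda>k. of_real (g (h k)) * mval z (h k)) sums ev g z"
    using r by (intro ev_line[OF g _ z h sup]) auto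
  show "(\<lambda>k. of_real (g (h k)) * mval z (h k)) sums (w * of_real v)"
    unfolding trm by (intro sums_mult sums_of_real v)
qed

lemma ev_ray:
  assumes r: "0 < r" and z: "(z, w) \<in> bidisc r"
  shows "vbound r a (ray1 q) R \<Longrightarrow> 0 \<le> a \<Longrightarrow> (\<lambda>k. ((cmod z)\<^sup>2) ^ k * q k n) sums v \<Longrightarrow> evs (ray1 q) (z, w) n = z * of_real v"
    and "vbound r a (ray2 q) R \<Longrightarrow> 0 \<le> a \<Longrightarrow> (\<lambda>k. ((cmod w)\<^sup>2) ^ k * q k n) sums v \<Longrightarrow> evs (ray2 q) (z, w) n = w * of_real v"
proof -
  have r0: "0 \<le> r" using r by simp
  have sup: "ray1 q \<mu> n \<noteq> 0 \<Longrightarrow> \<mu> \<in> range (\<lambda>k. Mono (Suc k) k 0 0)"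
    "ray2 q \<mu> n \<noteq> 0 \<Longrightarrow> \<mu> \<in> range (\<lambda>k. Mono 0 0 (Suc k) k)" for \<mu>
    by (cases \<mu>; auto split: if_splits)+
  show "evs (ray1 q) (z, w) n = z * of_real v"
    if b: "vbound r a (ray1 q) R" "0 \<le> a" and v: "(\<lambda>k. ((cmod z)\<^sup>2) ^ k * q k n) sums v"
    unfolding evs_def using modulus_power[of z]
    by (intro ev_line_sums[OF vbound_abs_conv[OF b r0] r z _ sup(1) _ v]) (auto simp: inj_on_def mult_ac)
  show "evs (ray2 q) (z, w) n = w * of_real v"
    if b: "vbound r a (ray2 q) R" "0 \<le> a" and v: "(\<lambda>k. ((cmod w)\<^sup>2) ^ k * q k n) sums v"
    unfolding evs_def using modulus_power[of w]
    by (intro ev_line_sums[OF vbound_abs_conv[OF b r0] r z _ sup(2) _ v]) (auto simp: inj_on_def mult_ac)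
qed

lemma ev_diag:
  assumes r: "0 < r" and z: "(z, w) \<in> bidisc r"
  shows "abs_conv r (diag1 t) \<Longrightarrow> (\<lambda>k. ((cmod z)\<^sup>2) ^ k * t k) sums v \<Longrightarrow> ev (diag1 t) (z, w) = of_real v"
    and "abs_conv r (diag2 t) \<Longrightarrow> (\<lambda>k. ((cmod w)\<^sup>2) ^ k * t k) sums v \<Longrightarrow> ev (diag2 t) (z, w) = of_real v"
proof -
  have sup: "diag1 t \<mu> \<noteq> 0 \<Longrightarrow> \<mu> \<in> range (\<lambda>k. Mono k k 0 0)"
    "diag2 t \<mu> \<noteq> 0 \<Longrightarrow> \<mu> \<in> range (\<lambda>k. Mono 0 0 k k)" for \<mu>
    by (cases \<mu>; auto split: if_splits)+
  show "ev (diag1 t) (z, w) = of_real v" if b: "abs_conv r (diag1 t)" and v: "(\<lambda>k. ((cmod z)\<^sup>2) ^ k * t k) sums v"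
    using ev_line_sums[OF b r z _ sup(1) _ v, of 1] modulus_power[of z] by (auto simp: inj_on_def mult_ac)
  show "ev (diag2 t) (z, w) = of_real v" if b: "abs_conv r (diag2 t)" and v: "(\<lambda>k. ((cmod w)\<^sup>2) ^ k * t k) sums v"
    using ev_line_sums[OF b r z _ sup(2) _ v, of 1] modulus_power[of w] by (auto simp: inj_on_def mult_ac)
qed

lemma ev_mixed_axis:
  assumes "\<And>\<mu>. g \<mu> \<noteq> 0 \<Longrightarrow> mixed \<mu>" "z = 0 \<or> w = 0"
  shows "ev g (z, w) = 0"
proof -
  have "of_real (g \<mu>) * mval (z, w) \<mu> = 0" for \<mu>
    using assms(1)[of \<mu>] assms(2) by (cases \<mu>) (auto simp: power_0_left)
  then show ?thesis unfolding ev_def by (rule infsum_0)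
qed

lemma cmod_ev_le:
  assumes "\<And>S. finite S \<Longrightarrow> (\<Sum>\<mu>\<in>S. cmod (mval z \<mu>) * \<bar>g \<mu>\<bar>) \<le> D"
    and hs: "((\<lambda>\<mu>. of_real (g \<mu>) * mval z \<mu>) has_sum ev g z) UNIV"
  shows "cmod (ev g z) \<le> D"
proof (rule tendsto_upperbound[OF tendsto_norm[OF hs[unfolded has_sum_def]] _ finite_subsets_at_top_neq_bot])
  show "\<forall>\<^sub>F S in finite_subsets_at_top UNIV. norm (\<Sum>\<mu>\<in>S. of_real (g \<mu>) * mval z \<mu>) \<le> D"
  proof (rule eventually_finite_subsets_at_top_weakI)
    fix S :: "mono set" assume S: "finite S"
    have "norm (\<Sum>\<mu>\<in>S. of_real (g \<mu>) * mval z \<mu>) \<le> (\<Sum>\<mu>\<in>S. cmod (mval z \<mu>) * \<bar>g \<mu>\<bar>)"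
      by (intro sum_norm_le) (simp add: norm_mult mult.commute)
    with assms(1)[OF S] show "norm (\<Sum>\<mu>\<in>S. of_real (g \<mu>) * mval z \<mu>) \<le> D" by linarith
  qed
qed

section \<open>Phase rotations and time evolution\<close>

lemma mval_rotate:
  "mval (cis \<alpha> * z, cis \<beta> * w) \<mu> =
     cis (of_int (charge \<mu> - hindex \<mu>) * \<alpha> + of_int (hindex \<mu>) * \<beta>) * mval (z, w) \<mu>"
proof (cases \<mu>)
  case (Mono a b c d)
  have "mval (cis \<alpha> * z, cis \<beta> * w) \<mu> = (cis \<alpha> ^ a * cis (- \<alpha>) ^ b * cis \<beta> ^ c * cis (- \<beta>) ^ d) * mval (z, w) \<mu>"
    by (simp add: Mono power_mult_distrib cis_cnj mult_ac)
  also have "cis \<alpha> ^ a * cis (- \<alpha>) ^ b * cis \<beta> ^ c * cis (- \<beta>) ^ d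
      = cis (of_int (charge \<mu> - hindex \<mu>) * \<alpha> + of_int (hindex \<mu>) * \<beta>)"
    unfolding Complex.DeMoivre cis_mult Mono by (simp add: algebra_simps)
  finally show ?thesis .
qed

lemma evs_gauge:
  assumes "\<And>\<mu> n. f \<mu> n \<noteq> 0 \<Longrightarrow> charge \<mu> = 1"
  shows "evs f (cis \<theta> * z, cis \<theta> * w) n = cis \<theta> * evs f (z, w) n"
proof -
  have "of_real (f \<mu> n) * mval (cis \<theta> * z, cis \<theta> * w) \<mu> = cis \<theta> * (of_real (f \<mu> n) * mval (z, w) \<mu>)" for \<mu>
  proof (cases "f \<mu> n = 0")
    case False
    then have "charge \<mu> = 1" by (rule assms)
    then have "of_int (charge \<mu> - hindex \<mu>) * \<theta> + of_int (hindex \<mu>) * \<theta> = \<theta>"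
      by (simp add: algebra_simps)
    then show ?thesis by (simp only: mval_rotate mult.left_commute)
  qed simp
  then show ?thesis unfolding evs_def ev_def by (simp only: infsum_cmult_right')
qed

lemma cis_second_order: "cmod (cis x - 1 - \<i> * of_real x) \<le> x\<^sup>2"
proof -
  have "cmod (exp (\<i> * of_real x) - (\<Sum>k\<le>1. (\<i> * of_real x) ^ k / fact k)) \<le> exp \<bar>Re (\<i> * of_real x)\<bar> * cmod (\<i> * of_real x) ^ Suc 1 / fact 1"
    by (rule Taylor_exp)
  then show ?thesis by (simp add: cis_conv_exp norm_mult power2_eq_square diff_diff_eq)
qed

text \<open>The velocity is orthogonal to z, so the modulus is conserved before g is known to be
  constant. In the application g depends on time through moduli only, so the first claim supplies
  the hypothesis of the second.\<close>

lemma rotating_solution: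
  fixes z :: "real \<Rightarrow> complex" and g :: "real \<Rightarrow> real"
  assumes I: "is_interval I" and z: "\<And>t. t \<in> I \<Longrightarrow> (z has_vector_derivative - \<i> * (of_real (g t) * z t)) (at t)"
  shows "s \<in> I \<Longrightarrow> t \<in> I \<Longrightarrow> cmod (z s) = cmod (z t)"
    and "s \<in> I \<Longrightarrow> t \<in> I \<Longrightarrow> (\<And>u. u \<in> I \<Longrightarrow> g u = \<omega>) \<Longrightarrow> z s = cis (- \<omega> * (s - t)) * z t"
proof -
  have cv: "convex I" using I by (simp add: is_interval_convex_1)
  show "cmod (z s) = cmod (z t)" if st: "s \<in> I" "t \<in> I"
  proof -
    have "((\<lambda>u. z u \<bullet> z u) has_derivative (\<lambda>h. 0)) (at u within I)" if "u \<in> I" for u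
    proof -
      have d: "(z has_derivative (\<lambda>h. h *\<^sub>R (- \<i> * (of_real (g u) * z u)))) (at u within I)"
        using z[OF that] has_derivative_at_withinI unfolding has_vector_derivative_def by blast
      have "z u \<bullet> (\<i> * (of_real (g u) * z u)) = 0"
        by (simp add: inner_complex_def algebra_simps)
      then show ?thesis using has_derivative_inner[OF d d] by (simp add: inner_commute)
    qed
    then obtain c where "\<And>u. u \<in> I \<Longrightarrow> z u \<bullet> z u = c" using has_derivative_zero_constant[OF cv, of "\<lambda>u. z u \<bullet> z u"] by blast
    then have "z s \<bullet> z s = z t \<bullet> z t" using st by simp
    then show ?thesis by (simp add: norm_eq_sqrt_inner)
  qed
  show "z s = cis (- \<omega> * (s - t)) * z t" if st: "s \<in> I" "t \<in> I" and g: "\<And>u. u \<in> I \<Longrightarrow> g u = \<omega>"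
  proof -
    have "((\<lambda>u. exp (of_real u * (\<i> * of_real \<omega>)) * z u) has_derivative (\<lambda>h. 0)) (at u within I)" if u: "u \<in> I" for u
    proof -
      have dz: "(z has_vector_derivative - \<i> * (of_real \<omega> * z u)) (at u)" using z[OF u] by (simp add: g[OF u])
      have de: "((\<lambda>u. exp (of_real u * (\<i> * of_real \<omega>))) has_vector_derivative (exp (of_real u * (\<i> * of_real \<omega>)) * (\<i> * of_real \<omega>))) (at u)"
        using exp_scaleR_has_vector_derivative_right[of "\<i> * of_real \<omega>" u UNIV]
        by (simp add: scaleR_conv_of_real)
      have "((\<lambda>u. exp (of_real u * (\<i> * of_real \<omega>)) * z u) has_vector_derivative
         (exp (of_real u * (\<i> * of_real \<omega>)) * (- \<i> * (of_real \<omega> * z u)) + exp (of_real u * (\<i> * of_real \<omega>)) * (\<i> * of_real \<omega>) * z u)) (at u)"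
        by (rule has_vector_derivative_mult[OF de dz])
      then have "((\<lambda>u. exp (of_real u * (\<i> * of_real \<omega>)) * z u) has_vector_derivative 0) (at u)"
        by (simp add: algebra_simps)
      then have "((\<lambda>u. exp (of_real u * (\<i> * of_real \<omega>)) * z u) has_derivative (\<lambda>h. 0)) (at u)"
        by (simp add: has_vector_derivative_def)
      then show ?thesis by (rule has_derivative_at_withinI)
    qed
    then obtain c where "\<And>u. u \<in> I \<Longrightarrow> exp (of_real u * (\<i> * of_real \<omega>)) * z u = c"
      using has_derivative_zero_constant[OF cv, of "\<lambda>u. exp (of_real u * (\<i> * of_real \<omega>)) * z u"] by blast
    then have e: "cis (s * \<omega>) * z s = cis (t * \<omega>) * z t" using st by (simp add: cis_conv_exp mult.left_commute)
    have "z s = cis (- (s * \<omega>)) * (cis (s * \<omega>) * z s)" unfolding mult.assoc[symmetric] cis_mult by simp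
    also have "\<dots> = cis (- (s * \<omega>)) * (cis (t * \<omega>) * z t)" by (simp only: e)
    also have "\<dots> = cis (- \<omega> * (s - t)) * z t" unfolding mult.assoc[symmetric] cis_mult by (simp add: algebra_simps)
    finally show ?thesis .
  qed
qed

text \<open>The loss of two factors of the degree is absorbed by shrinking the polyradius.\<close>

lemma degree_loss:
  assumes "0 \<le> \<rho>" "\<rho> < (r::real)"
  obtains M where "\<And>k::nat. (1 + real k)\<^sup>2 * \<rho> ^ k \<le> M * r ^ k" "0 \<le> M"
proof -
  have r: "0 < r" using assms by simp
  \<comment> \<open>The square root distributes \<rho> / r over the two factors of the degree:
    \<open>(1 + real k) * y ^ k\<close> is bounded, and its square is the quantity in
    question.\<close>
  define y where "y = sqrt (\<rho> / r)"
  have y: "0 \<le> y" "y < 1" "y\<^sup>2 = \<rho> / r" using assms r by (auto simp: y_def)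
  have "(\<lambda>n. of_nat n * y ^ n + y ^ n) \<longlonglongrightarrow> 0 + 0"
    using y by (intro tendsto_add powser_times_n_limit_0 LIMSEQ_realpow_zero) auto
  then have "Bseq (\<lambda>n. real n * y ^ n + y ^ n)" by (intro convergent_imp_Bseq convergentI) auto
  then obtain B where B: "0 < B" "\<And>n. \<bar>real n * y ^ n + y ^ n\<bar> \<le> B" by (auto elim!: BseqE)
  show thesis
  proof (rule that[of "B\<^sup>2"])
    fix k :: nat
    have "0 \<le> (1 + real k) * y ^ k" using y by simp
    moreover have "(1 + real k) * y ^ k \<le> B" using B(2)[of k] by (simp add: distrib_right)
    ultimately have "((1 + real k) * y ^ k)\<^sup>2 \<le> B\<^sup>2" by (intro power_mono)
    moreover have "((1 + real k) * y ^ k)\<^sup>2 = (1 + real k)\<^sup>2 * (\<rho> ^ k / r ^ k)"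
      by (simp add: power_mult_distrib power_divide[symmetric] y(3)[symmetric] power_mult[symmetric] mult.commute)
    ultimately have "(1 + real k)\<^sup>2 * (\<rho> ^ k / r ^ k) \<le> B\<^sup>2" by simp
    then show "(1 + real k)\<^sup>2 * \<rho> ^ k \<le> B\<^sup>2 * r ^ k" using r by (simp add: pos_divide_le_eq)
  qed simp
qed

lemma hindex_le: "\<bar>real_of_int (hindex \<mu>)\<bar> \<le> real (deg \<mu>)"
  by (cases \<mu>) auto

text \<open>Along the orbit a monomial of charge 1 rotates with its own frequency
  \<open>\<Lambda> \<mu>\<close>, so the difference quotient minus the derivative is again a series,
  whose factors are of second order in the frequency and of first order in \<open>s - t\<close>.
  Frequencies grow at most linearly in the degree; the strict inequality between the moduli and r
  compensates their squares.\<close>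

lemma evs_has_l2_derivative:
  assumes C: "vbound r a C R" and a: "0 \<le> a" and r: "0 < r"
    and C1: "vbound r a (\<lambda>\<mu> n. (1 - of_int (hindex \<mu>)) * C \<mu> n) R1"
    and C2: "vbound r a (\<lambda>\<mu> n. of_int (hindex \<mu>) * C \<mu> n) R2"
    and charge: "\<And>\<mu> n. C \<mu> n \<noteq> 0 \<Longrightarrow> charge \<mu> = 1"
    and z: "cmod (z1 t) < r" "cmod (z2 t) < r" and I: "open I" "t \<in> I"
    and orbit: "\<And>s. s \<in> I \<Longrightarrow> z1 s = cis (- \<omega>1 * (s - t)) * z1 t \<and> z2 s = cis (- \<omega>2 * (s - t)) * z2 t"
  shows "has_l2_derivative (\<lambda>s. evs C (z1 s, z2 s))
     (\<lambda>n. - \<i> * (of_real \<omega>1 * evs (\<lambda>\<mu> n. (1 - of_int (hindex \<mu>)) * C \<mu> n) (z1 t, z2 t) n +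
        of_real \<omega>2 * evs (\<lambda>\<mu> n. of_int (hindex \<mu>) * C \<mu> n) (z1 t, z2 t) n)) t"
proof -
  let ?z = "(z1 t, z2 t)"
  let ?C1 = "\<lambda>\<mu> n. (1 - of_int (hindex \<mu>)) * C \<mu> n" and ?C2 = "\<lambda>\<mu> n. of_int (hindex \<mu>) * C \<mu> n"
  let ?D = "\<lambda>n. - \<i> * (of_real \<omega>1 * evs ?C1 ?z n + of_real \<omega>2 * evs ?C2 ?z n)"
  define \<Lambda> where "\<Lambda> \<mu> = (1 - of_int (hindex \<mu>)) * \<omega>1 + of_int (hindex \<mu>) * \<omega>2" for \<mu>
  define \<rho> where "\<rho> = max (cmod (z1 t)) (cmod (z2 t))"
  have \<rho>: "0 \<le> \<rho>" "\<rho> < r" using z by (auto simp: \<rho>_def le_max_iff_disj)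
  obtain M where M: "\<And>k::nat. (1 + real k)\<^sup>2 * \<rho> ^ k \<le> M * r ^ k" "0 \<le> M" by (rule degree_loss[OF \<rho>]) blast
  define W where "W = (\<bar>\<omega>1\<bar> + \<bar>\<omega>2\<bar>)\<^sup>2 * M"
  have \<Lambda>: "cmod (mval ?z \<mu>) * (\<Lambda> \<mu>)\<^sup>2 \<le> W * r ^ deg \<mu>" for \<mu>
  proof -
    have "\<bar>\<Lambda> \<mu>\<bar> \<le> \<bar>1 - of_int (hindex \<mu>)\<bar> * \<bar>\<omega>1\<bar> + \<bar>of_int (hindex \<mu>)\<bar> * \<bar>\<omega>2\<bar>"
      unfolding \<Lambda>_def by (rule order_trans[OF abs_triangle_ineq]) (simp add: abs_mult)
    also have "\<dots> \<le> (1 + real (deg \<mu>)) * \<bar>\<omega>1\<bar> + (1 + real (deg \<mu>)) * \<bar>\<omega>2\<bar>"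
      using hindex_le[of \<mu>] by (intro add_mono mult_right_mono) auto
    finally have "\<bar>\<Lambda> \<mu>\<bar> \<le> (1 + real (deg \<mu>)) * (\<bar>\<omega>1\<bar> + \<bar>\<omega>2\<bar>)" by (simp add: distrib_left)
    then have "\<bar>\<Lambda> \<mu>\<bar>\<^sup>2 \<le> ((1 + real (deg \<mu>)) * (\<bar>\<omega>1\<bar> + \<bar>\<omega>2\<bar>))\<^sup>2" by (intro power_mono) auto
    then have l: "(\<Lambda> \<mu>)\<^sup>2 \<le> (1 + real (deg \<mu>))\<^sup>2 * (\<bar>\<omega>1\<bar> + \<bar>\<omega>2\<bar>)\<^sup>2" by (simp add: power_mult_distrib)
    have "cmod (mval ?z \<mu>) \<le> \<rho> ^ deg \<mu>" by (rule cmod_mval_le) (auto simp: \<rho>_def)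
    then have "cmod (mval ?z \<mu>) * (\<Lambda> \<mu>)\<^sup>2 \<le> \<rho> ^ deg \<mu> * ((1 + real (deg \<mu>))\<^sup>2 * (\<bar>\<omega>1\<bar> + \<bar>\<omega>2\<bar>)\<^sup>2)"
      using l \<rho> by (intro mult_mono) auto
    also have "\<dots> = (\<bar>\<omega>1\<bar> + \<bar>\<omega>2\<bar>)\<^sup>2 * ((1 + real (deg \<mu>))\<^sup>2 * \<rho> ^ deg \<mu>)" by (simp add: mult_ac)
    also have "\<dots> \<le> (\<bar>\<omega>1\<bar> + \<bar>\<omega>2\<bar>)\<^sup>2 * (M * r ^ deg \<mu>)" using M(1) by (intro mult_left_mono) auto
    finally show ?thesis by (simp add: W_def mult_ac)
  qed
  have zb: "?z \<in> bidisc r" using z by auto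
  have r0: "0 \<le> r" using r by simp
  have Dl2: "?D \<in> l2_space"
  proof -
    note s1 = le_space_mono(1)[OF evs_le_space[OF C1 r a zb] a] and s2 = le_space_mono(1)[OF evs_le_space[OF C2 r a zb] a]
    have "(\<lambda>n. of_real \<omega>1 * evs ?C1 ?z n + of_real \<omega>2 * evs ?C2 ?z n) \<in> l2_space"
      by (intro le_space_add(1) le_space_mult(1)[OF s1, of "\<lambda>_. of_real \<omega>1"] le_space_mult(1)[OF s2, of "\<lambda>_. of_real \<omega>2"]) auto
    from le_space_mult(1)[OF this, of "\<lambda>_. - \<i>" 1] show ?thesis by simp
  qed
  have Cs: "C \<mu> \<in> le_space a" for \<mu> using C by (simp add: vbound_def)
  have Cm: "mbound r (\<lambda>\<mu>. le_norm a (C \<mu>)) R" using C by (simp add: vbound_def)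
  have est: "l2_norm ((1 / (s - t)) *\<^sub>R (evs C (z1 s, z2 s) - evs C ?z) - ?D) \<le> W * R * \<bar>s - t\<bar>"
    if s: "s \<in> I" "s \<noteq> t" for s
  proof -
    define x where "x = s - t"
    have x: "x \<noteq> 0" using s(2) by (simp add: x_def)
    \<comment> \<open>The error of the difference quotient for one monomial, so that the total error
      is the series with coefficients \<open>C \<mu>\<close> and these values.\<close>
    define k where "k \<mu> = mval ?z \<mu> * ((cis (- \<Lambda> \<mu> * x) - 1) / of_real x + \<i> * of_real (\<Lambda> \<mu>))" for \<mu>
    have zs: "(z1 s, z2 s) = (cis (- \<omega>1 * x) * z1 t, cis (- \<omega>2 * x) * z2 t)" using orbit[OF s(1)] by (simp add: x_def)
    have sb: "(z1 s, z2 s) \<in> bidisc r" using zb unfolding zs by (simp add: norm_mult)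
    have hs: "((\<lambda>\<mu>. of_real (C \<mu> n) * k \<mu>) has_sum (((1 / (s - t)) *\<^sub>R (evs C (z1 s, z2 s) - evs C ?z) - ?D) n)) UNIV" for n
    proof -
      note h0 = ev_has_sum[OF vbound_abs_conv[OF C a r0, of n] r0 zb] and hs' = ev_has_sum[OF vbound_abs_conv[OF C a r0, of n] r0 sb]
      note h1 = ev_has_sum[OF vbound_abs_conv[OF C1 a r0, of n] r0 zb] and h2 = ev_has_sum[OF vbound_abs_conv[OF C2 a r0, of n] r0 zb]
      have "((\<lambda>\<mu>. (1 / of_real x) * (of_real (C \<mu> n) * mval (z1 s, z2 s) \<mu> + - (of_real (C \<mu> n) * mval ?z \<mu>))
          + (\<i> * of_real \<omega>1 * (of_real (?C1 \<mu> n) * mval ?z \<mu>) + \<i> * of_real \<omega>2 * (of_real (?C2 \<mu> n) * mval ?z \<mu>)))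
          has_sum ((1 / of_real x) * (evs C (z1 s, z2 s) n + - evs C ?z n)
          + (\<i> * of_real \<omega>1 * evs ?C1 ?z n + \<i> * of_real \<omega>2 * evs ?C2 ?z n))) UNIV"
        unfolding evs_def
        by (intro has_sum_add has_sum_cmult_right hs' h1 h2 has_sum_uminus[THEN iffD2]) (use h0 in simp)
      moreover have "(1 / of_real x) * (of_real (C \<mu> n) * mval (z1 s, z2 s) \<mu> + - (of_real (C \<mu> n) * mval ?z \<mu>))
          + (\<i> * of_real \<omega>1 * (of_real (?C1 \<mu> n) * mval ?z \<mu>) + \<i> * of_real \<omega>2 * (of_real (?C2 \<mu> n) * mval ?z \<mu>))
          = of_real (C \<mu> n) * k \<mu>" for \<mu>
      proof (cases "C \<mu> n = 0")
        case False
        then have "charge \<mu> = 1" by (rule charge)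
        then have "mval (z1 s, z2 s) \<mu> = cis (- \<Lambda> \<mu> * x) * mval ?z \<mu>"
          unfolding zs mval_rotate by (simp add: \<Lambda>_def algebra_simps)
        then show ?thesis by (simp add: k_def \<Lambda>_def algebra_simps diff_divide_distrib)
      qed simp
      moreover have "((1 / (s - t)) *\<^sub>R (evs C (z1 s, z2 s) - evs C ?z) - ?D) n
          = (1 / of_real x) * (evs C (z1 s, z2 s) n + - evs C ?z n)
          + (\<i> * of_real \<omega>1 * evs ?C1 ?z n + \<i> * of_real \<omega>2 * evs ?C2 ?z n)"
        by (simp add: x_def scaleR_conv_of_real algebra_simps)
      ultimately show ?thesis by simp
    qed
    have kb: "cmod (k \<mu>) \<le> W * r ^ deg \<mu> * \<bar>x\<bar>" for \<mu>
    proof -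
      have "k \<mu> = mval ?z \<mu> * ((cis (- \<Lambda> \<mu> * x) - 1 - \<i> * of_real (- \<Lambda> \<mu> * x)) / of_real x)"
        using x by (simp add: k_def field_simps)
      then have "cmod (k \<mu>) = cmod (mval ?z \<mu>) * (cmod (cis (- \<Lambda> \<mu> * x) - 1 - \<i> * of_real (- \<Lambda> \<mu> * x)) / \<bar>x\<bar>)"
        by (simp only: norm_mult norm_divide norm_of_real)
      also have "\<dots> \<le> cmod (mval ?z \<mu>) * ((- \<Lambda> \<mu> * x)\<^sup>2 / \<bar>x\<bar>)"
        using cis_second_order[of "- \<Lambda> \<mu> * x"] by (intro mult_left_mono divide_right_mono) auto
      also have "(- \<Lambda> \<mu> * x)\<^sup>2 / \<bar>x\<bar> = (\<Lambda> \<mu>)\<^sup>2 * \<bar>x\<bar>"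
        using x by (simp add: power2_eq_square field_simps abs_if)
      also have "cmod (mval ?z \<mu>) * ((\<Lambda> \<mu>)\<^sup>2 * \<bar>x\<bar>) \<le> W * r ^ deg \<mu> * \<bar>x\<bar>"
        using mult_right_mono[OF \<Lambda>[of \<mu>], of "\<bar>x\<bar>"] by (simp add: mult.assoc)
      finally show ?thesis .
    qed
    have W: "0 \<le> W" using M(2) by (simp add: W_def)
    have bd: "(\<Sum>\<mu>\<in>S. le_norm a (\<lambda>n. of_real (C \<mu> n) * k \<mu>)) \<le> W * R * \<bar>x\<bar>" if "finite S" for S
    proof -
      have "(\<Sum>\<mu>\<in>S. le_norm a (\<lambda>n. of_real (C \<mu> n) * k \<mu>)) \<le> (\<Sum>\<mu>\<in>S. cmod (k \<mu>) * le_norm a (C \<mu>))"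
        by (intro sum_mono series_term_bound(2) Cs)
      also have "\<dots> \<le> (\<Sum>\<mu>\<in>S. (W * \<bar>x\<bar>) * (r ^ deg \<mu> * le_norm a (C \<mu>)))"
      proof (rule sum_mono)
        fix \<mu>
        show "cmod (k \<mu>) * le_norm a (C \<mu>) \<le> (W * \<bar>x\<bar>) * (r ^ deg \<mu> * le_norm a (C \<mu>))"
          using mult_right_mono[OF kb[of \<mu>] le_norm_nonneg[of a "C \<mu>"]] by (simp add: mult_ac)
      qed
      also have "\<dots> \<le> (W * \<bar>x\<bar>) * R"
        unfolding sum_distrib_left[symmetric] using mboundD(2)[OF Cm that] W by (intro mult_left_mono) auto
      finally show ?thesis by (simp add: mult_ac)
    qed
    have "(1 / (s - t)) *\<^sub>R (evs C (z1 s, z2 s) - evs C ?z) - ?D \<in> le_space a"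
      "le_norm a ((1 / (s - t)) *\<^sub>R (evs C (z1 s, z2 s) - evs C ?z) - ?D) \<le> W * R * \<bar>x\<bar>"
      by (rule le_space_has_sum[OF series_term_bound(1)[OF Cs] hs], use bd in blast)+
    then show ?thesis using le_space_mono(2)[OF _ a] unfolding x_def by (meson order_trans)
  qed
  have ev: "\<forall>\<^sub>F s in at t. s \<in> I \<and> s \<noteq> t"
    using eventually_at_topological I by blast
  have lim: "((\<lambda>s. W * R * \<bar>s - t\<bar>) \<longlongrightarrow> 0) (at t)"
    by (rule tendsto_eq_intros refl | simp)+
  have "((\<lambda>s. l2_norm ((1 / (s - t)) *\<^sub>R (evs C (z1 s, z2 s) - evs C ?z) - ?D)) \<longlongrightarrow> 0) (at t)"
  proof (rule tendsto_sandwich[OF _ _ tendsto_const lim])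
    show "\<forall>\<^sub>F s in at t. 0 \<le> l2_norm ((1 / (s - t)) *\<^sub>R (evs C (z1 s, z2 s) - evs C ?z) - ?D)" by simp
    show "\<forall>\<^sub>F s in at t. l2_norm ((1 / (s - t)) *\<^sub>R (evs C (z1 s, z2 s) - evs C ?z) - ?D) \<le> W * R * \<bar>s - t\<bar>"
      using ev by eventually_elim (use est in blast)
  qed
  then show ?thesis unfolding has_l2_derivative_def using Dl2 by simp
qed


section \<open>The quasi-periodic solutions\<close>

lemma schroedinger_add: "schroedinger V (\<lambda>n. u n + v n) n = schroedinger V u n + schroedinger V v n"
  by (simp add: schroedinger_def lap_def scaleR_right_distrib algebra_simps)

lemma bound_state_zero [simp]: "bound_state \<phi> q 0 n = 0"
  by (simp add: bound_state_def)

lemma ev_uminus: "ev (\<lambda>\<mu>. - g \<mu>) z = - ev g z"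
  by (simp add: ev_def infsum_uminus)

lemma vbound_mono: "vbound r a f A \<Longrightarrow> A \<le> A' \<Longrightarrow> 0 \<le> r \<Longrightarrow> vbound r a f A'"
  unfolding vbound_def by (auto intro: mbound_mono simp: mboundD)

text \<open>Everything is compared with the larger of x and y: its n-th power is one of the two
  summands, and its k-th power is at most that of r.\<close>

lemma power_split_bound:
  fixes x y r :: real
  assumes x: "0 \<le> x" "x \<le> r" and y: "0 \<le> y" "y \<le> r" and AB: "A + B = n + k"
  shows "x ^ A * y ^ B \<le> (x ^ n + y ^ n) * r ^ k"
proof -
  define m where "m = max x y"
  have m: "0 \<le> m" "m \<le> r" "x \<le> m" "y \<le> m" using x y by (auto simp: m_def)
  have "x ^ A * y ^ B \<le> m ^ A * m ^ B" using x y m by (intro mult_mono power_mono) auto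
  also have "\<dots> = m ^ n * m ^ k" using AB by (simp flip: power_add)
  also have "\<dots> \<le> (x ^ n + y ^ n) * r ^ k"
    using m x y by (intro mult_mono power_mono) (auto simp: m_def max_def)
  finally show ?thesis .
qed

lemma bound_state_series:
  assumes fam: "bound_state_family V e \<phi> a \<delta> et q" and a: "0 \<le> a" and \<delta>: "0 < \<delta>"
  obtains t Q where "t 0 = 0" "Q 0 = (\<lambda>n. 0)" "\<And>k. Q k \<in> le_space a"
    "\<And>\<rho>. 0 \<le> \<rho> \<Longrightarrow> \<rho> < \<delta>\<^sup>2 \<Longrightarrow> summable (\<lambda>k. \<bar>t k\<bar> * \<rho> ^ k)"
    "\<And>\<rho>. 0 \<le> \<rho> \<Longrightarrow> \<rho> < \<delta>\<^sup>2 \<Longrightarrow> summable (\<lambda>k. le_norm a (Q k) * \<rho> ^ k)"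
    "\<And>s. \<bar>s\<bar> < \<delta>\<^sup>2 \<Longrightarrow> (\<lambda>k. s ^ k * t k) sums et s"
    "\<And>s n. \<bar>s\<bar> < \<delta>\<^sup>2 \<Longrightarrow> (\<lambda>k. s ^ k * Q k n) sums q s n"
proof -
  have anet: "analytic_on_ball UNIV norm (\<delta>\<^sup>2) et" and anq: "analytic_on_ball (le_space a) (le_norm a) (\<delta>\<^sup>2) q"
    using fam by (simp_all add: bound_state_family_def)
  obtain C where C: "\<And>z. z \<in> ball 0 \<delta> \<Longrightarrow> \<bar>et ((cmod z)\<^sup>2)\<bar> + le_norm a (q ((cmod z)\<^sup>2)) \<le> C * cmod z ^ 6"
    using fam unfolding bound_state_family_def by blast
  \<comment> \<open>At z = 0 the estimate by \<open>C * cmod z ^ 6\<close> makes both corrections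
    vanish, whence the zero coefficients \<open>t 0\<close> and \<open>Q 0\<close>.\<close>
  have "\<bar>et 0\<bar> + le_norm a (q 0) \<le> 0" using C[of 0] \<delta> by simp
  then have et0: "et 0 = 0" and q0: "le_norm a (q 0) \<le> 0" using le_norm_nonneg[of a "q 0"] by linarith+
  obtain t where t: "\<And>\<rho>. 0 \<le> \<rho> \<Longrightarrow> \<rho> < \<delta>\<^sup>2 \<Longrightarrow> summable (\<lambda>k. norm (t k) * \<rho> ^ k)"
    "\<And>s. \<bar>s\<bar> < \<delta>\<^sup>2 \<Longrightarrow> et s \<in> UNIV \<and> (\<lambda>m. norm (et s - (\<Sum>k<m. s ^ k *\<^sub>R t k))) \<longlonglongrightarrow> 0"
    by (rule analytic_coefficients[OF anet]) auto
  obtain Q where Q: "\<And>k. Q k \<in> le_space a" "\<And>\<rho>. 0 \<le> \<rho> \<Longrightarrow> \<rho> < \<delta>\<^sup>2 \<Longrightarrow> summable (\<lambda>k. le_norm a (Q k) * \<rho> ^ k)"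
    "\<And>s. \<bar>s\<bar> < \<delta>\<^sup>2 \<Longrightarrow> q s \<in> le_space a \<and> (\<lambda>m. le_norm a (q s - (\<Sum>k<m. s ^ k *\<^sub>R Q k))) \<longlonglongrightarrow> 0"
    by (rule analytic_coefficients[OF anq le_norm_nonneg]) blast
  have ts: "(\<lambda>k. s ^ k * t k) sums et s" if "\<bar>s\<bar> < \<delta>\<^sup>2" for s
  proof -
    have "(\<lambda>m. et s - (\<Sum>k<m. s ^ k * t k)) \<longlonglongrightarrow> 0" using t(2)[OF that] by (intro tendsto_norm_zero_cancel[where f = "\<lambda>m. et s - (\<Sum>k<m. s ^ k * t k)"]) simp
    from tendsto_diff[OF tendsto_const[of "et s"] this] show ?thesis by (simp add: sums_def)
  qed
  have Qs: "(\<lambda>k. s ^ k * Q k n) sums q s n" if s: "\<bar>s\<bar> < \<delta>\<^sup>2" for s n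
  proof -
    have ap: "(\<Sum>k<m. s ^ k *\<^sub>R Q k) = (\<lambda>n. \<Sum>k<m. s ^ k * Q k n)" for m
      by (induction m) (auto simp: fun_eq_iff)
    have mem: "(\<lambda>n. q s n - (\<Sum>k<m. s ^ k * Q k n)) \<in> le_space a" for m
    proof (rule le_space_diff(1))
      show "q s \<in> le_space a" using Q(3)[OF s] by simp
      have "(\<lambda>n. s ^ k * Q k n) \<in> le_space a" for k
        using le_space_scaleR(1)[OF Q(1)[of k], of "s ^ k"] by simp
      then show "(\<lambda>n. \<Sum>k<m. s ^ k * Q k n) \<in> le_space a"
        using le_space_sum[of "{..<m}" "\<lambda>k n. s ^ k * Q k n" a] by blast
    qed
    have lim: "(\<lambda>m. le_norm a (\<lambda>n. q s n - (\<Sum>k<m. s ^ k * Q k n))) \<longlonglongrightarrow> 0"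
    proof -
      have "q s - (\<Sum>k<m. s ^ k *\<^sub>R Q k) = (\<lambda>n. q s n - (\<Sum>k<m. s ^ k * Q k n))" for m
        by (auto simp: fun_eq_iff ap)
      then show ?thesis using Q(3)[OF s] by simp
    qed
    have "(\<lambda>m. q s n - (\<Sum>k<m. s ^ k * Q k n)) \<longlonglongrightarrow> 0"
      by (rule Lim_null_comparison[OF always_eventually lim]) (use norm_le_le_norm'[OF mem a] in blast)
    from tendsto_diff[OF tendsto_const[of "q s n"] this] show ?thesis by (simp add: sums_def)
  qed
  show thesis
  proof (rule that[of t Q])
    have z: "(\<lambda>k. 0 ^ k * g k) sums g 0" for g :: "nat \<Rightarrow> real"
      using sums_single[of 0 g] by (rule sums_cong[THEN iffD1, rotated]) (simp add: power_0_left)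
    have "(\<lambda>k. 0 ^ k * t k) sums t 0" by (rule z)
    then show "t 0 = 0" using ts[of 0] et0 \<delta> sums_unique2 by fastforce
    show "Q 0 = (\<lambda>n. 0)"
    proof
      fix n
      have "(\<lambda>k. 0 ^ k * Q k n) sums Q 0 n" by (rule z)
      moreover have "(\<lambda>k. 0 ^ k * Q k n) sums q 0 n" using Qs[of 0] \<delta> by simp
      moreover have "q 0 n = 0" using le_norm_eq_0D[OF _ q0] Q(3)[of 0] \<delta> by simp
      ultimately show "Q 0 n = 0" using sums_unique2 by fastforce
    qed
  qed (use Q t ts Qs in auto)
qed

text \<open>Connects the coefficient sequences with the given functions. The squared moduli range up
  to \<open>r\<^sup>2\<close> inclusive, in accordance with the closed
  \<open>bidisc\<close>.\<close>

locale two_mode_family = two_mode +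
  fixes et1 et2 :: "real \<Rightarrow> real" and Q1 Q2 :: "real \<Rightarrow> int \<Rightarrow> real"
  assumes et: "\<And>s. \<bar>s\<bar> \<le> r\<^sup>2 \<Longrightarrow> (\<lambda>k. s ^ k * t1 k) sums et1 s" "\<And>s. \<bar>s\<bar> \<le> r\<^sup>2 \<Longrightarrow> (\<lambda>k. s ^ k * t2 k) sums et2 s"
    and Q: "\<And>s n. \<bar>s\<bar> \<le> r\<^sup>2 \<Longrightarrow> (\<lambda>k. s ^ k * q1 k n) sums Q1 s n" "\<And>s n. \<bar>s\<bar> \<le> r\<^sup>2 \<Longrightarrow> (\<lambda>k. s ^ k * q2 k n) sums Q2 s n"
    and state1: "\<And>z n. cmod z \<le> r \<Longrightarrow> schroedinger V (bound_state \<phi>1 Q1 z) n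
      - of_real (e1 + et1 ((cmod z)\<^sup>2)) * bound_state \<phi>1 Q1 z n
      + of_real (cmod (bound_state \<phi>1 Q1 z n) ^ 6) * bound_state \<phi>1 Q1 z n = 0"
    and state2: "\<And>z n. cmod z \<le> r \<Longrightarrow> schroedinger V (bound_state \<phi>2 Q2 z) n
      - of_real (e2 + et2 ((cmod z)\<^sup>2)) * bound_state \<phi>2 Q2 z n
      + of_real (cmod (bound_state \<phi>2 Q2 z n) ^ 6) * bound_state \<phi>2 Q2 z n = 0"
begin

lemma modulus_le: "cmod z \<le> r \<Longrightarrow> \<bar>(cmod z)\<^sup>2\<bar> \<le> r\<^sup>2"
  by (simp add: power_mono)

lemma evs_state:
  assumes z: "(x, y) \<in> bidisc r"
  shows "evs (ray1 (q1(0 := \<phi>1))) (x, y) n = bound_state \<phi>1 Q1 x n"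
    "evs (ray2 (q2(0 := \<phi>2))) (x, y) n = bound_state \<phi>2 Q2 y n"
proof -
  have sm: "(\<lambda>k. s ^ k * (q(0 := \<phi>)) k n) sums (\<phi> n + v)"
    if "(\<lambda>k. s ^ k * q k n) sums v" "q 0 = (\<lambda>n. 0)" for s v and q :: "nat \<Rightarrow> int \<Rightarrow> real" and \<phi>
  proof -
    have "(\<lambda>k. (if k = 0 then \<phi> n else 0) + s ^ k * q k n) sums (\<phi> n + v)"
      by (intro sums_add that(1)) (use sums_single[of 0 "\<lambda>_. \<phi> n"] in simp)
    moreover have "(if k = 0 then \<phi> n else 0) + s ^ k * q k n = s ^ k * (q(0 := \<phi>)) k n" for k
      using that(2) by auto
    ultimately show ?thesis by simp
  qed
  have a0: "0 \<le> a" using a by simp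
  have m: "\<bar>(cmod x)\<^sup>2\<bar> \<le> r\<^sup>2" "\<bar>(cmod y)\<^sup>2\<bar> \<le> r\<^sup>2" using z modulus_le by auto
  show "evs (ray1 (q1(0 := \<phi>1))) (x, y) n = bound_state \<phi>1 Q1 x n"
    unfolding bound_state_def by (rule ev_ray(1)[OF r(1) z ray_bd(1) a0 sm[OF Q(1)[OF m(1)] zero(3)]])
  show "evs (ray2 (q2(0 := \<phi>2))) (x, y) n = bound_state \<phi>2 Q2 y n"
    unfolding bound_state_def by (rule ev_ray(2)[OF r(1) z ray_bd(2) a0 sm[OF Q(2)[OF m(2)] zero(4)]])
qed

text \<open>The z1-ray has \<open>hindex\<close> 0 and the z2-ray has \<open>hindex\<close> 1. Hence
  the factor \<open>1 - hindex\<close> keeps the first bound state and kills the second, and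
  \<open>hindex\<close> does the opposite. These two series are what the frequencies multiply in the
  time derivative.\<close>

lemma evs_profile:
  assumes X: "invar (\<psi>, \<epsilon>1, \<epsilon>2)" and z: "(x, y) \<in> bidisc r"
  shows "evs (profile \<psi>) (x, y) n = bound_state \<phi>1 Q1 x n + bound_state \<phi>2 Q2 y n + evs \<psi> (x, y) n"
    "evs (\<lambda>\<mu> n. (1 - of_int (hindex \<mu>)) * profile \<psi> \<mu> n) (x, y) n
      = bound_state \<phi>1 Q1 x n + evs (\<lambda>\<mu> n. (1 - of_int (hindex \<mu>)) * \<psi> \<mu> n) (x, y) n"
    "evs (\<lambda>\<mu> n. of_int (hindex \<mu>) * profile \<psi> \<mu> n) (x, y) n
      = bound_state \<phi>2 Q2 y n + evs (\<lambda>\<mu> n. of_int (hindex \<mu>) * \<psi> \<mu> n) (x, y) n"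
    "vbound r a (\<lambda>\<mu> n. (1 - of_int (hindex \<mu>)) * profile \<psi> \<mu> n) (B * r + r\<^sup>2)"
    "vbound r a (\<lambda>\<mu> n. of_int (hindex \<mu>) * profile \<psi> \<mu> n) (B * r + r\<^sup>2)"
proof -
  have r0: "0 \<le> r" and a0: "0 \<le> a" using r a by auto
  note ib = inv_psi_bound[OF X]
  note ac = vbound_abs_conv[OF _ a0 r0, of _ _ n]
  note st = evs_state[OF z, unfolded evs_def, symmetric]
  show "evs (profile \<psi>) (x, y) n = bound_state \<phi>1 Q1 x n + bound_state \<phi>2 Q2 y n + evs \<psi> (x, y) n"
    unfolding evs_def st profile_def
    by (simp only: ev_add[OF _ _ r0 z] abs_conv_add[OF _ _ r0] ac[OF ray_bd(1)] ac[OF ray_bd(2)] ac[OF ib(1)])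
  have e1: "(\<lambda>\<mu> n. (1 - of_int (hindex \<mu>)) * profile \<psi> \<mu> n)
      = (\<lambda>\<mu> n. ray1 (q1(0 := \<phi>1)) \<mu> n + (1 - of_int (hindex \<mu>)) * \<psi> \<mu> n)"
  proof (intro ext)
    fix \<mu> n
    show "(1 - of_int (hindex \<mu>)) * profile \<psi> \<mu> n = ray1 (q1(0 := \<phi>1)) \<mu> n + (1 - of_int (hindex \<mu>)) * \<psi> \<mu> n"
      by (cases \<mu>) (auto simp: profile_def algebra_simps)
  qed
  have e2: "(\<lambda>\<mu> n. of_int (hindex \<mu>) * profile \<psi> \<mu> n)
      = (\<lambda>\<mu> n. ray2 (q2(0 := \<phi>2)) \<mu> n + of_int (hindex \<mu>) * \<psi> \<mu> n)"
  proof (intro ext)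
    fix \<mu> n
    show "of_int (hindex \<mu>) * profile \<psi> \<mu> n = ray2 (q2(0 := \<phi>2)) \<mu> n + of_int (hindex \<mu>) * \<psi> \<mu> n"
      by (cases \<mu>) (auto simp: profile_def algebra_simps)
  qed
  show "evs (\<lambda>\<mu> n. (1 - of_int (hindex \<mu>)) * profile \<psi> \<mu> n) (x, y) n
      = bound_state \<phi>1 Q1 x n + evs (\<lambda>\<mu> n. (1 - of_int (hindex \<mu>)) * \<psi> \<mu> n) (x, y) n"
    unfolding e1 evs_def st by (rule ev_add[OF ac[OF ray_bd(1)] ac[OF ib(2)] r0 z])
  show "evs (\<lambda>\<mu> n. of_int (hindex \<mu>) * profile \<psi> \<mu> n) (x, y) n
      = bound_state \<phi>2 Q2 y n + evs (\<lambda>\<mu> n. of_int (hindex \<mu>) * \<psi> \<mu> n) (x, y) n"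
    unfolding e2 evs_def st by (rule ev_add[OF ac[OF ray_bd(2)] ac[OF ib(3)] r0 z])
  show "vbound r a (\<lambda>\<mu> n. (1 - of_int (hindex \<mu>)) * profile \<psi> \<mu> n) (B * r + r\<^sup>2)"
    unfolding e1 by (rule vbound_add[OF ray_bd(1) ib(2) r0])
  show "vbound r a (\<lambda>\<mu> n. of_int (hindex \<mu>) * profile \<psi> \<mu> n) (B * r + r\<^sup>2)"
    unfolding e2 by (rule vbound_add[OF ray_bd(2) ib(3) r0])
qed

lemma evs_psi_axis:
  assumes X: "invar (\<psi>, \<epsilon>1, \<epsilon>2)" and "x = 0 \<or> y = 0"
  shows "evs \<psi> (x, y) n = 0"
  unfolding evs_def using X assms(2) by (intro ev_mixed_axis) (auto simp: admissible_def)

abbreviation "nonl w \<equiv> complex_of_real (cmod w ^ 6) * w"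

text \<open>On the axes \<psi> vanishes and the profile is a single bound state, so cutting off the
  non-mixed monomials subtracts the nonlinearity of each bound state; the origin contributes
  0.\<close>

lemma ev_rhs:
  assumes X: "invar (\<psi>, \<epsilon>1, \<epsilon>2)" and z: "(x, y) \<in> bidisc r"
  shows "ev (\<lambda>\<mu>. rhs (\<psi>, \<epsilon>1, \<epsilon>2) \<mu> n) (x, y) =
     ev \<epsilon>1 (x, y) * (x * of_real (Q1 ((cmod x)\<^sup>2) n)) + ev \<epsilon>2 (x, y) * (y * of_real (Q2 ((cmod y)\<^sup>2) n))
     + (of_real (et1 ((cmod x)\<^sup>2)) + ev \<epsilon>1 (x, y)) * evs (\<lambda>\<mu> n. (1 - of_int (hindex \<mu>)) * \<psi> \<mu> n) (x, y) n
     + (of_real (et2 ((cmod y)\<^sup>2)) + ev \<epsilon>2 (x, y)) * evs (\<lambda>\<mu> n. of_int (hindex \<mu>) * \<psi> \<mu> n) (x, y) n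
     - nonl (evs (profile \<psi>) (x, y) n) + nonl (bound_state \<phi>1 Q1 x n) + nonl (bound_state \<phi>2 Q2 y n)"
proof -
  have r0: "0 \<le> r" and a0: "0 \<le> a" using r a by auto
  note ib = inv_psi_bound[OF X]
  note ac = vbound_abs_conv[OF _ a0 r0, of _ _ n]
  have m: "\<bar>(cmod x)\<^sup>2\<bar> \<le> r\<^sup>2" "\<bar>(cmod y)\<^sup>2\<bar> \<le> r\<^sup>2" using z modulus_le by auto
  have ce: "abs_conv r \<epsilon>1" "abs_conv r \<epsilon>2" "abs_conv r (diag1 t1)" "abs_conv r (diag2 t2)"
    using X diag_bd by (auto simp: abs_conv_def)
  note cq = ac[OF ray_bd(3)] ac[OF ray_bd(4)]
  note cp = ac[OF ib(2)] ac[OF ib(3)]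
  note ca = abs_conv_add[OF ce(3,1) r0] abs_conv_add[OF ce(4,2) r0]
  note pb = profile_bound[OF X]
  note cs = ac[OF vbound_uminus[OF vbound_seventh[OF pb r(1) a0]]]
  have t: "ev (diag1 t1) (x, y) = of_real (et1 ((cmod x)\<^sup>2))" "ev (diag2 t2) (x, y) = of_real (et2 ((cmod y)\<^sup>2))"
    by (rule ev_diag(1)[OF r(1) z ce(3) et(1)[OF m(1)]], rule ev_diag(2)[OF r(1) z ce(4) et(2)[OF m(2)]])
  have q: "ev (\<lambda>\<mu>. ray1 q1 \<mu> n) (x, y) = x * of_real (Q1 ((cmod x)\<^sup>2) n)" "ev (\<lambda>\<mu>. ray2 q2 \<mu> n) (x, y) = y * of_real (Q2 ((cmod y)\<^sup>2) n)"
    using ev_ray(1)[OF r(1) z ray_bd(3) a0 Q(1)[OF m(1)]] ev_ray(2)[OF r(1) z ray_bd(4) a0 Q(2)[OF m(2)]]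
    by (simp_all add: evs_def)
  have N: "ev (\<lambda>\<mu>. seventh (profile \<psi>) \<mu> n) w = nonl (evs (profile \<psi>) w n)" if "w \<in> bidisc r" for w
    unfolding evs_def by (rule ev_seventh[where f = "profile \<psi>", OF ac[OF pb] r(1) that])
  have zx: "(x, 0) \<in> bidisc r" "(0, y) \<in> bidisc r" "(0, 0) \<in> bidisc r" using z r0 by auto
  have mix: "ev (\<lambda>\<mu>. if mixed \<mu> then - seventh (profile \<psi>) \<mu> n else 0) (x, y)
      = - nonl (evs (profile \<psi>) (x, y) n) + nonl (bound_state \<phi>1 Q1 x n) + nonl (bound_state \<phi>2 Q2 y n)"
    unfolding ev_mixed[OF cs r0 z] ev_uminus N[OF z] N[OF zx(1)] N[OF zx(2)] N[OF zx(3)]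
    by (simp add: evs_profile(1)[OF X zx(1)] evs_profile(1)[OF X zx(2)] evs_profile(1)[OF X zx(3)] evs_psi_axis[OF X])
  have cm: "abs_conv r (\<lambda>\<mu>. if mixed \<mu> then - seventh (profile \<psi>) \<mu> n else 0)"
  proof -
    obtain R where "mbound r (\<lambda>\<mu>. \<bar>- seventh (profile \<psi>) \<mu> n\<bar>) R" using cs unfolding abs_conv_def by blast
    then show ?thesis by (rule abs_convI) (use r0 in auto)
  qed
  note cv = abs_conv_conv[OF ce(1) cq(1) r0] abs_conv_conv[OF ce(2) cq(2) r0] abs_conv_conv[OF ca(1) cp(1) r0] abs_conv_conv[OF ca(2) cp(2) r0]
  note c2 = abs_conv_add[OF cv(1,2) r0]
  note c3 = abs_conv_add[OF c2 cv(3) r0]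
  note c4 = abs_conv_add[OF c3 cv(4) r0]
  show ?thesis
    unfolding rhs.simps vconv_def ev_add[OF c4 cm r0 z] ev_add[OF c3 cv(4) r0 z] ev_add[OF c2 cv(3) r0 z] ev_add[OF cv(1,2) r0 z]
      ev_conv[OF ce(1) cq(1) r0 z] ev_conv[OF ce(2) cq(2) r0 z] ev_conv[OF ca(1) cp(1) r0 z] ev_conv[OF ca(2) cp(2) r0 z]
      ev_add[OF ce(3,1) r0 z] ev_add[OF ce(4,2) r0 z] t q mix
    by (simp add: evs_def algebra_simps)
qed

text \<open>Multiplication by z1 or z2 is the exponent shift \<open>inc1\<close> or
  \<open>inc2\<close>. Since e lives on balanced monomials, the guarded formula captures the
  complete shifted series.\<close>

lemma ev_shift:
  assumes e: "abs_conv r e" "\<And>\<mu>. e \<mu> \<noteq> 0 \<Longrightarrow> balanced \<mu>" and z: "(x, y) \<in> bidisc r"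
  shows "((\<lambda>\<mu>. of_real (case \<mu> of Mono i j k l \<Rightarrow> if i = Suc j \<and> k = l then e (Mono j j k k) else 0) * mval (x, y) \<mu>)
       has_sum (x * ev e (x, y))) UNIV"
    "((\<lambda>\<mu>. of_real (case \<mu> of Mono i j k l \<Rightarrow> if i = j \<and> k = Suc l then e (Mono i i l l) else 0) * mval (x, y) \<mu>)
       has_sum (y * ev e (x, y))) UNIV"
proof -
  have r0: "0 \<le> r" using r by simp
  let ?f = "\<lambda>\<mu>. of_real (case \<mu> of Mono i j k l \<Rightarrow> if i = Suc j \<and> k = l then e (Mono j j k k) else 0) * mval (x, y) \<mu>"
  let ?g = "\<lambda>\<mu>. of_real (case \<mu> of Mono i j k l \<Rightarrow> if i = j \<and> k = Suc l then e (Mono i i l l) else 0) * mval (x, y) \<mu>"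
  have fe: "?f (inc1 \<mu>) = x * (of_real (e \<mu>) * mval (x, y) \<mu>)" for \<mu>
    using e(2)[of \<mu>] by (cases \<mu>) auto
  have ge: "?g (inc2 \<mu>) = y * (of_real (e \<mu>) * mval (x, y) \<mu>)" for \<mu>
    using e(2)[of \<mu>] by (cases \<mu>) auto
  have "(?f has_sum (x * ev e (x, y))) (range inc1)"
    unfolding has_sum_reindex[OF inj_inc(1)] o_def fe by (intro has_sum_cmult_right ev_has_sum[OF e(1) r0 z])
  moreover have "?f \<mu> = 0" if "\<mu> \<notin> range inc1" for \<mu>
  proof (cases \<mu>)
    case (Mono i j k l)
    have "i \<noteq> Suc j" using that inc1.simps[of j j k l] Mono by (metis rangeI)
    then show ?thesis by (simp add: Mono)
  qed
  ultimately show "(?f has_sum (x * ev e (x, y))) UNIV"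
    by (subst has_sum_cong_neutral[where T = "range inc1"]) auto
  have "(?g has_sum (y * ev e (x, y))) (range inc2)"
    unfolding has_sum_reindex[OF inj_inc(2)] o_def ge by (intro has_sum_cmult_right ev_has_sum[OF e(1) r0 z])
  moreover have "?g \<mu> = 0" if "\<mu> \<notin> range inc2" for \<mu>
  proof (cases \<mu>)
    case (Mono i j k l)
    have "k \<noteq> Suc l" using that inc2.simps[of i j l l] Mono by (metis rangeI)
    then show ?thesis by (simp add: Mono)
  qed
  ultimately show "(?g has_sum (y * ev e (x, y))) UNIV"
    by (subst has_sum_cong_neutral[where T = "range inc2"]) auto
qed

text \<open>The coefficient equations are summed and the two bound state equations added. The
  nonlinear terms of the single bound states cancel against those in \<open>ev_rhs\<close>, and the
  solvability corrections complete \<epsilon> q to \<epsilon> (\<phi> + q), so that all terms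
  regroup by frequency. Along an orbit the right-hand side is \<open>\<i>\<close> times the time
  derivative.\<close>

lemma stationary_equation:
  assumes X: "invar (\<psi>, \<epsilon>1, \<epsilon>2)"
    and eq: "solves (\<psi>, \<epsilon>1, \<epsilon>2)"
    and z: "(x, y) \<in> bidisc r"
  defines "s \<equiv> ((cmod x)\<^sup>2, (cmod y)\<^sup>2)" and "u \<equiv> evs (profile \<psi>) (x, y)"
  shows "schroedinger V u n + nonl (u n) =
     of_real (e1 + et1 ((cmod x)\<^sup>2) + evm \<epsilon>1 s) * evs (\<lambda>\<mu> n. (1 - of_int (hindex \<mu>)) * profile \<psi> \<mu> n) (x, y) n +
     of_real (e2 + et2 ((cmod y)\<^sup>2) + evm \<epsilon>2 s) * evs (\<lambda>\<mu> n. of_int (hindex \<mu>) * profile \<psi> \<mu> n) (x, y) n"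
proof -
  have r0: "0 \<le> r" and a0: "0 \<le> a" using r a by auto
  let ?b1 = "bound_state \<phi>1 Q1 x" and ?b2 = "bound_state \<phi>2 Q2 y" and ?p = "evs \<psi> (x, y)"
  let ?A = "evs (\<lambda>\<mu> n. (1 - of_int (hindex \<mu>)) * \<psi> \<mu> n) (x, y) n" and ?B = "evs (\<lambda>\<mu> n. of_int (hindex \<mu>) * \<psi> \<mu> n) (x, y) n"
  let ?m = "mval (x, y)"
  note ib = inv_psi_bound[OF X]
  have hp: "((\<lambda>\<mu>. of_real (\<psi> \<mu> k) * ?m \<mu>) has_sum ?p k) UNIV" for k
    unfolding evs_def by (rule ev_has_sum[OF vbound_abs_conv[OF ib(1) a0 r0] r0 z])
  have hA: "((\<lambda>\<mu>. of_real ((1 - of_int (hindex \<mu>)) * \<psi> \<mu> n) * ?m \<mu>) has_sum ?A) UNIV"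
    unfolding evs_def by (rule ev_has_sum[OF vbound_abs_conv[OF ib(2) a0 r0] r0 z])
  have hB: "((\<lambda>\<mu>. of_real (of_int (hindex \<mu>) * \<psi> \<mu> n) * ?m \<mu>) has_sum ?B) UNIV"
    unfolding evs_def by (rule ev_has_sum[OF vbound_abs_conv[OF ib(3) a0 r0] r0 z])
  have hR: "((\<lambda>\<mu>. of_real (rhs (\<psi>, \<epsilon>1, \<epsilon>2) \<mu> n) * ?m \<mu>) has_sum ev (\<lambda>\<mu>. rhs (\<psi>, \<epsilon>1, \<epsilon>2) \<mu> n) (x, y)) UNIV"
    by (rule ev_has_sum[OF vbound_abs_conv[OF rhs_bound[OF X] a0 r0] r0 z])
  have \<epsilon>: "mbound r (\<lambda>\<mu>. \<bar>\<epsilon>1 \<mu>\<bar>) r" "mbound r (\<lambda>\<mu>. \<bar>\<epsilon>2 \<mu>\<bar>) r" using X by auto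
  have bal: "\<epsilon>1 \<mu> \<noteq> 0 \<Longrightarrow> balanced \<mu>" "\<epsilon>2 \<mu> \<noteq> 0 \<Longrightarrow> balanced \<mu>" for \<mu> using X eadm_props by auto
  have ac: "abs_conv r \<epsilon>1" "abs_conv r \<epsilon>2" using \<epsilon> by (auto simp: abs_conv_def)
  have ee: "ev \<epsilon>1 (x, y) = of_real (evm \<epsilon>1 s)" "ev \<epsilon>2 (x, y) = of_real (evm \<epsilon>2 s)"
    unfolding s_def by (rule ev_balanced[OF \<epsilon>(1) r(1) z bal(1)], assumption, rule ev_balanced[OF \<epsilon>(2) r(1) z bal(2)], assumption)
  note h1 = ev_shift(1)[OF ac(1) bal(1) z] and h2 = ev_shift(2)[OF ac(2) bal(2) z]
  let ?F1 = "\<lambda>\<mu>. case \<mu> of Mono i j k l \<Rightarrow> if i = Suc j \<and> k = l then \<epsilon>1 (Mono j j k k) else 0"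
  let ?F2 = "\<lambda>\<mu>. case \<mu> of Mono i j k l \<Rightarrow> if i = j \<and> k = Suc l then \<epsilon>2 (Mono i i l l) else 0"
  have L: "((\<lambda>\<mu>. of_real (schroedinger V (\<psi> \<mu>) n) * ?m \<mu>) has_sum schroedinger V ?p n) UNIV"
  proof -
    have "((\<lambda>\<mu>. of_real (2 + V n) * (of_real (\<psi> \<mu> n) * ?m \<mu>) + - (of_real (\<psi> \<mu> (n + 1)) * ?m \<mu>) + - (of_real (\<psi> \<mu> (n - 1)) * ?m \<mu>))
        has_sum (of_real (2 + V n) * ?p n + - ?p (n + 1) + - ?p (n - 1))) UNIV"
      by (intro has_sum_add has_sum_cmult_right hp has_sum_uminus[THEN iffD2]) (use hp in simp_all)
    moreover have "of_real (2 + V n) * (of_real (\<psi> \<mu> n) * ?m \<mu>) + - (of_real (\<psi> \<mu> (n + 1)) * ?m \<mu>) + - (of_real (\<psi> \<mu> (n - 1)) * ?m \<mu>)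
        = of_real (schroedinger V (\<psi> \<mu>) n) * ?m \<mu>" for \<mu>
      by (simp add: schroedinger_def lap_def algebra_simps)
    moreover have "of_real (2 + V n) * ?p n + - ?p (n + 1) + - ?p (n - 1) = schroedinger V ?p n"
      by (simp add: schroedinger_def lap_def scaleR_conv_of_real algebra_simps)
    ultimately show ?thesis by simp
  qed
  have "((\<lambda>\<mu>. of_real e1 * (of_real ((1 - of_int (hindex \<mu>)) * \<psi> \<mu> n) * ?m \<mu>)
      + of_real e2 * (of_real (of_int (hindex \<mu>) * \<psi> \<mu> n) * ?m \<mu>) + of_real (rhs (\<psi>, \<epsilon>1, \<epsilon>2) \<mu> n) * ?m \<mu>
      + of_real (\<phi>1 n) * (of_real (?F1 \<mu>) * ?m \<mu>) + of_real (\<phi>2 n) * (of_real (?F2 \<mu>) * ?m \<mu>)) has_sum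
     (of_real e1 * ?A + of_real e2 * ?B + ev (\<lambda>\<mu>. rhs (\<psi>, \<epsilon>1, \<epsilon>2) \<mu> n) (x, y)
      + of_real (\<phi>1 n) * (x * ev \<epsilon>1 (x, y)) + of_real (\<phi>2 n) * (y * ev \<epsilon>2 (x, y)))) UNIV"
    by (intro has_sum_add has_sum_cmult_right hA hB hR h1 h2)
  moreover have "of_real e1 * (of_real ((1 - of_int (hindex \<mu>)) * \<psi> \<mu> n) * ?m \<mu>)
      + of_real e2 * (of_real (of_int (hindex \<mu>) * \<psi> \<mu> n) * ?m \<mu>) + of_real (rhs (\<psi>, \<epsilon>1, \<epsilon>2) \<mu> n) * ?m \<mu>
      + of_real (\<phi>1 n) * (of_real (?F1 \<mu>) * ?m \<mu>) + of_real (\<phi>2 n) * (of_real (?F2 \<mu>) * ?m \<mu>)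
      = of_real (schroedinger V (\<psi> \<mu>) n) * ?m \<mu>" for \<mu>
  proof -
    have "schroedinger V (\<psi> \<mu>) n = e1 * ((1 - of_int (hindex \<mu>)) * \<psi> \<mu> n) + e2 * (of_int (hindex \<mu>) * \<psi> \<mu> n)
        + rhs (\<psi>, \<epsilon>1, \<epsilon>2) \<mu> n + \<phi>1 n * ?F1 \<mu> + \<phi>2 n * ?F2 \<mu>"
      using eq[unfolded solves.simps, rule_format, of \<mu> n] by (cases \<mu>) (simp add: algebra_simps del: rhs.simps)
    then show ?thesis by (simp add: distrib_right mult.assoc del: rhs.simps)
  qed
  ultimately have "schroedinger V ?p n = of_real e1 * ?A + of_real e2 * ?B + ev (\<lambda>\<mu>. rhs (\<psi>, \<epsilon>1, \<epsilon>2) \<mu> n) (x, y)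
      + of_real (\<phi>1 n) * (x * ev \<epsilon>1 (x, y)) + of_real (\<phi>2 n) * (y * ev \<epsilon>2 (x, y))"
    using has_sum_unique[OF L] by (simp del: rhs.simps)
  note P = this[unfolded ev_rhs[OF X z] ee]
  have ue: "u = (\<lambda>n. ?b1 n + ?b2 n + ?p n)" unfolding u_def using evs_profile(1)[OF X z] by blast
  have s12: "schroedinger V u n = schroedinger V ?b1 n + schroedinger V ?b2 n + schroedinger V ?p n"
    unfolding ue by (simp only: schroedinger_add)
  have "cmod x \<le> r" "cmod y \<le> r" using z by auto
  note S1 = state1[OF this(1), of n] and S2 = state2[OF this(2), of n]
  have b: "?b1 n = x * of_real (\<phi>1 n) + x * of_real (Q1 ((cmod x)\<^sup>2) n)" "?b2 n = y * of_real (\<phi>2 n) + y * of_real (Q2 ((cmod y)\<^sup>2) n)"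
    by (simp_all add: bound_state_def distrib_left)
  have lin: "p = q - w" if "p - q + w = 0" for p q w :: complex
  proof -
    have "p = (p - q + w) + (q - w)" by simp
    then show ?thesis using that by simp
  qed
  have T1: "schroedinger V ?b1 n = of_real (e1 + et1 ((cmod x)\<^sup>2)) * ?b1 n - nonl (?b1 n)"
    by (rule lin[OF S1])
  have T2: "schroedinger V ?b2 n = of_real (e2 + et2 ((cmod y)\<^sup>2)) * ?b2 n - nonl (?b2 n)"
    by (rule lin[OF S2])
  define N1 N2 N3 where "N1 = nonl (?b1 n)" and "N2 = nonl (?b2 n)" and "N3 = nonl (u n)"
  define w1 w2 where "w1 = complex_of_real (evm \<epsilon>1 s)" and "w2 = complex_of_real (evm \<epsilon>2 s)"
  have "schroedinger V u n + N3 = of_real (e1 + et1 ((cmod x)\<^sup>2)) * ?b1 n + of_real (e2 + et2 ((cmod y)\<^sup>2)) * ?b2 n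
     + (of_real e1 * ?A + of_real e2 * ?B + (w1 * (x * of_real (Q1 ((cmod x)\<^sup>2) n)) + w2 * (y * of_real (Q2 ((cmod y)\<^sup>2) n))
     + (of_real (et1 ((cmod x)\<^sup>2)) + w1) * ?A + (of_real (et2 ((cmod y)\<^sup>2)) + w2) * ?B)
     + of_real (\<phi>1 n) * (x * w1) + of_real (\<phi>2 n) * (y * w2))"
    unfolding s12 T1 T2 P N1_def[symmetric] N2_def[symmetric] u_def[symmetric] N3_def[symmetric] w1_def[symmetric] w2_def[symmetric] by (simp add: algebra_simps)
  also have "\<dots> = (of_real (e1 + et1 ((cmod x)\<^sup>2)) + w1) * (?b1 n + ?A) + (of_real (e2 + et2 ((cmod y)\<^sup>2)) + w2) * (?b2 n + ?B)"
    unfolding b by (simp add: algebra_simps)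
  finally show ?thesis
    unfolding evs_profile(2,3)[OF X z] N3_def w1_def w2_def by simp
qed

end


section \<open>Size of \<psi> and of the frequency corrections\<close>

context two_mode
begin

text \<open>Every monomial present contains both modes and has degree at least 7. After one factor
  from each mode, five factors go into the power sum and the others are paid by the radius. The
  constant is the bound \<open>r\<^sup>2\<close> of \<psi> rescaled by \<open>r ^ 7\<close>.\<close>

lemma psi_estimate:
  assumes X: "invar (\<psi>, \<epsilon>1, \<epsilon>2)" and z: "(x, y) \<in> bidisc r"
  shows "le_norm a (evs \<psi> (x, y)) \<le> r\<^sup>2 / r ^ 7 * (cmod x * cmod y * (cmod x ^ 5 + cmod y ^ 5))"
proof -
  have r0: "0 \<le> r" and a0: "0 \<le> a" using r a by auto
  note ib = inv_psi_bound(1)[OF X]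
  let ?x = "cmod x" and ?y = "cmod y"
  let ?E = "?x * ?y * (?x ^ 5 + ?y ^ 5)"
  have trm: "cmod (mval (x, y) \<mu>) * le_norm a (\<psi> \<mu>) \<le> ?E / r ^ 7 * (r ^ deg \<mu> * le_norm a (\<psi> \<mu>))" for \<mu>
  proof (cases "\<psi> \<mu> = (\<lambda>n. 0)")
    case False
    then have adm: "admissible \<mu>" using X by fastforce
    obtain i j k l where \<mu>: "\<mu> = Mono i j k l" by (cases \<mu>)
    obtain A where A: "i + j = Suc A" using adm by (auto simp: \<mu> admissible_def gr0_conv_Suc)
    obtain B where B: "k + l = Suc B" using adm by (auto simp: \<mu> admissible_def gr0_conv_Suc)
    obtain d where d: "deg \<mu> = 7 + d" using adm le_Suc_ex by (auto simp: admissible_def)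
    have "A + B = 5 + d" using A B d by (simp add: \<mu>)
    then have p: "?x ^ A * ?y ^ B \<le> (?x ^ 5 + ?y ^ 5) * r ^ d"
      using z by (intro power_split_bound) auto
    have "cmod (mval (x, y) \<mu>) = ?x ^ (i + j) * ?y ^ (k + l)"
      by (simp add: \<mu> norm_mult norm_power power_add mult_ac)
    also have "\<dots> = ?x * ?y * (?x ^ A * ?y ^ B)" by (simp add: A B)
    also have "\<dots> \<le> ?x * ?y * ((?x ^ 5 + ?y ^ 5) * r ^ d)" using p by (intro mult_left_mono) auto
    also have "\<dots> = ?E / r ^ 7 * r ^ deg \<mu>" using r by (simp add: d power_add)
    finally have "cmod (mval (x, y) \<mu>) \<le> ?E / r ^ 7 * r ^ deg \<mu>" .
    from mult_right_mono[OF this le_norm_nonneg[of a "\<psi> \<mu>"]] show ?thesis by (simp only: mult.assoc)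
  qed simp
  have "le_norm a (\<lambda>n. evs \<psi> (x, y) n - (\<Sum>\<mu>\<in>{}. of_real (\<psi> \<mu> n) * mval (x, y) \<mu>)) \<le> ?E / r ^ 7 * r\<^sup>2"
  proof (rule evs_tail(2)[OF ib r(1) a0 z finite.emptyI])
    fix S :: "mono set" assume S: "finite S"
    have "(\<Sum>\<mu>\<in>S. cmod (mval (x, y) \<mu>) * le_norm a (\<psi> \<mu>)) \<le> (\<Sum>\<mu>\<in>S. ?E / r ^ 7 * (r ^ deg \<mu> * le_norm a (\<psi> \<mu>)))"
      by (intro sum_mono trm)
    also have "\<dots> \<le> ?E / r ^ 7 * r\<^sup>2"
      unfolding sum_distrib_left[symmetric]
      using ib S r0 by (intro mult_left_mono mboundD(2)) (auto simp: vbound_def)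
    finally show "(\<Sum>\<mu>\<in>S. cmod (mval (x, y) \<mu>) * le_norm a (\<psi> \<mu>)) \<le> ?E / r ^ 7 * r\<^sup>2" .
  qed
  then show ?thesis by (simp add: mult.commute)
qed

text \<open>The part common to both corrections; they differ only in the bound
  \<open>monomial\<close>, where d counts the excess over the lowest order 3 in the squared
  moduli.\<close>

lemma frequency_estimate:
  assumes e: "mbound r (\<lambda>\<mu>. \<bar>e \<mu>\<bar>) r" and z: "(x, y) \<in> bidisc r"
    and bal: "\<And>\<mu>. e \<mu> \<noteq> 0 \<Longrightarrow> balanced \<mu>" and E: "0 \<le> E"
    and monomial: "\<And>i j d. e (Mono i i j j) \<noteq> 0 \<Longrightarrow> i + j = 3 + d \<Longrightarrow> ((cmod x)\<^sup>2) ^ i * ((cmod y)\<^sup>2) ^ j \<le> E * (r\<^sup>2) ^ d"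
    and low: "\<And>\<mu>. e \<mu> \<noteq> 0 \<Longrightarrow> 6 \<le> deg \<mu>"
  shows "\<bar>evm e ((cmod x)\<^sup>2, (cmod y)\<^sup>2)\<bar> \<le> r / r ^ 6 * E"
proof -
  have r0: "0 \<le> r" using r by auto
  have trm: "cmod (mval (x, y) \<mu>) * \<bar>e \<mu>\<bar> \<le> E / r ^ 6 * (r ^ deg \<mu> * \<bar>e \<mu>\<bar>)" for \<mu>
  proof (cases "e \<mu> = 0")
    case False
    obtain i j where \<mu>: "\<mu> = Mono i i j j" using bal[OF False] by (cases \<mu>) auto
    obtain d where d: "i + j = 3 + d" using low[OF False] le_Suc_ex[of 3 "i + j"] by (auto simp: \<mu>)
    have dg: "deg \<mu> = 6 + 2 * d" using d by (simp add: \<mu>)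
    have "cmod (mval (x, y) \<mu>) = ((cmod x)\<^sup>2) ^ i * ((cmod y)\<^sup>2) ^ j"
      by (simp add: \<mu> norm_mult norm_power power2_eq_square power_mult_distrib mult_ac)
    also have "\<dots> \<le> E * (r\<^sup>2) ^ d" by (rule monomial[OF _ d]) (use False \<mu> in simp)
    also have "\<dots> = E / r ^ 6 * r ^ deg \<mu>" using r by (simp add: dg power_add power_mult)
    finally have "cmod (mval (x, y) \<mu>) \<le> E / r ^ 6 * r ^ deg \<mu>" .
    from mult_right_mono[OF this abs_ge_zero[of "e \<mu>"]] show ?thesis by (simp only: mult.assoc)
  qed simp
  have ac: "abs_conv r e" using e by (auto simp: abs_conv_def)
  have "cmod (ev e (x, y)) \<le> E / r ^ 6 * r"
  proof (rule cmod_ev_le[OF _ ev_has_sum[OF ac r0 z]])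
    fix S :: "mono set" assume S: "finite S"
    have "(\<Sum>\<mu>\<in>S. cmod (mval (x, y) \<mu>) * \<bar>e \<mu>\<bar>) \<le> (\<Sum>\<mu>\<in>S. E / r ^ 6 * (r ^ deg \<mu> * \<bar>e \<mu>\<bar>))"
      by (intro sum_mono trm)
    also have "\<dots> \<le> E / r ^ 6 * r"
      unfolding sum_distrib_left[symmetric] using e S r0 E by (intro mult_left_mono mboundD(2)) auto
    finally show "(\<Sum>\<mu>\<in>S. cmod (mval (x, y) \<mu>) * \<bar>e \<mu>\<bar>) \<le> E / r ^ 6 * r" .
  qed
  moreover have "ev e (x, y) = of_real (evm e ((cmod x)\<^sup>2, (cmod y)\<^sup>2))"
    by (rule ev_balanced[OF e r(1) z bal])
  ultimately show ?thesis by (simp add: mult.commute)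
qed

text \<open>The support conditions guarantee one squared modulus of the other mode. Once it is split
  off, two more are available for the sum of fourth powers, and the excess is paid by
  \<open>r\<^sup>2\<close>.\<close>

lemma epsilon_estimate:
  assumes X: "invar (\<psi>, \<epsilon>1, \<epsilon>2)" and z: "(x, y) \<in> bidisc r"
  shows "\<bar>evm \<epsilon>1 ((cmod x)\<^sup>2, (cmod y)\<^sup>2)\<bar> \<le> r / r ^ 6 * ((cmod y)\<^sup>2 * (cmod x ^ 4 + cmod y ^ 4))"
    "\<bar>evm \<epsilon>2 ((cmod x)\<^sup>2, (cmod y)\<^sup>2)\<bar> \<le> r / r ^ 6 * ((cmod x)\<^sup>2 * (cmod x ^ 4 + cmod y ^ 4))"
proof -
  have \<epsilon>: "mbound r (\<lambda>\<mu>. \<bar>\<epsilon>1 \<mu>\<bar>) r" "mbound r (\<lambda>\<mu>. \<bar>\<epsilon>2 \<mu>\<bar>) r"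
    and adm: "\<And>\<mu>. \<epsilon>1 \<mu> \<noteq> 0 \<Longrightarrow> eadm1 \<mu>" "\<And>\<mu>. \<epsilon>2 \<mu> \<noteq> 0 \<Longrightarrow> eadm2 \<mu>" using X by auto
  have m: "(cmod x)\<^sup>2 \<le> r\<^sup>2" "(cmod y)\<^sup>2 \<le> r\<^sup>2" using z by (auto intro: power_mono)
  have four: "((cmod w)\<^sup>2)\<^sup>2 = cmod w ^ 4" for w by (simp flip: power_mult)
  have split: "((cmod x)\<^sup>2) ^ A * ((cmod y)\<^sup>2) ^ B \<le> (cmod x ^ 4 + cmod y ^ 4) * (r\<^sup>2) ^ d" if "A + B = 2 + d" for A B d
    using power_split_bound[of "(cmod x)\<^sup>2" "r\<^sup>2" "(cmod y)\<^sup>2" A B 2 d] m that by (simp add: four)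
  show "\<bar>evm \<epsilon>1 ((cmod x)\<^sup>2, (cmod y)\<^sup>2)\<bar> \<le> r / r ^ 6 * ((cmod y)\<^sup>2 * (cmod x ^ 4 + cmod y ^ 4))"
  proof (rule frequency_estimate[OF \<epsilon>(1) z])
    fix i j d assume "\<epsilon>1 (Mono i i j j) \<noteq> 0" and ij: "i + j = 3 + d"
    then have "0 < j" using adm(1)[of "Mono i i j j"] by auto
    then obtain B where B: "j = Suc B" by (auto simp: gr0_conv_Suc)
    have "((cmod x)\<^sup>2) ^ i * ((cmod y)\<^sup>2) ^ B \<le> (cmod x ^ 4 + cmod y ^ 4) * (r\<^sup>2) ^ d" using ij B by (intro split) simp
    then have "(cmod y)\<^sup>2 * (((cmod x)\<^sup>2) ^ i * ((cmod y)\<^sup>2) ^ B) \<le> (cmod y)\<^sup>2 * ((cmod x ^ 4 + cmod y ^ 4) * (r\<^sup>2) ^ d)"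
      by (intro mult_left_mono) auto
    then show "((cmod x)\<^sup>2) ^ i * ((cmod y)\<^sup>2) ^ j \<le> (cmod y)\<^sup>2 * (cmod x ^ 4 + cmod y ^ 4) * (r\<^sup>2) ^ d"
      by (simp add: B mult.assoc mult.left_commute)
  qed (use adm eadm_props in auto)
  show "\<bar>evm \<epsilon>2 ((cmod x)\<^sup>2, (cmod y)\<^sup>2)\<bar> \<le> r / r ^ 6 * ((cmod x)\<^sup>2 * (cmod x ^ 4 + cmod y ^ 4))"
  proof (rule frequency_estimate[OF \<epsilon>(2) z])
    fix i j d assume "\<epsilon>2 (Mono i i j j) \<noteq> 0" and ij: "i + j = 3 + d"
    then have "0 < i" using adm(2)[of "Mono i i j j"] by auto
    then obtain A where A: "i = Suc A" by (auto simp: gr0_conv_Suc)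
    have "((cmod x)\<^sup>2) ^ A * ((cmod y)\<^sup>2) ^ j \<le> (cmod x ^ 4 + cmod y ^ 4) * (r\<^sup>2) ^ d" using ij A by (intro split) simp
    then have "(cmod x)\<^sup>2 * (((cmod x)\<^sup>2) ^ A * ((cmod y)\<^sup>2) ^ j) \<le> (cmod x)\<^sup>2 * ((cmod x ^ 4 + cmod y ^ 4) * (r\<^sup>2) ^ d)"
      by (intro mult_left_mono) auto
    then show "((cmod x)\<^sup>2) ^ i * ((cmod y)\<^sup>2) ^ j \<le> (cmod x)\<^sup>2 * (cmod x ^ 4 + cmod y ^ 4) * (r\<^sup>2) ^ d"
      by (simp add: A mult.assoc)
  qed (use adm eadm_props in auto)
qed

end

section \<open>Time evolution along the orbits\<close>

context two_mode_family
begin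

text \<open>Conservation of the moduli makes both frequencies constant in time, so the orbit is an
  exact rotation and the series can be differentiated term by term. The series and the stated
  expression are known to agree at times in \<open>I\<close> only; as \<open>I\<close> is open, the
  derivative carries over.\<close>

lemma evolution:
  assumes X: "invar (\<psi>, \<epsilon>1, \<epsilon>2)"
    and eq: "solves (\<psi>, \<epsilon>1, \<epsilon>2)"
    and I: "open I" "is_interval I"
    and orbit: "\<And>t. t \<in> I \<Longrightarrow> (z1 t, z2 t) \<in> ball 0 r"
    and z1: "\<And>t. t \<in> I \<Longrightarrow> (z1 has_vector_derivative
       - \<i> * (of_real (e1 + et1 ((cmod (z1 t))\<^sup>2) + evm \<epsilon>1 ((cmod (z1 t))\<^sup>2, (cmod (z2 t))\<^sup>2)) * z1 t)) (at t)"
    and z2: "\<And>t. t \<in> I \<Longrightarrow> (z2 has_vector_derivative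
       - \<i> * (of_real (e2 + et2 ((cmod (z2 t))\<^sup>2) + evm \<epsilon>2 ((cmod (z1 t))\<^sup>2, (cmod (z2 t))\<^sup>2)) * z2 t)) (at t)"
  shows "dnls_solution V I
     (\<lambda>t n. bound_state \<phi>1 Q1 (z1 t) n + bound_state \<phi>2 Q2 (z2 t) n + evs \<psi> (z1 t, z2 t) n)"
proof -
  have a0: "0 \<le> a" using a by simp
  let ?C1 = "\<lambda>\<mu> n. (1 - of_int (hindex \<mu>)) * profile \<psi> \<mu> n" and ?C2 = "\<lambda>\<mu> n. of_int (hindex \<mu>) * profile \<psi> \<mu> n"
  have lt: "cmod (z1 t) < r" "cmod (z2 t) < r" if "t \<in> I" for t
    using orbit[OF that] norm_fst_le[of "z1 t" "z2 t"] norm_snd_le[of "z2 t" "z1 t"] by auto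
  then have bd: "(z1 t, z2 t) \<in> bidisc r" if "t \<in> I" for t using that by (auto simp: less_imp_le)
  define u where "u t = evs (profile \<psi>) (z1 t, z2 t)" for t
  have ue: "u t = (\<lambda>n. bound_state \<phi>1 Q1 (z1 t) n + bound_state \<phi>2 Q2 (z2 t) n + evs \<psi> (z1 t, z2 t) n)" if "t \<in> I" for t
    unfolding u_def using evs_profile(1)[OF X bd[OF that]] by blast
  define g1 where "g1 t = e1 + et1 ((cmod (z1 t))\<^sup>2) + evm \<epsilon>1 ((cmod (z1 t))\<^sup>2, (cmod (z2 t))\<^sup>2)" for t
  define g2 where "g2 t = e2 + et2 ((cmod (z2 t))\<^sup>2) + evm \<epsilon>2 ((cmod (z1 t))\<^sup>2, (cmod (z2 t))\<^sup>2)" for t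
  note z1' = z1[folded g1_def] and z2' = z2[folded g2_def]
  have l2: "u t \<in> l2_space" if "t \<in> I" for t
    unfolding u_def by (rule le_space_mono(1)[OF evs_le_space[OF profile_bound[OF X] r(1) a0 bd[OF that]] a0])
  have der: "\<exists>D. has_l2_derivative (\<lambda>s. u s) D t \<and>
      (\<forall>n. \<i> * D n = schroedinger V (u t) n + of_real (cmod (u t n) ^ 6) * u t n)" if t: "t \<in> I" for t
  proof -
    let ?D = "\<lambda>n. - \<i> * (of_real (g1 t) * evs ?C1 (z1 t, z2 t) n + of_real (g2 t) * evs ?C2 (z1 t, z2 t) n)"
    have c1: "cmod (z1 s) = cmod (z1 t)" and c2: "cmod (z2 s) = cmod (z2 t)" if "s \<in> I" for s
      by (rule rotating_solution(1)[OF I(2) z1' that t], assumption, rule rotating_solution(1)[OF I(2) z2' that t], assumption)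
    have gc: "g1 s = g1 t" "g2 s = g2 t" if "s \<in> I" for s
      using c1[OF that] c2[OF that] by (simp_all add: g1_def g2_def)
    have rot: "z1 s = cis (- g1 t * (s - t)) * z1 t \<and> z2 s = cis (- g2 t * (s - t)) * z2 t" if "s \<in> I" for s
    proof
      show "z1 s = cis (- g1 t * (s - t)) * z1 t"
        by (rule rotating_solution(2)[where g = g1, OF I(2) z1' that t gc(1)])
      show "z2 s = cis (- g2 t * (s - t)) * z2 t"
        by (rule rotating_solution(2)[where g = g2, OF I(2) z2' that t gc(2)])
    qed
    have "has_l2_derivative (\<lambda>s. evs (profile \<psi>) (z1 s, z2 s)) ?D t"
    proof (rule evs_has_l2_derivative[OF profile_bound[OF X] a0 r(1) evs_profile(4)[OF X bd[OF t]] evs_profile(5)[OF X bd[OF t]] _ lt[OF t] I(1) t rot])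
      show "charge \<mu> = 1" if "profile \<psi> \<mu> n \<noteq> 0" for \<mu> n
        using profile_support[OF X that] by simp
    qed
    then have "has_l2_derivative (\<lambda>s. u s) ?D t" by (simp only: u_def)
    moreover have "\<i> * ?D n = schroedinger V (u t) n + of_real (cmod (u t n) ^ 6) * u t n" for n
    proof -
      have "\<i> * ?D n = of_real (g1 t) * evs ?C1 (z1 t, z2 t) n + of_real (g2 t) * evs ?C2 (z1 t, z2 t) n"
        by (simp add: mult.assoc[symmetric])
      then show ?thesis
        unfolding u_def stationary_equation[OF X eq bd[OF t]] g1_def g2_def .
    qed
    ultimately show ?thesis by blast
  qed
  let ?U = "\<lambda>t n. bound_state \<phi>1 Q1 (z1 t) n + bound_state \<phi>2 Q2 (z2 t) n + evs \<psi> (z1 t, z2 t) n"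
  show ?thesis
    unfolding dnls_solution_def
  proof (intro conjI ballI)
    show "?U t \<in> l2_space" if "t \<in> I" for t using l2[OF that] unfolding ue[OF that] .
    fix t assume t: "t \<in> I"
    obtain D where D: "has_l2_derivative u D t"
      "\<And>n. \<i> * D n = schroedinger V (u t) n + of_real (cmod (u t n) ^ 6) * u t n" using der[OF t] by blast
    have ev: "\<forall>\<^sub>F s in at t. s \<in> I" using eventually_at_topological I(1) t by blast
    have "has_l2_derivative ?U D t"
      unfolding has_l2_derivative_def
    proof
      show "D \<in> l2_space" using D(1) by (simp add: has_l2_derivative_def)
      have "((\<lambda>s. l2_norm ((1 / (s - t)) *\<^sub>R (u s - u t) - D)) \<longlongrightarrow> 0) (at t)" using D(1) by (simp add: has_l2_derivative_def)
      then show "((\<lambda>s. l2_norm ((1 / (s - t)) *\<^sub>R (?U s - ?U t) - D)) \<longlongrightarrow> 0) (at t)"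
      proof (rule Lim_transform_eventually)
        show "\<forall>\<^sub>F s in at t. l2_norm ((1 / (s - t)) *\<^sub>R (u s - u t) - D) = l2_norm ((1 / (s - t)) *\<^sub>R (?U s - ?U t) - D)"
          using ev by eventually_elim (simp only: ue[OF t] ue)
      qed
    qed
    moreover have "\<forall>n. \<i> * D n = schroedinger V (?U t) n + of_real (cmod (?U t n) ^ 6) * ?U t n"
      using D(2) unfolding ue[OF t] by blast
    ultimately show "\<exists>D. has_l2_derivative ?U D t \<and>
        (\<forall>n. \<i> * D n = schroedinger V (?U t) n + of_real (cmod (?U t n) ^ 6) * ?U t n)" by blast
  qed
qed

end

theorem theorem1p3:
  fixes V :: "int \<Rightarrow> real"
    and e1 e2 a0 \<delta>0 :: real
    and \<phi>1 \<phi>2 :: "int \<Rightarrow> real"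
    and et1 et2 :: "real \<Rightarrow> real"
    and q1 q2 :: "real \<Rightarrow> int \<Rightarrow> real"
  assumes V: "(\<lambda>n. sqrt (1 + \<bar>real_of_int n\<bar>\<^sup>2) * \<bar>V n\<bar>) summable_on UNIV"
    and less: "e1 < e2"
    and spec: "discrete_spectrum_on l2_space l2_norm (schroedinger V) = {complex_of_real e1, complex_of_real e2}"
    and nonres: "\<And>n::int. e1 + of_int n * (e2 - e1) \<notin> {0..4}"
    and phi1: "\<phi>1 \<in> l2_space" "l2_norm \<phi>1 = 1" "\<And>n. schroedinger V \<phi>1 n = e1 * \<phi>1 n"
    and phi2: "\<phi>2 \<in> l2_space" "l2_norm \<phi>2 = 1" "\<And>n. schroedinger V \<phi>2 n = e2 * \<phi>2 n"
    and pos: "a0 > 0" "\<delta>0 > 0"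
    and bs1: "bound_state_family V e1 \<phi>1 a0 \<delta>0 et1 q1"
    and bs2: "bound_state_family V e2 \<phi>2 a0 \<delta>0 et2 q2"
  shows "\<exists>a1 \<delta>1. \<exists>\<psi> :: complex \<times> complex \<Rightarrow> int \<Rightarrow> complex. \<exists>\<epsilon>1 \<epsilon>2 :: real \<times> real \<Rightarrow> real.
    0 < a1 \<and> a1 < a0 \<and> 0 < \<delta>1 \<and> \<delta>1 < \<delta>0 \<and>
    analytic_on_ball (le_space a1) (le_norm a1) \<delta>1 \<psi> \<and>
    analytic_on_ball UNIV norm (\<delta>1\<^sup>2) \<epsilon>1 \<and>
    analytic_on_ball UNIV norm (\<delta>1\<^sup>2) \<epsilon>2 \<and>
    (\<forall>I z1 z2. open I \<and> is_interval I \<and>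
       (\<forall>t\<in>I. (z1 t, z2 t) \<in> ball 0 \<delta>1 \<and>
          (z1 has_vector_derivative
             - \<i> * (of_real (e1 + et1 ((cmod (z1 t))\<^sup>2) + \<epsilon>1 ((cmod (z1 t))\<^sup>2, (cmod (z2 t))\<^sup>2)) * z1 t)) (at t) \<and>
          (z2 has_vector_derivative
             - \<i> * (of_real (e2 + et2 ((cmod (z2 t))\<^sup>2) + \<epsilon>2 ((cmod (z1 t))\<^sup>2, (cmod (z2 t))\<^sup>2)) * z2 t)) (at t))
       \<longrightarrow> dnls_solution V I
             (\<lambda>t n. bound_state \<phi>1 q1 (z1 t) n + bound_state \<phi>2 q2 (z2 t) n + \<psi> (z1 t, z2 t) n)) \<and>
    (\<forall>\<theta>::real. \<forall>z1 z2. (z1, z2) \<in> ball 0 \<delta>1 \<longrightarrow>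
       (\<forall>n. cis \<theta> * \<psi> (z1, z2) n = \<psi> (cis \<theta> * z1, cis \<theta> * z2) n)) \<and>
    (\<exists>C. \<forall>z1 z2. (z1, z2) \<in> ball 0 \<delta>1 \<longrightarrow>
       le_norm a1 (\<psi> (z1, z2)) \<le> C * (cmod z1 * cmod z2 * (cmod z1 ^ 5 + cmod z2 ^ 5)) \<and>
       \<bar>\<epsilon>1 ((cmod z1)\<^sup>2, (cmod z2)\<^sup>2)\<bar> \<le> C * ((cmod z2)\<^sup>2 * (cmod z1 ^ 4 + cmod z2 ^ 4)) \<and>
       \<bar>\<epsilon>2 ((cmod z1)\<^sup>2, (cmod z2)\<^sup>2)\<bar> \<le> C * ((cmod z1)\<^sup>2 * (cmod z1 ^ 4 + cmod z2 ^ 4)))"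
proof -
  obtain a K where a: "0 < a" "a < a0" and K: "0 \<le> K" and \<phi>a: "\<phi>1 \<in> le_space a" "\<phi>2 \<in> le_space a"
    and solv: "\<And>m::int. harmonic_solvable V a K (e1 + of_int m * (e2 - e1))
       (if m = 0 then \<phi>1 else if m = 1 then \<phi>2 else (\<lambda>n. 0)) (1 + \<bar>of_int m\<bar>)"
    using harmonic_solvable_family[OF V less spec nonres phi1 phi2 pos(1)] by blast
  have a00: "0 \<le> a0" using pos by simp
  obtain t1 c1 where s1: "t1 0 = 0" "c1 0 = (\<lambda>n. 0)" "\<And>k. c1 k \<in> le_space a0"
    "\<And>\<rho>. 0 \<le> \<rho> \<Longrightarrow> \<rho> < \<delta>0\<^sup>2 \<Longrightarrow> summable (\<lambda>k. \<bar>t1 k\<bar> * \<rho> ^ k)"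
    "\<And>\<rho>. 0 \<le> \<rho> \<Longrightarrow> \<rho> < \<delta>0\<^sup>2 \<Longrightarrow> summable (\<lambda>k. le_norm a0 (c1 k) * \<rho> ^ k)"
    "\<And>s. \<bar>s\<bar> < \<delta>0\<^sup>2 \<Longrightarrow> (\<lambda>k. s ^ k * t1 k) sums et1 s"
    "\<And>s n. \<bar>s\<bar> < \<delta>0\<^sup>2 \<Longrightarrow> (\<lambda>k. s ^ k * c1 k n) sums q1 s n"
    by (rule bound_state_series[OF bs1 a00 pos(2)]) blast
  obtain t2 c2 where s2: "t2 0 = 0" "c2 0 = (\<lambda>n. 0)" "\<And>k. c2 k \<in> le_space a0"
    "\<And>\<rho>. 0 \<le> \<rho> \<Longrightarrow> \<rho> < \<delta>0\<^sup>2 \<Longrightarrow> summable (\<lambda>k. \<bar>t2 k\<bar> * \<rho> ^ k)"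
    "\<And>\<rho>. 0 \<le> \<rho> \<Longrightarrow> \<rho> < \<delta>0\<^sup>2 \<Longrightarrow> summable (\<lambda>k. le_norm a0 (c2 k) * \<rho> ^ k)"
    "\<And>s. \<bar>s\<bar> < \<delta>0\<^sup>2 \<Longrightarrow> (\<lambda>k. s ^ k * t2 k) sums et2 s"
    "\<And>s n. \<bar>s\<bar> < \<delta>0\<^sup>2 \<Longrightarrow> (\<lambda>k. s ^ k * c2 k n) sums q2 s n"
    by (rule bound_state_series[OF bs2 a00 pos(2)]) blast
  \<comment> \<open>A fixed radius strictly inside the domain of analyticity, at which the
    coefficient sums converge.\<close>
  define R where "R = \<delta>0 / 2"
  have R: "0 < R" "R < \<delta>0" "0 \<le> R\<^sup>2" "R\<^sup>2 < \<delta>0\<^sup>2" using pos by (auto simp: R_def power_strict_mono)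
  have ca: "c1 k \<in> le_space a" "c2 k \<in> le_space a" "le_norm a (c1 k) \<le> le_norm a0 (c1 k)" "le_norm a (c2 k) \<le> le_norm a0 (c2 k)" for k
    using le_space_mono[OF s1(3), of a k] le_space_mono[OF s2(3), of a k] a by auto
  have sq: "summable (\<lambda>k. le_norm a (c k) * (R\<^sup>2) ^ k)"
    if "summable (\<lambda>k. le_norm a0 (c k) * (R\<^sup>2) ^ k)" "\<And>k. le_norm a (c k) \<le> le_norm a0 (c k)" for c :: "nat \<Rightarrow> int \<Rightarrow> real"
    by (rule summable_comparison_test'[OF that(1), of 0]) (use that(2) in \<open>simp add: abs_mult mult_right_mono\<close>)
  note q1s = sq[OF s1(5)[OF R(3,4)] ca(3)] and q2s = sq[OF s2(5)[OF R(3,4)] ca(4)]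
  define S where "S c = (\<Sum>k. c k * (R\<^sup>2) ^ k) / R\<^sup>2" for c :: "nat \<Rightarrow> real"
  have S0: "0 \<le> S c" if "summable (\<lambda>k. c k * (R\<^sup>2) ^ k)" "\<And>k. 0 \<le> c k" for c
    unfolding S_def using that by (intro divide_nonneg_nonneg suminf_nonneg) auto
  \<comment> \<open>Only sums at the fixed radius \<open>R\<close> enter, so \<open>B\<close> is
    available before r is chosen.\<close>
  define B where "B = le_norm a \<phi>1 + le_norm a \<phi>2 + S (\<lambda>k. le_norm a (c1 k)) + S (\<lambda>k. le_norm a (c2 k)) + S (\<lambda>k. \<bar>t1 k\<bar>) + S (\<lambda>k. \<bar>t2 k\<bar>)"
  have SS: "0 \<le> S (\<lambda>k. le_norm a (c1 k))" "0 \<le> S (\<lambda>k. le_norm a (c2 k))" "0 \<le> S (\<lambda>k. \<bar>t1 k\<bar>)" "0 \<le> S (\<lambda>k. \<bar>t2 k\<bar>)"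
    by (auto intro!: S0 q1s q2s s1(4) s2(4) R(3,4))
  have B: "0 \<le> B" "S (\<lambda>k. le_norm a (c1 k)) \<le> B" "S (\<lambda>k. le_norm a (c2 k)) \<le> B" "S (\<lambda>k. \<bar>t1 k\<bar>) \<le> B" "S (\<lambda>k. \<bar>t2 k\<bar>) \<le> B"
    "le_norm a \<phi>1 + S (\<lambda>k. le_norm a (c1 k)) \<le> B" "le_norm a \<phi>2 + S (\<lambda>k. le_norm a (c2 k)) \<le> B"
    using SS le_norm_nonneg[of a \<phi>1] le_norm_nonneg[of a \<phi>2] unfolding B_def by linarith+
  define M where "M = K * (4 * B + 2 + (2 * B + 1) ^ 7)"
  have M: "0 \<le> M" using K B(1) by (simp add: M_def)
  \<comment> \<open>\<open>1 / (M + 1)\<close> gives \<open>M * r \<le> 1\<close>, which is the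
    smallness condition of the locale; the bound 1 serves to compare powers of r.\<close>
  define r where "r = min (min 1 R) (1 / (M + 1))"
  have r: "0 < r" "r \<le> 1" "r \<le> R" "r \<le> 1 / (M + 1)" using R M by (auto simp: r_def)
  have r2: "r\<^sup>2 \<le> r" using r by (simp add: power2_eq_square mult_left_le)
  have r\<delta>: "r < \<delta>0" using r(3) R(2) by simp
  have small: "M * r \<le> 1"
  proof -
    have "M * r \<le> M * (1 / (M + 1))" using r M by (intro mult_left_mono) auto
    also have "\<dots> \<le> 1" using M by simp
    finally show ?thesis .
  qed
  have ray: "vbound r a (ray1 c) (B * r\<^sup>2)" "vbound r a (ray2 c) (B * r\<^sup>2)"
    "vbound r a (ray1 (c(0 := \<phi>))) (B * r)" "vbound r a (ray2 (c(0 := \<phi>))) (B * r)"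
    if c: "\<And>k. c k \<in> le_space a" "c 0 = (\<lambda>n. 0)" "summable (\<lambda>k. le_norm a (c k) * (R\<^sup>2) ^ k)"
      and SB: "S (\<lambda>k. le_norm a (c k)) \<le> B" and \<phi>: "\<phi> \<in> le_space a" "le_norm a \<phi> + S (\<lambda>k. le_norm a (c k)) \<le> B"
    for c :: "nat \<Rightarrow> int \<Rightarrow> real" and \<phi>
  proof -
    have Sc: "0 \<le> S (\<lambda>k. le_norm a (c k))" by (rule S0[OF c(3)]) simp
    have D: "(\<Sum>k\<in>A. r ^ (2 * k) * le_norm a (c k)) \<le> r\<^sup>2 * S (\<lambda>k. le_norm a (c k))" if "finite A" for A
      unfolding S_def by (rule power_series_tail[OF _ _ c(3) r(1,3) that]) (simp_all add: c(2))
    have "r * (r\<^sup>2 * S (\<lambda>k. le_norm a (c k))) \<le> 1 * (r\<^sup>2 * B)"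
      using r SB Sc by (intro mult_mono mult_left_mono) auto
    then have le: "r * (r\<^sup>2 * S (\<lambda>k. le_norm a (c k))) \<le> B * r\<^sup>2" by (simp add: mult.commute)
    show "vbound r a (ray1 c) (B * r\<^sup>2)" "vbound r a (ray2 c) (B * r\<^sup>2)"
      using vbound_ray[OF c(1) D r(1)] le r by (auto intro: vbound_mono)
    have \<phi>c: "(c(0 := \<phi>)) k \<in> le_space a" for k using c(1) \<phi>(1) by simp
    \<comment> \<open>The entry 0 carries the eigenfunction without any power of r; this is why the
      full rays are only of order r, one less than the corrections.\<close>
    have D': "(\<Sum>k\<in>A. r ^ (2 * k) * le_norm a ((c(0 := \<phi>)) k)) \<le> B" if A: "finite A" for A
    proof -
      have "(\<Sum>k\<in>A. r ^ (2 * k) * le_norm a ((c(0 := \<phi>)) k))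
          \<le> (\<Sum>k\<in>A. (if k = 0 then le_norm a \<phi> else 0) + r ^ (2 * k) * le_norm a (c k))"
        using r by (intro sum_mono) auto
      also have "\<dots> = (\<Sum>k\<in>A. if k = 0 then le_norm a \<phi> else 0) + (\<Sum>k\<in>A. r ^ (2 * k) * le_norm a (c k))"
        by (rule sum.distrib)
      also have "(\<Sum>k\<in>A. if k = 0 then le_norm a \<phi> else 0) \<le> le_norm a \<phi>" using A by simp
      also have "(\<Sum>k\<in>A. r ^ (2 * k) * le_norm a (c k)) \<le> r\<^sup>2 * S (\<lambda>k. le_norm a (c k))" by (rule D[OF A])
      also have "\<dots> \<le> 1 * S (\<lambda>k. le_norm a (c k))" using Sc r r2 by (intro mult_right_mono) auto
      finally show ?thesis using \<phi>(2) by simp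
    qed
    show "vbound r a (ray1 (c(0 := \<phi>))) (B * r)" "vbound r a (ray2 (c(0 := \<phi>))) (B * r)"
      using vbound_ray[OF \<phi>c D' r(1)] by (simp_all only: mult.commute)
  qed
  have diag: "mbound r (\<lambda>\<mu>. \<bar>diag1 t \<mu>\<bar>) (B * r)" "mbound r (\<lambda>\<mu>. \<bar>diag2 t \<mu>\<bar>) (B * r)"
    if t: "t 0 = 0" "summable (\<lambda>k. \<bar>t k\<bar> * (R\<^sup>2) ^ k)" and SB: "S (\<lambda>k. \<bar>t k\<bar>) \<le> B" for t
  proof -
    have St: "0 \<le> S (\<lambda>k. \<bar>t k\<bar>)" by (rule S0[OF t(2)]) simp
    have D: "(\<Sum>k\<in>A. r ^ (2 * k) * \<bar>t k\<bar>) \<le> B * r" if "finite A" for A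
    proof -
      have "(\<Sum>k\<in>A. r ^ (2 * k) * \<bar>t k\<bar>) \<le> r\<^sup>2 * S (\<lambda>k. \<bar>t k\<bar>)"
        unfolding S_def by (rule power_series_tail[OF _ _ t(2) r(1,3) that]) (simp_all add: t(1))
      also have "\<dots> \<le> r * B" using r r2 SB St by (intro mult_mono) auto
      finally show ?thesis by (simp add: mult.commute)
    qed
    show "mbound r (\<lambda>\<mu>. \<bar>diag1 t \<mu>\<bar>) (B * r)" "mbound r (\<lambda>\<mu>. \<bar>diag2 t \<mu>\<bar>) (B * r)"
      by (rule mbound_diag[OF D r(1)], assumption)+
  qed
  note ray1s = ray[OF ca(1) s1(2) q1s B(2) \<phi>a(1) B(6)] and ray2s = ray[OF ca(2) s2(2) q2s B(3) \<phi>a(2) B(7)]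
  have lt: "\<bar>s\<bar> < \<delta>0\<^sup>2" if "\<bar>s\<bar> \<le> r\<^sup>2" for s
    using that power_strict_mono[OF r\<delta>, of 2] r(1) by simp
  have zb: "z \<in> ball 0 \<delta>0" if "cmod z \<le> r" for z using that r\<delta> by simp
  interpret fam: two_mode_family V e1 e2 a K B r \<phi>1 \<phi>2 t1 t2 c1 c2 et1 et2 q1 q2
  proof
    show "K * (4 * B + 2 + (2 * B + 1) ^ 7) * r \<le> 1" using small by (simp only: M_def)
    show "mbound r (\<lambda>\<mu>. \<bar>diag1 t1 \<mu>\<bar>) (B * r)" by (rule diag(1)[OF s1(1) s1(4)[OF R(3,4)] B(4)])
    show "mbound r (\<lambda>\<mu>. \<bar>diag2 t2 \<mu>\<bar>) (B * r)" by (rule diag(2)[OF s2(1) s2(4)[OF R(3,4)] B(5)])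
    show "schroedinger V (bound_state \<phi>1 q1 z) n - of_real (e1 + et1 ((cmod z)\<^sup>2)) * bound_state \<phi>1 q1 z n
      + of_real (cmod (bound_state \<phi>1 q1 z n) ^ 6) * bound_state \<phi>1 q1 z n = 0" if "cmod z \<le> r" for z n
      using bs1 zb[OF that] unfolding bound_state_family_def by blast
    show "schroedinger V (bound_state \<phi>2 q2 z) n - of_real (e2 + et2 ((cmod z)\<^sup>2)) * bound_state \<phi>2 q2 z n
      + of_real (cmod (bound_state \<phi>2 q2 z n) ^ 6) * bound_state \<phi>2 q2 z n = 0" if "cmod z \<le> r" for z n
      using bs2 zb[OF that] unfolding bound_state_family_def by blast
  qed (fact a(1) r(1,2) K B(1) solv s1(1,2) s2(1,2) ray1s(1,3) ray2s(2,4) | rule s1(6,7) s2(6,7), erule lt)+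
  obtain \<psi> \<epsilon>1 \<epsilon>2 where X: "fam.invar (\<psi>, \<epsilon>1, \<epsilon>2)" and eq: "fam.solves (\<psi>, \<epsilon>1, \<epsilon>2)"
    by (rule fam.solution_exists)
  have \<epsilon>: "mbound r (\<lambda>\<mu>. \<bar>\<epsilon>1 \<mu>\<bar>) r" "mbound r (\<lambda>\<mu>. \<bar>\<epsilon>2 \<mu>\<bar>) r" using X by auto
  have charge: "charge \<mu> = 1" if "\<psi> \<mu> n \<noteq> 0" for \<mu> n using X that by (auto simp: admissible_def)
  define C where "C = r\<^sup>2 / r ^ 7 + r / r ^ 6"
  have C: "r\<^sup>2 / r ^ 7 \<le> C" "r / r ^ 6 \<le> C" using r by (auto simp: C_def)
  have est: "le_norm a (evs \<psi> (z1, z2)) \<le> C * (cmod z1 * cmod z2 * (cmod z1 ^ 5 + cmod z2 ^ 5))"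
    "\<bar>evm \<epsilon>1 ((cmod z1)\<^sup>2, (cmod z2)\<^sup>2)\<bar> \<le> C * ((cmod z2)\<^sup>2 * (cmod z1 ^ 4 + cmod z2 ^ 4))"
    "\<bar>evm \<epsilon>2 ((cmod z1)\<^sup>2, (cmod z2)\<^sup>2)\<bar> \<le> C * ((cmod z1)\<^sup>2 * (cmod z1 ^ 4 + cmod z2 ^ 4))"
    if "(z1, z2) \<in> ball 0 r" for z1 z2
  proof -
    have z: "(z1, z2) \<in> bidisc r" using that by (rule ball_bidisc) simp
    show "le_norm a (evs \<psi> (z1, z2)) \<le> C * (cmod z1 * cmod z2 * (cmod z1 ^ 5 + cmod z2 ^ 5))"
      by (rule order_trans[OF fam.psi_estimate[OF X z] mult_right_mono[OF C(1)]]) simp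
    show "\<bar>evm \<epsilon>1 ((cmod z1)\<^sup>2, (cmod z2)\<^sup>2)\<bar> \<le> C * ((cmod z2)\<^sup>2 * (cmod z1 ^ 4 + cmod z2 ^ 4))"
      by (rule order_trans[OF fam.epsilon_estimate(1)[OF X z] mult_right_mono[OF C(2)]]) simp
    show "\<bar>evm \<epsilon>2 ((cmod z1)\<^sup>2, (cmod z2)\<^sup>2)\<bar> \<le> C * ((cmod z1)\<^sup>2 * (cmod z1 ^ 4 + cmod z2 ^ 4))"
      by (rule order_trans[OF fam.epsilon_estimate(2)[OF X z] mult_right_mono[OF C(2)]]) simp
  qed
  have ana: "analytic_on_ball (le_space a) (le_norm a) r (evs \<psi>)"
    "analytic_on_ball UNIV norm (r\<^sup>2) (evm \<epsilon>1)" "analytic_on_ball UNIV norm (r\<^sup>2) (evm \<epsilon>2)"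
    using a(1) by (auto intro!: analytic_evs[OF fam.inv_psi_bound(1)[OF X] r(1)] analytic_evm[OF _ r(1)] \<epsilon>)
  show ?thesis
    by (rule exI[of _ a], rule exI[of _ r], rule exI[of _ "evs \<psi>"], rule exI[of _ "evm \<epsilon>1"], rule exI[of _ "evm \<epsilon>2"],
        intro conjI a r(1) r\<delta> ana, intro allI impI, elim conjE, rule fam.evolution[OF X eq], blast, blast, blast, blast, blast,
        intro allI impI evs_gauge[symmetric], erule charge, intro exI[of _ C] allI impI conjI est)
qed

end
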